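(* Let $m\ge 2$ and $\mathcal{T}=(t_{i_1\ldots i_m})\in\mathbb{T}(\mathbb{C}^2,m)$. Then $$\mathrm{Edet}(\mathcal{T})=\sum_{i=1}^{2(m-1)}\frac{1}{i!}\sum_{d_j>0,\ \sum_{j=1}^id_j=2(m-1)}\ \prod_{j=1}^i\frac{-\mathrm{Tr}_{d_j}(\mathcal{T})}{d_j},$$ where, for $d\in\{1,\ldots,2(m-1)\}$, $$\mathrm{Tr}_d(\mathcal{T})=(m-1)\left\{t_{11\ldots1}^d+t_{22\ldots2}^d+\sum_{h+k=d,\ h,k\ge1}\ \sum_{s=1}^{\min\{h,k\}(m-1)}\frac{s(h+k)}{hk(m-1)}\sum_{\substack{(a_1,\ldots,a_h)\in\mathbb{D}^s\\(b_1,\ldots,b_k)\in\mathbb{E}^s}}\left(\prod_{p=1}^h\alpha_{a_p}\right)\left(\prod_{q=1}^k\beta_{b_q}\right)\right\}.$$ Here, for $0\le a,b\le m-1$, $\alpha_a$ is the sum of $t_{1i_2\ldots i_m}$ over all $(i_2,\ldots,i_m)\in\{1,2\}^{m-1}$ with exactly $a$ entries equal to $2$, $\beta_b$ is the sum of $t_{2j_2\ldots j_m}$ over all $(j_2,\ldots,j_m)\in\{1,2\}^{m-1}$ with exactly $b$ entries equal to $1$, $\mathbb{D}^s=\{(a_1,\ldots,a_h)\in\mathbb{Z}^h: a_1+\cdots+a_h=s,\ 0\le a_p\le m-1\}$ and $\mathbb{E}^s=\{(b_1,\ldots,b_k)\in\mathbb{Z}^k: b_1+\cdots+b_k=s,\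 0\le b_q\le m-1\}$.
   Context: $\mathbb{T}(\mathbb{C}^n,m)$ is the space of $m$-th order $n$-dimensional complex tensors $\mathcal{T}=(t_{i_1\ldots i_m})$, $1\le i_1,\ldots,i_m\le n$. For $\mathbf{x}\in\mathbb{C}^n$, $\mathcal{T}\mathbf{x}^{m-1}\in\mathbb{C}^n$ has $i$-th entry $\sum_{i_2,\ldots,i_m=1}^n t_{ii_2\ldots i_m}x_{i_2}\cdots x_{i_m}$. The resultant $\mathrm{Res}$ of $n$ homogeneous polynomials in $n$ variables, each of degree $m-1$, is the irreducible polynomial in their coefficients that vanishes if and only if the polynomials have a common zero in $\mathbb{C}^n\setminus\{\mathbf{0}\}$, normalized by $\mathrm{Res}(x_1^{m-1},\ldots,x_n^{m-1})=1$. $\mathrm{Edet}(\mathcal{T})$ is the resultant of the $n$ components of $\mathcal{T}\mathbf{x}^{m-1}$ (here $n=2$). *)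

theory Defs
  imports
    "HOL-Analysis.Analysis"
    "HOL-Library.Poly_Mapping"
    "HOL-Computational_Algebra.Computational_Algebra"
begin

text \<open>
  Multivariate polynomials with variables in \<open>'v\<close> and coefficients in \<open>'a\<close>: a monomial is its
  exponent vector \<open>'v \<Rightarrow>\<^sub>0 nat\<close>, and the ring operations are those of \<^theory>\<open>HOL-Library.Poly_Mapping\<close>
  (convolution product).
\<close>

type_synonym ('v, 'a) mpoly = "('v \<Rightarrow>\<^sub>0 nat) \<Rightarrow>\<^sub>0 'a"

definition mpoly_var :: "'v \<Rightarrow> ('v, 'a::comm_semiring_1) mpoly" where
  "mpoly_var v = Poly_Mapping.single (Poly_Mapping.single v 1) 1"

definition mpoly_const :: "'a::comm_semiring_1 \<Rightarrow> ('v, 'a) mpoly" where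
  "mpoly_const c = Poly_Mapping.single 0 c"

definition mpoly_eval :: "('v \<Rightarrow> 'a::comm_semiring_1) \<Rightarrow> ('v, 'a) mpoly \<Rightarrow> 'a" where
  "mpoly_eval f p =
     (\<Sum>e\<in>Poly_Mapping.keys p. Poly_Mapping.lookup p e *
        (\<Prod>v\<in>Poly_Mapping.keys e. f v ^ Poly_Mapping.lookup e v))"

definition mpoly_vars :: "('v, 'a::comm_semiring_1) mpoly \<Rightarrow> 'v set" where
  "mpoly_vars p = (\<Union>e\<in>Poly_Mapping.keys p. Poly_Mapping.keys e)"

definition exponents_of_degree :: "nat \<Rightarrow> ('n::finite \<Rightarrow>\<^sub>0 nat) set" where
  "exponents_of_degree D = {e. (\<Sum>i\<in>UNIV. Poly_Mapping.lookup e i) = D}"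

definition homogeneous_of_degree :: "nat \<Rightarrow> ('n::finite, complex) mpoly \<Rightarrow> bool" where
  "homogeneous_of_degree D p \<longleftrightarrow> Poly_Mapping.keys p \<subseteq> exponents_of_degree D"

text \<open>
  The resultant of \<open>n\<close> forms of degree \<open>D\<close> in \<open>n\<close> variables (both indexed by the finite type \<open>'n\<close>) is
  a polynomial in their coefficients; the variable \<open>(i, e)\<close> stands for the coefficient of the
  monomial with exponent vector \<open>e\<close> in the \<open>i\<close>-th form.
\<close>

definition coeffs_of_system :: "('n::finite \<Rightarrow> ('n, complex) mpoly) \<Rightarrow> 'n \<times> ('n \<Rightarrow>\<^sub>0 nat) \<Rightarrow> complex" where
  "coeffs_of_system F = (\<lambda>(i, e). Poly_Mapping.lookup (F i) e)"

definition is_resultant_poly ::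
  "nat \<Rightarrow> ('n::finite \<times> ('n \<Rightarrow>\<^sub>0 nat), complex) mpoly \<Rightarrow> bool" where
  "is_resultant_poly D R \<longleftrightarrow>
     mpoly_vars R \<subseteq> UNIV \<times> exponents_of_degree D \<and>
     irreducible R \<and>
     (\<forall>F :: 'n \<Rightarrow> ('n, complex) mpoly. (\<forall>i. homogeneous_of_degree D (F i)) \<longrightarrow>
        (mpoly_eval (coeffs_of_system F) R = 0 \<longleftrightarrow>
          (\<exists>x :: complex ^ 'n. x \<noteq> 0 \<and> (\<forall>i. mpoly_eval (\<lambda>j. x $ j) (F i) = 0)))) \<and>
     mpoly_eval (coeffs_of_system (\<lambda>i. mpoly_var i ^ D)) R = 1"

text \<open>
  For \<open>D \<ge> 1\<close> exactly one polynomial satisfies \<open>is_resultant_poly D\<close>: existence is the classical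
  theorem on resultants, and uniqueness follows from the Nullstellensatz.
\<close>

definition resultant_poly :: "nat \<Rightarrow> ('n::finite \<times> ('n \<Rightarrow>\<^sub>0 nat), complex) mpoly" where
  "resultant_poly D = (THE R. is_resultant_poly D R)"

definition Res :: "nat \<Rightarrow> ('n::finite \<Rightarrow> ('n, complex) mpoly) \<Rightarrow> complex" where
  "Res D F = mpoly_eval (coeffs_of_system F) (resultant_poly D)"

text \<open>
  An \<open>m\<close>-th order tensor is a function on index lists, of which only the values at lists of length
  \<open>m\<close> are relevant. \<open>tensor_form m T i\<close> is the \<open>i\<close>-th component of \<open>T x\<^sup>m\<^sup>-\<^sup>1\<close>, as a polynomial in \<open>x\<close>.
\<close>

definition tensor_form :: "nat \<Rightarrow> ('n::finite list \<Rightarrow> complex) \<Rightarrow> 'n \<Rightarrow> ('n, complex) mpoly" where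
  "tensor_form m T i =
     (\<Sum>is | length is = m - 1. mpoly_const (T (i # is)) * (\<Prod>j\<leftarrow>is. mpoly_var j))"

definition Edet :: "nat \<Rightarrow> ('n::finite list \<Rightarrow> complex) \<Rightarrow> complex" where
  "Edet m T = Res (m - 1) (tensor_form m T)"

text \<open>
  Dimension 2: the index type \<open>2\<close> has exactly the two elements \<open>1\<close> and \<open>2\<close> (with \<open>2 = 0\<close>).
\<close>

definition tensor_alpha :: "nat \<Rightarrow> (2 list \<Rightarrow> complex) \<Rightarrow> nat \<Rightarrow> complex" where
  "tensor_alpha m T a = (\<Sum>is | length is = m - 1 \<and> count_list is 2 = a. T (1 # is))"

definition tensor_beta :: "nat \<Rightarrow> (2 list \<Rightarrow> complex) \<Rightarrow> nat \<Rightarrow> complex" where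
  "tensor_beta m T b = (\<Sum>js | length js = m - 1 \<and> count_list js 1 = b. T (2 # js))"

text \<open>
  The sets \<open>\<D>\<^sup>s\<close> (for \<open>l = h\<close>) and \<open>\<E>\<^sup>s\<close> (for \<open>l = k\<close>).
\<close>

definition bounded_tuples :: "nat \<Rightarrow> nat \<Rightarrow> nat \<Rightarrow> nat list set" where
  "bounded_tuples m l s = {as. length as = l \<and> sum_list as = s \<and> (\<forall>a\<in>set as. a \<le> m - 1)}"

definition tensor_Tr :: "nat \<Rightarrow> (2 list \<Rightarrow> complex) \<Rightarrow> nat \<Rightarrow> complex" where
  "tensor_Tr m T d = of_nat (m - 1) *
     (T (replicate m 1) ^ d + T (replicate m 2) ^ d +
      (\<Sum>(h, k) | h + k = d \<and> h \<ge> 1 \<and> k \<ge> 1.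
         \<Sum>s = 1..min h k * (m - 1).
           of_nat (s * (h + k)) / of_nat (h * k * (m - 1)) *
           (\<Sum>(as, bs) \<in> bounded_tuples m h s \<times> bounded_tuples m k s.
              (\<Prod>a\<leftarrow>as. tensor_alpha m T a) * (\<Prod>b\<leftarrow>bs. tensor_beta m T b))))"

end

theory Submission
  imports Defs
begin

text \<open>
  Let \<open>F\<^sub>1\<close>, \<open>F\<^sub>2\<close> be the components of \<open>T x\<^bsup>m-1\<^esup>\<close>, \<open>D = m - 1\<close>, \<open>A(z) = F\<^sub>1(1, z)\<close> and \<open>B(w) = F\<^sub>2(w, 1)\<close>.
  For small \<open>t\<close> write \<open>1 - t A(z) = u \<Prod>\<^sub>i (1 - w\<^sub>i z)\<close> and \<open>1 - t B(w) = v \<Prod>\<^sub>j (1 - z\<^sub>j w)\<close>. The resultant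
  \<open>E(t)\<close> of \<open>x\<^sup>D - t F\<^sub>1\<close> and \<open>y\<^sup>D - t F\<^sub>2\<close> is \<open>u\<^sup>D v\<^sup>D \<Prod>\<^sub>i\<^sub>j (1 - w\<^sub>i z\<^sub>j)\<close>. Expanding its logarithm into power
  sums of the \<open>w\<^sub>i\<close> and \<open>z\<^sub>j\<close>, which are read off from \<open>log (1 - t A)\<close> and \<open>log (1 - t B)\<close>, gives
  \<open>E(t) = exp (- \<Sum>\<^sub>d Tr\<^sub>d(T) t\<^sup>d / d)\<close>. As \<open>E\<close> is a polynomial of degree at most \<open>2 D\<close> whose top coefficient
  is the resultant of \<open>F\<^sub>1\<close> and \<open>F\<^sub>2\<close>, the claimed expression equals the product of \<open>F\<^sub>2\<close> over the zeros
  of \<open>F\<^sub>1\<close>.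

  The claimed expression, a polynomial \<open>R\<close> in the coefficients, is therefore a resultant: its zero set
  is the polynomial image of an affine space, and pseudo-division by \<open>R\<close> in one variable shows that \<open>R\<close>
  divides every polynomial vanishing on that set. This gives irreducibility of \<open>R\<close> and uniqueness of
  the resultant.
\<close>

subsection \<open>Polynomial functions\<close>

text \<open>\<open>Edet\<close> rests on a definite description, so nothing can be computed from
  \<open>resultant_poly\<close> until the claimed expression is known to satisfy
  \<open>is_resultant_poly\<close> and to be the only such polynomial. Most arguments use polynomial
  functions instead of formal polynomials: an identity can then be tested along a line or curve,
  where it concerns one complex variable.

  The pencil is chosen so that t = 0 gives the normalizing system, with resultant 1; hence the
  logarithm exists near 0. The resultant has degree D in the coefficients of each form, so the top
  power is t^(2 D) and the sign is (-1)^(2 D) = 1.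

  Two obstacles shape the proof. The reciprocal roots w_i and z_j are not polynomial in t, so
  polynomiality of E needs its own argument. And reciprocal roots require A(0) \<noteq> 0; linear
  factors P - Q z, with projective zero (Q, P), together with a deformation of the P, extend the
  product formula to all A, including those of lower degree and A = 0.\<close>

definition univ_polyfun :: "(complex \<Rightarrow> complex) \<Rightarrow> bool" where
  "univ_polyfun f \<longleftrightarrow> (\<exists>p. f = poly p)"

lemma univ_polyfun_const [intro]: "univ_polyfun (\<lambda>_. c)"
  unfolding univ_polyfun_def by (rule exI[of _ "[:c:]"]) auto

lemma univ_polyfun_ident [intro]: "univ_polyfun (\<lambda>t. t)"
  unfolding univ_polyfun_def by (rule exI[of _ "[:0, 1:]"]) auto

lemma univ_polyfun_add [intro]:
  assumes "univ_polyfun f" "univ_polyfun g"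
  shows "univ_polyfun (\<lambda>t. f t + g t)"
proof -
  from assms obtain p q where "f = poly p" "g = poly q"
    by (auto simp: univ_polyfun_def)
  then show ?thesis
    unfolding univ_polyfun_def by (intro exI[of _ "p + q"]) auto
qed

lemma univ_polyfun_mult [intro]:
  assumes "univ_polyfun f" "univ_polyfun g"
  shows "univ_polyfun (\<lambda>t. f t * g t)"
proof -
  from assms obtain p q where "f = poly p" "g = poly q"
    by (auto simp: univ_polyfun_def)
  then show ?thesis
    unfolding univ_polyfun_def by (intro exI[of _ "p * q"]) auto
qed

lemma univ_polyfun_diff [intro]:
  assumes "univ_polyfun f" "univ_polyfun g"
  shows "univ_polyfun (\<lambda>t. f t - g t)"
proof -
  from assms obtain p q where "f = poly p" "g = poly q"
    by (auto simp: univ_polyfun_def)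
  then show ?thesis
    unfolding univ_polyfun_def by (intro exI[of _ "p - q"]) auto
qed

lemma univ_polyfun_sum [intro]:
  "(\<And>i. i \<in> I \<Longrightarrow> univ_polyfun (f i)) \<Longrightarrow> univ_polyfun (\<lambda>t. \<Sum>i\<in>I. f i t)"
  by (induction I rule: infinite_finite_induct) auto

lemma univ_polyfun_prod [intro]:
  "(\<And>i. i \<in> I \<Longrightarrow> univ_polyfun (f i)) \<Longrightarrow> univ_polyfun (\<lambda>t. \<Prod>i\<in>I. f i t)"
  by (induction I rule: infinite_finite_induct) auto

lemma univ_polyfun_power [intro]:
  "univ_polyfun f \<Longrightarrow> univ_polyfun (\<lambda>t. f t ^ n)"
  by (induction n) auto

lemmas univ_polyfun_intros =
  univ_polyfun_const univ_polyfun_ident univ_polyfun_add univ_polyfun_mult univ_polyfun_diff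
  univ_polyfun_sum univ_polyfun_prod univ_polyfun_power

lemma univ_polyfun_zeros_finite:
  assumes "univ_polyfun f" "f t0 \<noteq> 0"
  shows "finite {t. f t = 0}"
proof -
  from assms obtain p where p: "f = poly p" by (auto simp: univ_polyfun_def)
  with assms(2) have "p \<noteq> 0" by auto
  then show ?thesis using poly_roots_finite[of p] p by simp
qed

text \<open>Identity principle: a nonzero polynomial in one variable has finitely many zeros. Later
  genericity arguments are reduced to this by restricting to a curve through the given
  point.\<close>

lemma univ_polyfun_vanishes:
  assumes f: "univ_polyfun f" and g: "univ_polyfun g" and "g t0 \<noteq> 0"
    and "\<And>t. g t \<noteq> 0 \<Longrightarrow> f t = 0"
  shows "f t = 0"
proof (rule ccontr)
  assume "f t \<noteq> 0"
  then have "finite {t. f t = 0}" "finite {t. g t = 0}"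
    using univ_polyfun_zeros_finite assms by blast+
  moreover have "UNIV = {t. f t = 0} \<union> {t. g t = 0}" using assms(4) by auto
  ultimately have "finite (UNIV :: complex set)" by (metis finite_UnI)
  then show False using infinite_UNIV_char_0 by blast
qed

text \<open>Products are generated one variable at a time, so that inductions only meet
  multiplication by a single variable; this is the natural step of pseudo-division. \<open>S\<close>
  bounds the variables that occur.\<close>

inductive polyfun :: "'v set \<Rightarrow> (('v \<Rightarrow> complex) \<Rightarrow> complex) \<Rightarrow> bool" for S where
  const: "polyfun S (\<lambda>x. c)"
| add: "polyfun S f \<Longrightarrow> polyfun S g \<Longrightarrow> polyfun S (\<lambda>x. f x + g x)"
| var_mult: "v \<in> S \<Longrightarrow> polyfun S f \<Longrightarrow> polyfun S (\<lambda>x. x v * f x)"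

lemma polyfun_cmult:
  assumes "polyfun S f"
  shows "polyfun S (\<lambda>x. c * f x)"
  using assms
proof induction
  case (add f g)
  then show ?case using polyfun.add[OF add.IH] by (simp add: algebra_simps)
next
  case (var_mult v f)
  then show ?case using polyfun.var_mult[OF var_mult(1,3)] by (simp add: algebra_simps)
qed (rule polyfun.const)

lemma polyfun_mult:
  assumes "polyfun S f" "polyfun S g"
  shows "polyfun S (\<lambda>x. f x * g x)"
  using assms(1)
proof induction
  case (const c)
  then show ?case using polyfun_cmult[OF assms(2)] .
next
  case (add f g)
  then show ?case using polyfun.add[OF add.IH] by (simp add: algebra_simps)
next
  case (var_mult v f)
  then show ?case using polyfun.var_mult[OF var_mult(1,3)] by (simp add: algebra_simps)
qed

lemma polyfun_var: "v \<in> S \<Longrightarrow> polyfun S (\<lambda>x. x v)"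
  using polyfun.var_mult[OF _ polyfun.const[of S 1], of v] by simp

lemma polyfun_diff: "polyfun S f \<Longrightarrow> polyfun S g \<Longrightarrow> polyfun S (\<lambda>x. f x - g x)"
  using polyfun.add[OF _ polyfun_cmult[of S g "-1"], of f] by simp

lemma polyfun_sum:
  "(\<And>i. i \<in> I \<Longrightarrow> polyfun S (f i)) \<Longrightarrow> polyfun S (\<lambda>x. \<Sum>i\<in>I. f i x)"
  by (induction I rule: infinite_finite_induct) (auto intro: polyfun.intros)

lemma polyfun_prod:
  "(\<And>i. i \<in> I \<Longrightarrow> polyfun S (f i)) \<Longrightarrow> polyfun S (\<lambda>x. \<Prod>i\<in>I. f i x)"
  by (induction I rule: infinite_finite_induct) (auto intro: polyfun.const polyfun_mult)

lemma polyfun_prod_list: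
  "(\<And>i. i \<in> set xs \<Longrightarrow> polyfun S (f i)) \<Longrightarrow> polyfun S (\<lambda>x. \<Prod>i\<leftarrow>xs. f i x)"
  by (induction xs) (auto intro: polyfun.const polyfun_mult)

lemma polyfun_power: "polyfun S f \<Longrightarrow> polyfun S (\<lambda>x. f x ^ n)"
  by (induction n) (auto intro: polyfun.const polyfun_mult)

lemmas polyfun_intros =
  polyfun.const polyfun.add polyfun_mult polyfun_diff polyfun_sum polyfun_prod
  polyfun_prod_list polyfun_power

lemma polyfun_mono: "polyfun S f \<Longrightarrow> S \<subseteq> S' \<Longrightarrow> polyfun S' f"
  by (induction rule: polyfun.induct) (auto intro: polyfun.intros)

lemma polyfun_cong_on:
  assumes "polyfun S f" "\<And>v. v \<in> S \<Longrightarrow> x v = y v"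
  shows "f x = f y"
  using assms by (induction rule: polyfun.induct) auto

lemma polyfun_along:
  assumes "polyfun S f" "\<And>v. v \<in> S \<Longrightarrow> univ_polyfun (\<lambda>t. g t v)"
  shows "univ_polyfun (\<lambda>t. f (g t))"
  using assms by (induction rule: polyfun.induct) auto

lemma polyfun_restrict:
  assumes "polyfun S f"
  shows "polyfun (S - {v}) (\<lambda>x. f (x(v := c)))"
  using assms
proof induction
  case (var_mult w f)
  show ?case
  proof (cases "w = v")
    case True
    then show ?thesis using polyfun_cmult[OF var_mult.IH, of c] by simp
  next
    case False
    then have "w \<in> S - {v}" using var_mult by auto
    from polyfun.var_mult[OF this var_mult.IH] False show ?thesis by simp
  qed
qed (auto intro: polyfun.intros)

text \<open>The product is nonzero on a line through two points where the factors do not vanish.\<close>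

lemma polyfun_mult_eq_0:
  fixes f g :: "('v \<Rightarrow> complex) \<Rightarrow> complex"
  assumes f: "polyfun S f" and g: "polyfun S' g"
    and 0: "\<And>x. f x * g x = 0" and y: "g y \<noteq> 0"
  shows "f x = 0"
proof -
  define l where "l = (\<lambda>t v. x v + t * (y v - x v))"
  have l: "univ_polyfun (\<lambda>t. l t v)" for v unfolding l_def by (intro univ_polyfun_intros)
  have l0: "l 0 = x" and l1: "l 1 = y" by (auto simp: l_def)
  have "f (l 0) = 0"
  proof (rule univ_polyfun_vanishes[where f = "\<lambda>t. f (l t)" and g = "\<lambda>t. g (l t)" and ?t0.0 = 1])
    show "univ_polyfun (\<lambda>t. f (l t))" "univ_polyfun (\<lambda>t. g (l t))"
      using polyfun_along[OF f] polyfun_along[OF g] l by auto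
    show "g (l 1) \<noteq> 0" using y l1 by simp
    show "f (l t) = 0" if "g (l t) \<noteq> 0" for t using 0[of "l t"] that by simp
  qed
  then show ?thesis using l0 by simp
qed

text \<open>On the line through \<open>x\<close> and \<open>y\<close> both factors are univariate
  polynomials with product 1, hence of degree 0. Later this makes the quotient of two resultants a
  constant.\<close>

lemma polyfun_unit_const:
  fixes f g :: "('v \<Rightarrow> complex) \<Rightarrow> complex"
  assumes f: "polyfun S f" and g: "polyfun S g" and 1: "\<And>x. f x * g x = 1"
  shows "f x = f y"
proof -
  define l where "l = (\<lambda>t v. x v + t * (y v - x v))"
  have l: "univ_polyfun (\<lambda>t. l t v)" for v unfolding l_def by (intro univ_polyfun_intros)
  have l0: "l 0 = x" and l1: "l 1 = y" by (auto simp: l_def)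
  have "univ_polyfun (\<lambda>t. f (l t))" "univ_polyfun (\<lambda>t. g (l t))"
    using polyfun_along[OF f] polyfun_along[OF g] l by auto
  then obtain p q where p: "(\<lambda>t. f (l t)) = poly p" and q: "(\<lambda>t. g (l t)) = poly q"
    unfolding univ_polyfun_def by blast
  have "poly (p * q) t = poly 1 t" for t
    using 1[of "l t"] fun_cong[OF p, of t] fun_cong[OF q, of t] by simp
  then have "p * q = 1" by (metis poly_eq_poly_eq_iff ext)
  then have "degree p = 0"
    by (metis degree_mult_eq degree_1 add_is_0 mult_zero_left mult_zero_right one_neq_zero)
  then obtain c where "p = [:c:]" using degree_eq_zeroE by blast
  then show ?thesis using fun_cong[OF p, of 0] fun_cong[OF p, of 1] l0 l1 by simp
qed

text \<open>Since the \<open>c i\<close> avoid \<open>v\<close>, changing \<open>v\<close> alone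
  leaves them fixed and yields a genuine polynomial in one variable. \<open>N\<close> is only an
  upper bound for its degree.\<close>

lemma polyfun_expand:
  assumes "polyfun S f"
  shows "\<exists>N c. (\<forall>i. polyfun (S - {v}) (c i)) \<and> (\<forall>x. f x = (\<Sum>i\<le>N. c i x * x v ^ i))"
  using assms
proof induction
  case (const c)
  show ?case
    by (rule exI[of _ 0], rule exI[of _ "\<lambda>_ _. c"]) (auto intro: polyfun.const)
next
  case (add f g)
  from add.IH obtain N c M d where
    c: "\<And>i. polyfun (S - {v}) (c i)" "\<And>x. f x = (\<Sum>i\<le>N. c i x * x v ^ i)" and
    d: "\<And>i. polyfun (S - {v}) (d i)" "\<And>x. g x = (\<Sum>i\<le>M. d i x * x v ^ i)"
    by blast
  define e where "e = (\<lambda>i x. (if i \<le> N then c i x else 0) + (if i \<le> M then d i x else 0))"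
  have f: "f x = (\<Sum>i\<le>max N M. (if i \<le> N then c i x else 0) * x v ^ i)" for x
    unfolding c(2) by (rule sum.mono_neutral_cong_left) auto
  have g: "g x = (\<Sum>i\<le>max N M. (if i \<le> M then d i x else 0) * x v ^ i)" for x
    unfolding d(2) by (rule sum.mono_neutral_cong_left) auto
  have "polyfun (S - {v}) (e i)" for i
    unfolding e_def using c(1) d(1)
    by (cases "i \<le> N"; cases "i \<le> M"; simp add: polyfun.const polyfun.add)
  moreover have "f x + g x = (\<Sum>i\<le>max N M. e i x * x v ^ i)" for x
    unfolding f g e_def by (simp add: sum.distrib ring_distribs)
  ultimately show ?case by (intro exI[of _ "max N M"] exI[of _ e]) simp
next
  case (var_mult w f)
  from var_mult.IH obtain N c where
    c: "\<And>i. polyfun (S - {v}) (c i)" "\<And>x. f x = (\<Sum>i\<le>N. c i x * x v ^ i)"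
    by blast
  show ?case
  proof (cases "w = v")
    case True
    define e where "e = (\<lambda>i. case i of 0 \<Rightarrow> (\<lambda>_. 0) | Suc j \<Rightarrow> c j)"
    have "polyfun (S - {v}) (e i)" for i
      unfolding e_def using c(1) by (cases i) (auto intro: polyfun.const)
    moreover have "x w * f x = (\<Sum>i\<le>Suc N. e i x * x v ^ i)" for x
      unfolding c(2) sum.atMost_Suc_shift e_def using True
      by (simp add: sum_distrib_left mult_ac)
    ultimately show ?thesis by (intro exI[of _ "Suc N"] exI[of _ e]) simp
  next
    case False
    then have w: "w \<in> S - {v}" using var_mult by auto
    have "polyfun (S - {v}) (\<lambda>x. x w * c i x)" for i
      using polyfun.var_mult[OF w c(1)] .
    moreover have "x w * f x = (\<Sum>i\<le>N. (x w * c i x) * x v ^ i)" for x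
      unfolding c(2) by (simp add: sum_distrib_left mult_ac)
    ultimately show ?thesis
      by (intro exI[of _ N] exI[of _ "\<lambda>i x. x w * c i x"] conjI allI)
  qed
qed

text \<open>Division by the variable \<open>v\<close>: vanishing on the hyperplane
  \<open>x v = 0\<close> becomes divisibility by \<open>x v\<close>, as needed in
  \<open>cancel_av_0\<close>.\<close>

lemma polyfun_factor_var:
  assumes "polyfun UNIV f"
  shows "\<exists>g. polyfun UNIV g \<and> (\<forall>x. f x = f (x(v := 0)) + x v * g x)"
  using assms
proof induction
  case (const c)
  show ?case by (rule exI[of _ "\<lambda>_. 0"]) (auto intro: polyfun.const)
next
  case (add f g)
  from add.IH obtain f' g' where *: "polyfun UNIV f'" "polyfun UNIV g'"
    "\<And>x. f x = f (x(v := 0)) + x v * f' x" "\<And>x. g x = g (x(v := 0)) + x v * g' x"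
    by blast
  have "f x + g x = (f (x(v := 0)) + g (x(v := 0))) + x v * (f' x + g' x)" for x
    using *(3,4)[of x] by (simp add: ring_distribs)
  then show ?case
    by (intro exI[of _ "\<lambda>x. f' x + g' x"] conjI polyfun.add *(1,2) allI)
next
  case (var_mult w f)
  show ?case
  proof (cases "w = v")
    case True
    then show ?thesis using var_mult(2) by (intro exI[of _ f] conjI allI) simp_all
  next
    case False
    from var_mult.IH obtain f' where f': "polyfun UNIV f'" "\<And>x. f x = f (x(v := 0)) + x v * f' x"
      by blast
    have "x w * f x = (x(v := 0)) w * f (x(v := 0)) + x v * (x w * f' x)" for x
      using f'(2)[of x] False by (simp add: ring_distribs)
    moreover have "polyfun UNIV (\<lambda>x. x w * f' x)"
      using f'(1) by (intro polyfun.var_mult) simp_all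
    ultimately show ?thesis by (intro exI[of _ "\<lambda>x. x w * f' x"] conjI allI)
  qed
qed

subsection \<open>Multivariate polynomials and their polynomial functions\<close>

definition monom_eval :: "('v \<Rightarrow> 'a::comm_semiring_1) \<Rightarrow> ('v \<Rightarrow>\<^sub>0 nat) \<Rightarrow> 'a" where
  "monom_eval f e = (\<Prod>v\<in>Poly_Mapping.keys e. f v ^ Poly_Mapping.lookup e v)"

lemma monom_eval_superset:
  assumes "finite V" "Poly_Mapping.keys e \<subseteq> V"
  shows "monom_eval f e = (\<Prod>v\<in>V. f v ^ Poly_Mapping.lookup e v)"
  unfolding monom_eval_def
  by (rule prod.mono_neutral_left) (use assms in \<open>auto simp: in_keys_iff\<close>)

lemma monom_eval_add: "monom_eval f (e + e') = monom_eval f e * monom_eval f e'"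
proof -
  let ?V = "Poly_Mapping.keys e \<union> Poly_Mapping.keys e'"
  have "Poly_Mapping.keys (e + e') \<subseteq> ?V" by (rule Poly_Mapping.keys_add)
  then show ?thesis
    by (simp add: monom_eval_superset[of ?V] lookup_add power_add prod.distrib)
qed

lemma monom_eval_zero [simp]: "monom_eval f 0 = 1"
  by (simp add: monom_eval_def)

lemma monom_eval_single [simp]: "monom_eval f (Poly_Mapping.single v n) = f v ^ n"
  by (cases "n = 0") (auto simp: monom_eval_def)

lemma mpoly_eval_superset:
  assumes "finite K" "Poly_Mapping.keys p \<subseteq> K"
  shows "mpoly_eval f p = (\<Sum>e\<in>K. Poly_Mapping.lookup p e * monom_eval f e)"
  unfolding mpoly_eval_def monom_eval_def
  by (rule sum.mono_neutral_left) (use assms in \<open>auto simp: in_keys_iff\<close>)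

lemma mpoly_eval_add: "mpoly_eval f (p + q) = mpoly_eval f p + mpoly_eval f q"
proof -
  let ?K = "Poly_Mapping.keys p \<union> Poly_Mapping.keys q"
  have "Poly_Mapping.keys (p + q) \<subseteq> ?K" by (rule Poly_Mapping.keys_add)
  then show ?thesis
    by (simp add: mpoly_eval_superset[of ?K] lookup_add sum.distrib ring_distribs)
qed

lemma mpoly_eval_zero [simp]: "mpoly_eval f 0 = 0"
  by (simp add: mpoly_eval_def)

lemma mpoly_eval_sum: "mpoly_eval f (sum g I) = (\<Sum>i\<in>I. mpoly_eval f (g i))"
  by (induction I rule: infinite_finite_induct) (auto simp: mpoly_eval_add)

lemma mpoly_eval_single: "mpoly_eval f (Poly_Mapping.single e c) = c * monom_eval f e"
  by (cases "c = 0") (auto simp: mpoly_eval_def monom_eval_def)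

lemma poly_mapping_sum_single:
  "p = (\<Sum>e\<in>Poly_Mapping.keys p. Poly_Mapping.single e (Poly_Mapping.lookup p e))"
proof (rule poly_mapping_eqI)
  fix e
  have "(\<Sum>e'\<in>Poly_Mapping.keys p. (if e' = e then Poly_Mapping.lookup p e' else 0)) =
      Poly_Mapping.lookup p e"
    by (simp add: in_keys_iff)
  then show "Poly_Mapping.lookup p e = Poly_Mapping.lookup
      (\<Sum>e\<in>Poly_Mapping.keys p. Poly_Mapping.single e (Poly_Mapping.lookup p e)) e"
    by (simp add: lookup_sum lookup_single when_def)
qed

lemma mpoly_eval_mult: "mpoly_eval f (p * q) = mpoly_eval f p * mpoly_eval f q"
proof -
  have "p * q = (\<Sum>e\<in>Poly_Mapping.keys p. \<Sum>e'\<in>Poly_Mapping.keys q.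
      Poly_Mapping.single (e + e') (Poly_Mapping.lookup p e * Poly_Mapping.lookup q e'))"
    unfolding mult_single[symmetric] sum_product[symmetric] poly_mapping_sum_single[symmetric] ..
  then have "mpoly_eval f (p * q) =
    (\<Sum>e\<in>Poly_Mapping.keys p. \<Sum>e'\<in>Poly_Mapping.keys q.
      (Poly_Mapping.lookup p e * monom_eval f e) * (Poly_Mapping.lookup q e' * monom_eval f e'))"
    by (simp add: mpoly_eval_sum mpoly_eval_single monom_eval_add mult_ac)
  also have "\<dots> = mpoly_eval f p * mpoly_eval f q"
    unfolding sum_product[symmetric] by (simp add: mpoly_eval_superset[OF finite_keys order_refl])
  finally show ?thesis .
qed

lemma mpoly_eval_one [simp]: "mpoly_eval f 1 = 1"
  using mpoly_eval_single[of f 0 1] by simp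

lemma mpoly_eval_const [simp]: "mpoly_eval f (mpoly_const c) = c"
  by (simp add: mpoly_const_def mpoly_eval_single)

lemma mpoly_eval_var [simp]: "mpoly_eval f (mpoly_var v) = f v"
  by (simp add: mpoly_var_def mpoly_eval_single)

lemma polyfun_mpoly_eval:
  fixes P :: "('v, complex) mpoly"
  shows "polyfun (mpoly_vars P) (\<lambda>x. mpoly_eval x P)"
  unfolding mpoly_eval_def
proof (intro polyfun_intros polyfun_var)
  fix e v assume "e \<in> Poly_Mapping.keys P" "v \<in> Poly_Mapping.keys e"
  then show "v \<in> mpoly_vars P" by (auto simp: mpoly_vars_def)
qed

lemma mpoly_vars_add: "mpoly_vars (p + q) \<subseteq> mpoly_vars p \<union> mpoly_vars q"
  using Poly_Mapping.keys_add[of p q] unfolding mpoly_vars_def by blast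

lemma mpoly_vars_mult: "mpoly_vars (p * q) \<subseteq> mpoly_vars p \<union> mpoly_vars q"
proof
  fix v assume "v \<in> mpoly_vars (p * q)"
  then obtain e where e: "e \<in> Poly_Mapping.keys (p * q)" "v \<in> Poly_Mapping.keys e"
    by (auto simp: mpoly_vars_def)
  then obtain a b where "e = a + b" "a \<in> Poly_Mapping.keys p" "b \<in> Poly_Mapping.keys q"
    using Poly_Mapping.keys_mult[of p q] by auto
  with e(2) Poly_Mapping.keys_add[of a b] show "v \<in> mpoly_vars p \<union> mpoly_vars q"
    by (auto simp: mpoly_vars_def)
qed

lemma polyfun_imp_mpoly_eval:
  fixes f :: "('v \<Rightarrow> complex) \<Rightarrow> complex"
  assumes "polyfun S f"
  shows "\<exists>P. mpoly_vars P \<subseteq> S \<and> (\<forall>x. f x = mpoly_eval x P)"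
  using assms
proof induction
  case (const c)
  show ?case
    by (rule exI[of _ "mpoly_const c"]) (auto simp: mpoly_vars_def mpoly_const_def mpoly_eval_single split: if_splits)
next
  case (add f g)
  from add.IH obtain P Q where "mpoly_vars P \<subseteq> S" "\<And>x. f x = mpoly_eval x P"
    "mpoly_vars Q \<subseteq> S" "\<And>x. g x = mpoly_eval x Q"
    by blast
  then show ?case
    using mpoly_vars_add[of P Q] by (intro exI[of _ "P + Q"]) (auto simp: mpoly_eval_add)
next
  case (var_mult v f)
  then obtain P where P: "mpoly_vars P \<subseteq> S" "\<And>x. f x = mpoly_eval x P" by blast
  have "mpoly_vars (mpoly_var v :: ('v, complex) mpoly) \<subseteq> S"
    using var_mult(1) by (auto simp: mpoly_vars_def mpoly_var_def)
  with P(1) have "mpoly_vars (mpoly_var v * P) \<subseteq> S"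
    using mpoly_vars_mult[of "mpoly_var v" P] by blast
  with P show ?case by (intro exI[of _ "mpoly_var v * P"]) (simp add: mpoly_eval_mult)
qed

lemma monom_eval_mult: "monom_eval (\<lambda>v. f v * g v) e = monom_eval f e * monom_eval g e"
  by (simp add: monom_eval_def power_mult_distrib prod.distrib)

text \<open>Artin's argument: distinct monomials are distinct characters of the multiplicative monoid of
  points, hence linearly independent.\<close>

lemma monom_eval_independent:
  fixes c :: "('v \<Rightarrow>\<^sub>0 nat) \<Rightarrow> complex"
  assumes "finite K" "\<And>x. (\<Sum>e\<in>K. c e * monom_eval x e) = 0" "e \<in> K"
  shows "c e = 0"
  using assms
proof (induction K arbitrary: c e rule: finite_induct)
  case empty
  then show ?case by simp
next
  case (insert e0 K)
  have *: "c e1 = 0" if e1: "e1 \<in> K" for e1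
  proof -
    have "e1 \<noteq> e0" using insert.hyps e1 by auto
    then obtain v where v: "Poly_Mapping.lookup e1 v \<noteq> Poly_Mapping.lookup e0 v"
      using poly_mapping_eqI[of e1 e0] by metis
    \<comment> \<open>The two exponents differ at \<open>v\<close>, so the value 2 there separates
      the two characters: distinct powers of 2 have distinct norms.\<close>
    define y :: "'v \<Rightarrow> complex" where "y = (\<lambda>_. 1)(v := 2)"
    have y: "monom_eval y e = 2 ^ Poly_Mapping.lookup e v" for e
    proof -
      have "monom_eval y e = (\<Prod>w\<in>insert v (Poly_Mapping.keys e). y w ^ Poly_Mapping.lookup e w)"
        by (rule monom_eval_superset) auto
      also have "\<dots> = (\<Prod>w\<in>insert v (Poly_Mapping.keys e).
          if w = v then 2 ^ Poly_Mapping.lookup e v else 1)"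
        by (rule prod.cong) (auto simp: y_def)
      finally show ?thesis by (simp add: prod.delta')
    qed
    \<comment> \<open>The relation at the pointwise product of \<open>y\<close> and
      \<open>x\<close>, minus \<open>monom_eval y e0\<close> times the relation at \<open>x\<close>,
      no longer contains \<open>e0\<close>.\<close>
    have "(\<Sum>e\<in>K. c e * (monom_eval y e - monom_eval y e0) * monom_eval x e) = 0" for x
    proof -
      have "(\<Sum>e\<in>K. c e * (monom_eval y e - monom_eval y e0) * monom_eval x e) =
        (\<Sum>e\<in>insert e0 K. c e * (monom_eval y e - monom_eval y e0) * monom_eval x e)"
        using insert.hyps by simp
      also have "\<dots> = (\<Sum>e\<in>insert e0 K. c e * monom_eval (\<lambda>v. y v * x v) e)
          - monom_eval y e0 * (\<Sum>e\<in>insert e0 K. c e * monom_eval x e)"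
        unfolding sum_distrib_left sum_subtractf[symmetric] monom_eval_mult
        by (rule sum.cong) (auto simp: algebra_simps)
      finally show ?thesis using insert.prems(1) by simp
    qed
    from insert.IH[OF this e1] have "c e1 * (monom_eval y e1 - monom_eval y e0) = 0" .
    moreover have "monom_eval y e1 \<noteq> monom_eval y e0"
    proof -
      have "cmod (2 ^ Poly_Mapping.lookup e1 v) \<noteq> cmod (2 ^ Poly_Mapping.lookup e0 v)"
        using v by (simp add: norm_power)
      then show ?thesis unfolding y by metis
    qed
    ultimately show ?thesis by simp
  qed
  moreover have "c e0 = 0"
    using insert.prems(1)[of "\<lambda>_. 1"] insert.hyps * by (simp add: monom_eval_def sum.neutral)
  ultimately show ?case using insert.prems(2) by auto
qed

lemma mpoly_eval_inject:
  fixes P Q :: "('v, complex) mpoly"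
  assumes "\<And>x. mpoly_eval x P = mpoly_eval x Q"
  shows "P = Q"
proof (rule poly_mapping_eqI)
  fix e
  let ?K = "insert e (Poly_Mapping.keys P \<union> Poly_Mapping.keys Q)"
  have "(\<Sum>e\<in>?K. (Poly_Mapping.lookup P e - Poly_Mapping.lookup Q e) * monom_eval x e) = 0" for x
  proof -
    have "mpoly_eval x P = (\<Sum>e\<in>?K. Poly_Mapping.lookup P e * monom_eval x e)"
      "mpoly_eval x Q = (\<Sum>e\<in>?K. Poly_Mapping.lookup Q e * monom_eval x e)"
      by (rule mpoly_eval_superset; auto)+
    then show ?thesis using assms[of x] unfolding left_diff_distrib sum_subtractf by simp
  qed
  from monom_eval_independent[OF _ this, of e]
  show "Poly_Mapping.lookup P e = Poly_Mapping.lookup Q e" by simp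
qed

subsection \<open>Linear factors of complex polynomials\<close>

text \<open>There are always exactly \<open>D\<close> factors: a deficit in the degree is filled
  with \<open>[:1, 0:]\<close>, which stands for a root at infinity. The zero polynomial is covered
  too.\<close>

lemma complex_poly_linear_factors:
  fixes p :: "complex poly"
  assumes "degree p \<le> D" "D > 0"
  shows "\<exists>P Q. p = (\<Prod>j<D. [:P j, - Q j:])"
  using assms(2,1)
proof (induction D arbitrary: p rule: nat_induct_non_zero)
  case 1
  then have "p = [:coeff p 0, - (- coeff p 1):]"
    by (intro poly_eqI) (auto simp: coeff_pCons coeff_eq_0 split: nat.splits)
  then show ?case
    by (intro exI[of _ "\<lambda>_. coeff p 0"] exI[of _ "\<lambda>_. - coeff p 1"]) simp
next
  case (Suc D)
  have "\<exists>r a b. p = r * [:a, - b:] \<and> degree r \<le> D"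
  proof (cases "degree p \<le> D")
    case True
    then show ?thesis by (intro exI[of _ p] exI[of _ 1] exI[of _ 0]) simp
  next
    case False
    with Suc.prems have deg: "degree p = Suc D" by simp
    then have "\<not> constant (poly p)" using constant_degree by (metis nat.distinct(1))
    then obtain z where "poly p z = 0" using fundamental_theorem_of_algebra by blast
    then obtain r where r: "p = [:- z, 1:] * r" by (auto simp: poly_eq_0_iff_dvd)
    then have "r \<noteq> 0" using deg by auto
    then have "degree r = D" using deg r by (simp add: degree_mult_eq del: mult_pCons_left)
    with r show ?thesis
      by (intro exI[of _ r] exI[of _ "-z"] exI[of _ "-1"]) (simp add: mult.commute)
  qed
  then obtain r a b where r: "p = r * [:a, - b:]" "degree r \<le> D" by blast
  from Suc.IH[OF r(2)] obtain P Q where "r = (\<Prod>j<D. [:P j, - Q j:])" by blast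
  then have "p = (\<Prod>j<Suc D. [:(P(D := a)) j, - (Q(D := b)) j:])"
    using r(1) by (simp add: lessThan_Suc mult.commute)
  then show ?case by blast
qed

lemma coeff_0_prod_linear: "coeff (\<Prod>j<(D::nat). [:P j, Q j:]) 0 = (\<Prod>j<D. P j :: complex)"
  by (induction D) (auto simp: coeff_mult lessThan_Suc)

text \<open>A nonzero constant term makes every \<open>P j\<close> invertible. \<open>w j\<close> is
  the reciprocal of a root, or 0 for a root at infinity, so the degree of \<open>p\<close> needs no
  case distinction.\<close>

lemma complex_poly_reciprocal_roots:
  fixes p :: "complex poly"
  assumes "degree p \<le> D" "D > 0" "coeff p 0 \<noteq> 0"
  shows "\<exists>w. p = smult (coeff p 0) (\<Prod>j<D. [:1, - w j:])"
proof -
  from complex_poly_linear_factors[OF assms(1,2)] obtain P Q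
    where PQ: "p = (\<Prod>j<D. [:P j, - Q j:])" by blast
  have c: "coeff p 0 = (\<Prod>j<D. P j)" unfolding PQ by (rule coeff_0_prod_linear)
  with assms(3) have nz: "P j \<noteq> 0" if "j < D" for j using that by auto
  have "p = (\<Prod>j<D. smult (P j) [:1, - (Q j / P j):])"
    unfolding PQ by (rule prod.cong) (use nz in auto)
  also have "\<dots> = smult (coeff p 0) (\<Prod>j<D. [:1, - (Q j / P j):])"
    unfolding c by (simp add: prod_smult del: smult_pCons)
  finally show ?thesis by (rule exI[of _ "\<lambda>j. Q j / P j"])
qed

lemma degree_prod_linear_le: "degree (\<Prod>j<(D::nat). [:P j, Q j:]) \<le> D"
proof (induction D)
  case (Suc D)
  have "degree (\<Prod>j<Suc D. [:P j, Q j:]) \<le> degree [:P D, Q D:] + degree (\<Prod>j<D. [:P j, Q j:])"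
    unfolding prod.lessThan_Suc by (subst mult.commute) (rule degree_mult_le)
  also have "\<dots> \<le> 1 + D" by (intro add_mono Suc.IH) simp
  finally show ?case by simp
qed simp

lemma coeff_mult_bounds:
  fixes p q :: "'a::comm_semiring_0 poly"
  assumes "degree p \<le> m" "degree q \<le> n"
  shows "coeff (p * q) (m + n) = coeff p m * coeff q n"
proof -
  have "coeff (p * q) (m + n) = (\<Sum>i\<le>m + n. coeff p i * coeff q (m + n - i))"
    by (rule coeff_mult)
  also have "\<dots> = (\<Sum>i\<in>{m}. coeff p i * coeff q (m + n - i))"
  proof (rule sum.mono_neutral_right; (intro ballI)?)
    fix i assume i: "i \<in> {..m + n} - {m}"
    show "coeff p i * coeff q (m + n - i) = 0"
    proof (cases "i < m")
      case True
      then have "degree q < m + n - i" using assms by linarith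
      then show ?thesis by (simp add: coeff_eq_0)
    next
      case False
      then have "degree p < i" using assms i by auto
      then show ?thesis by (simp add: coeff_eq_0)
    qed
  qed auto
  finally show ?thesis by simp
qed

lemma coeff_prod_linear_top: "coeff (\<Prod>j<(D::nat). [:P j, Q j:]) D = (\<Prod>j<D. Q j :: complex)"
proof (induction D)
  case (Suc D)
  have "coeff ((\<Prod>j<D. [:P j, Q j:]) * [:P D, Q D:]) (D + 1) =
    coeff (\<Prod>j<D. [:P j, Q j:]) D * coeff [:P D, Q D:] 1"
    by (rule coeff_mult_bounds) (auto intro: degree_prod_linear_le)
  then show ?case using Suc.IH by simp
qed simp

section \<open>Lagrange interpolation\<close>

definition lagrange_basis :: "nat \<Rightarrow> (nat \<Rightarrow> complex) \<Rightarrow> nat \<Rightarrow> complex poly" where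
  "lagrange_basis n x i = (\<Prod>j\<in>{..n} - {i}. smult (1 / (x i - x j)) [:- x j, 1:])"

lemma degree_lagrange_basis: "i \<le> n \<Longrightarrow> degree (lagrange_basis n x i) \<le> n"
  unfolding lagrange_basis_def
  by (rule order_trans[OF degree_prod_sum_le], simp,
      rule order_trans[OF sum_mono[of _ _ "\<lambda>_. 1"]]) auto

lemma poly_lagrange_basis:
  assumes "inj_on x {..n}" "i \<le> n" "k \<le> n"
  shows "poly (lagrange_basis n x i) (x k) = (if i = k then 1 else 0)"
proof (cases "i = k")
  case True
  have "poly (lagrange_basis n x i) (x i) = (\<Prod>j\<in>{..n} - {i}. 1)"
    unfolding lagrange_basis_def poly_prod
  proof (rule prod.cong)
    fix j assume "j \<in> {..n} - {i}"
    then have "x i - x j \<noteq> 0" using assms by (auto simp: inj_on_def)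
    then show "poly (smult (1 / (x i - x j)) [:- x j, 1:]) (x i) = 1"
      by (simp add: diff_divide_distrib[symmetric])
  qed simp
  with True show ?thesis by simp
next
  case False
  then show ?thesis
    using assms(2,3) unfolding lagrange_basis_def poly_prod by (auto intro!: prod_zero bexI[of _ k])
qed

lemma lagrange_interpolation:
  assumes inj: "inj_on x {..n}" and deg: "degree p \<le> n"
  shows "p = (\<Sum>i\<le>n. smult (poly p (x i)) (lagrange_basis n x i))"
proof -
  let ?q = "\<Sum>i\<le>n. smult (poly p (x i)) (lagrange_basis n x i)"
  have degq: "degree ?q \<le> n"
    by (intro degree_sum_le) (auto intro: order_trans[OF degree_smult_le] degree_lagrange_basis)
  have eq: "poly (p - ?q) (x k) = 0" if "k \<le> n" for k
    using that by (simp add: poly_sum poly_lagrange_basis[OF inj] if_distrib sum.delta' cong: if_cong)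
  have "p - ?q = 0"
  proof (rule ccontr)
    assume nz: "p - ?q \<noteq> 0"
    have "Suc n = card (x ` {..n})" using inj by (simp add: card_image)
    also have "\<dots> \<le> card {z. poly (p - ?q) z = 0}"
      by (intro card_mono poly_roots_finite nz) (use eq in auto)
    also have "\<dots> \<le> degree (p - ?q)" by (rule card_poly_roots_bound[OF nz])
    also have "\<dots> \<le> n" using deg degq by (rule degree_diff_le)
    finally show False by simp
  qed
  then show ?thesis by simp
qed

lemma poly_eqI_cofinite:
  fixes p q :: "complex poly"
  assumes "finite F" "\<And>t. t \<notin> F \<Longrightarrow> poly p t = poly q t"
  shows "p = q"
proof (rule ccontr)
  assume "p \<noteq> q"
  then have "finite {t. poly (p - q) t = 0}" by (intro poly_roots_finite) simp
  moreover have "UNIV = F \<union> {t. poly (p - q) t = 0}" using assms(2) by auto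
  ultimately have "finite (UNIV :: complex set)" using assms(1) by (metis finite_UnI)
  then show False using infinite_UNIV_char_0 by blast
qed

subsection \<open>The resultant along a pencil\<close>

text \<open>Eliminates the \<open>w i\<close> from the double product, which turns out to depend on
  them only through \<open>u\<close>. With the roles exchanged it eliminates the
  \<open>z j\<close>.\<close>

lemma prod_poly_reciprocal_roots:
  fixes z :: "nat \<Rightarrow> complex"
  assumes "u = smult c (\<Prod>i<D. [:1, - w i:])"
  shows "(\<Prod>j<D. poly u (z j)) = c ^ D * (\<Prod>i<D. \<Prod>j<D. 1 - w i * z j)"
proof -
  have "(\<Prod>j<D. poly u (z j)) = (\<Prod>j<D. c * (\<Prod>i<D. 1 - w i * z j))"
    unfolding assms by (simp add: poly_prod mult.commute)
  also have "\<dots> = c ^ D * (\<Prod>i<D. \<Prod>j<D. 1 - w i * z j)"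
    by (subst prod.swap) (simp add: prod.distrib)
  finally show ?thesis .
qed

text \<open>The product below is the resultant of \<open>x\<^sup>D - t F\<^sub>1\<close> and \<open>y\<^sup>D - t F\<^sub>2\<close>, where \<open>F\<^sub>1(1, z) = A(z)\<close> and
  \<open>F\<^sub>2(w, 1) = B(w)\<close>. It is a polynomial in the \<open>t\<close> of each factor separately, hence jointly by
  interpolation.\<close>

lemma pencil_resultant_polynomial:
  fixes A B :: "complex poly"
  assumes D: "D > 0" and degA: "degree A \<le> D" and degB: "degree B \<le> D"
    and A: "A = smult a (\<Prod>i<D. [:1, - r i:])"
  shows "\<exists>q. coeff q (2 * D) = a ^ D * (\<Prod>i<D. poly B (r i)) \<and>
    (\<forall>t w z. 1 - t * coeff A 0 \<noteq> 0 \<longrightarrow> 1 - t * coeff B 0 \<noteq> 0 \<longrightarrow>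
      1 - smult t A = smult (1 - t * coeff A 0) (\<Prod>i<D. [:1, - w i:]) \<longrightarrow>
      1 - smult t B = smult (1 - t * coeff B 0) (\<Prod>i<D. [:1, - z i:]) \<longrightarrow>
      poly q t = (1 - t * coeff A 0) ^ D * (1 - t * coeff B 0) ^ D *
        (\<Prod>i<D. \<Prod>j<D. 1 - w i * z j))"
proof -
  define u v where "u = (\<lambda>t. 1 - t * coeff A 0)" and "v = (\<lambda>t. 1 - t * coeff B 0)"
  define W where "W = (\<lambda>t w. 1 - smult t A = smult (u t) (\<Prod>i<D. [:1, - w i:]))"
  define Z where "Z = (\<lambda>t z. 1 - smult t B = smult (v t) (\<Prod>i<D. [:1, - z i:]))"
  have exW: "\<exists>w. W t w" if "u t \<noteq> 0" for t
    using complex_poly_reciprocal_roots[of "1 - smult t A" D] that D degA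
    by (simp add: W_def u_def degree_diff_le order_trans[OF degree_smult_le])
  have exZ: "\<exists>z. Z t z" if "v t \<noteq> 0" for t
    using complex_poly_reciprocal_roots[of "1 - smult t B" D] that D degB
    by (simp add: Z_def v_def degree_diff_le order_trans[OF degree_smult_le])
  define w where "w = (\<lambda>t. SOME w. W t w)"
  have w: "W t (w t)" if "u t \<noteq> 0" for t
    unfolding w_def using exW[OF that] by (rule someI_ex)
  \<comment> \<open>With separate parameters t1 and t2 in the two forms, \<open>Q\<close> is the
    resultant as a polynomial in t1 once the zeros of the second form are fixed, and
    \<open>R\<close> is the resultant as a polynomial in t2 once those of the first are.\<close>
  define Q where "Q = (\<lambda>t z. smult (v t ^ D) (\<Prod>j<D. [:1, - poly A (z j):]))"
  define R where "R = (\<lambda>t w. smult (u t ^ D) (\<Prod>i<D. [:1, - poly B (w i):]))"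
  have Qval: "poly (Q t2 z) t1 = u t1 ^ D * v t2 ^ D * (\<Prod>i<D. \<Prod>j<D. 1 - w i * z j)"
    if "W t1 w" for t1 t2 w z
    using prod_poly_reciprocal_roots[OF that[unfolded W_def], of z]
    by (simp add: Q_def poly_prod)
  have Rval: "poly (R t1 w) t2 = u t1 ^ D * v t2 ^ D * (\<Prod>i<D. \<Prod>j<D. 1 - w i * z j)"
    if "Z t2 z" for t1 t2 w z
  proof -
    have "(\<Prod>j<D. \<Prod>i<D. 1 - z j * w i) = (\<Prod>i<D. \<Prod>j<D. 1 - w i * z j)"
      by (subst prod.swap) (simp add: mult.commute)
    then show ?thesis
      using prod_poly_reciprocal_roots[OF that[unfolded Z_def], of w]
      by (simp add: R_def poly_prod)
  qed
  have degQ: "degree (Q t z) \<le> D" and degR: "degree (R t z) \<le> D" for t z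
    unfolding Q_def R_def by (auto intro!: order_trans[OF degree_smult_le] degree_prod_linear_le)
  have fin: "finite {t. 1 - t * c = 0}" for c :: complex
  proof (rule finite_subset)
    show "{t. 1 - t * c = 0} \<subseteq> {1 / c}" by (auto simp: eq_divide_eq)
  qed simp
  then have "infinite (UNIV - {t. u t = 0})"
    unfolding u_def using infinite_UNIV_char_0 by (metis Diff_infinite_finite)
  then obtain T where T: "finite T" "card T = Suc D" "T \<subseteq> UNIV - {t. u t = 0}"
    using infinite_arbitrarily_large by blast
  then obtain x where x: "bij_betw x {..<Suc D} T"
    using bij_betw_from_nat_into_finite[of T] by metis
  then have inj: "inj_on x {..D}" and ux: "\<And>i. i \<le> D \<Longrightarrow> u (x i) \<noteq> 0"
    using T by (auto simp: bij_betw_def lessThan_Suc_atMost)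
  define l where "l = lagrange_basis D x"
  \<comment> \<open>Interpolation in t1 at \<open>D + 1\<close> nodes, where the value at a node is
    still a polynomial in t2. Multiplying polynomials in the same variable sets t1 = t2.\<close>
  define q where "q = (\<Sum>i\<le>D. R (x i) (w (x i)) * l i)"
  have Qeq: "Q t z = (\<Sum>i\<le>D. smult (poly (R (x i) (w (x i))) t) (l i))" if "Z t z" for t z
  proof -
    have "Q t z = (\<Sum>i\<le>D. smult (poly (Q t z) (x i)) (l i))"
      unfolding l_def by (rule lagrange_interpolation[OF inj degQ])
    also have "\<dots> = (\<Sum>i\<le>D. smult (poly (R (x i) (w (x i))) t) (l i))"
      using Qval[OF w[OF ux]] Rval[OF that] by (intro sum.cong) auto
    finally show ?thesis .
  qed
  have qval: "poly q t = u t ^ D * v t ^ D * (\<Prod>i<D. \<Prod>j<D. 1 - w' i * z j)"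
    if "W t w'" "Z t z" for t w' z
    using Qeq[OF that(2)] Qval[OF that(1), of t z] by (simp add: q_def poly_sum)
  \<comment> \<open>The coefficient of t1^D as a polynomial in t2. Away from the zeros of
    \<open>v\<close> it is \<open>v t ^ D\<close> times the product of the
    \<open>- poly A (z j)\<close>, from which the \<open>z j\<close> are eliminated in favour of the
    reciprocal roots of \<open>A\<close>. Its own top coefficient brings a second factor
    \<open>(-1) ^ D\<close>, cancelling the first.\<close>
  have "(\<Sum>i\<le>D. smult (coeff (l i) D) (R (x i) (w (x i)))) =
      smult ((-1) ^ D * a ^ D) (\<Prod>i<D. [:1, - poly B (r i):])"
  proof (rule poly_eqI_cofinite)
    show "finite {t. v t = 0}" unfolding v_def by (rule fin)
    fix t assume "t \<notin> {t. v t = 0}"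
    then obtain z where z: "Z t z" using exZ by auto
    have "poly (\<Sum>i\<le>D. smult (coeff (l i) D) (R (x i) (w (x i)))) t = coeff (Q t z) D"
      unfolding Qeq[OF z] by (simp add: poly_sum coeff_sum mult.commute)
    also have "\<dots> = v t ^ D * (\<Prod>j<D. - poly A (z j))"
      unfolding Q_def by (simp add: coeff_prod_linear_top)
    also have "\<dots> = (-1) ^ D * (v t ^ D * (\<Prod>j<D. poly A (z j)))"
      using prod.distrib[of "\<lambda>_. -1" "\<lambda>j. poly A (z j)" "{..<D}"] by simp
    also have "\<dots> = (-1) ^ D * a ^ D * (v t ^ D * (\<Prod>j<D. \<Prod>i<D. 1 - z j * r i))"
      unfolding prod_poly_reciprocal_roots[OF A]
      by (subst prod.swap) (simp add: mult_ac)
    also have "\<dots> = (-1) ^ D * a ^ D * (\<Prod>i<D. poly (1 - smult t B) (r i))"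
      unfolding prod_poly_reciprocal_roots[OF z[unfolded Z_def], of r] ..
    finally show "poly (\<Sum>i\<le>D. smult (coeff (l i) D) (R (x i) (w (x i)))) t =
      poly (smult ((-1) ^ D * a ^ D) (\<Prod>i<D. [:1, - poly B (r i):])) t"
      by (simp add: poly_prod)
  qed
  from arg_cong[OF this, of "\<lambda>p. coeff p D"]
  have "(\<Sum>i\<le>D. coeff (l i) D * coeff (R (x i) (w (x i))) D) =
      coeff (smult ((-1) ^ D * a ^ D) (\<Prod>i<D. [:1, - poly B (r i):])) D"
    unfolding coeff_sum coeff_smult .
  also have "\<dots> = (-1) ^ D * a ^ D * (\<Prod>i<D. (-1) * poly B (r i))"
    by (simp add: coeff_prod_linear_top)
  also have "\<dots> = a ^ D * (\<Prod>i<D. poly B (r i))"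
    unfolding prod.distrib by (simp add: power_mult_distrib[symmetric] mult_ac)
  finally have top: "(\<Sum>i\<le>D. coeff (l i) D * coeff (R (x i) (w (x i))) D) =
    a ^ D * (\<Prod>i<D. poly B (r i))" .
  have "coeff q (2 * D) = (\<Sum>i\<le>D. coeff (R (x i) (w (x i))) D * coeff (l i) D)"
    unfolding q_def coeff_sum mult_2
    by (intro sum.cong refl coeff_mult_bounds degR) (simp add: l_def degree_lagrange_basis)
  with top have "coeff q (2 * D) = a ^ D * (\<Prod>i<D. poly B (r i))" by (simp add: mult.commute)
  then show ?thesis
    using qval unfolding u_def v_def W_def Z_def by (intro exI[of _ q] conjI allI impI)
qed

subsection \<open>Power sums of reciprocal roots\<close>

text \<open>The l1 norm of the coefficients. It is submultiplicative, so its powers bound the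
  coefficients of all \<open>p ^ h\<close> and geometric series control the interchanges of limits
  and sums.\<close>

definition coeff_norm :: "complex poly \<Rightarrow> real" where
  "coeff_norm p = (\<Sum>i\<le>degree p. norm (coeff p i))"

lemma coeff_norm_nonneg: "coeff_norm p \<ge> 0"
  by (simp add: coeff_norm_def sum_nonneg)

lemma sum_norm_coeff_le: "(\<Sum>s\<le>N. norm (coeff p s)) \<le> coeff_norm p"
proof -
  have "(\<Sum>s\<le>N. norm (coeff p s)) = (\<Sum>s\<in>{..N} \<inter> {..degree p}. norm (coeff p s))"
    by (rule sum.mono_neutral_right) (auto intro: le_degree)
  also have "\<dots> \<le> coeff_norm p"
    unfolding coeff_norm_def by (intro sum_mono2) auto
  finally show ?thesis .
qed

lemma sum_norm_coeff_mult:
  fixes p q :: "complex poly"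
  shows "(\<Sum>s\<le>N. norm (coeff (p * q) s)) \<le> (\<Sum>s\<le>N. norm (coeff p s)) * (\<Sum>s\<le>N. norm (coeff q s))"
proof -
  have "(\<Sum>s\<le>N. norm (coeff (p * q) s)) \<le> (\<Sum>s\<le>N. \<Sum>i\<le>s. norm (coeff p i) * norm (coeff q (s - i)))"
    unfolding coeff_mult norm_mult[symmetric] by (intro sum_mono norm_sum)
  also have "\<dots> = (\<Sum>(i, j)\<in>{(i, j). i + j \<le> N}. norm (coeff p i) * norm (coeff q j))"
    by (rule sum.triangle_reindex_eq[symmetric])
  also have "\<dots> \<le> (\<Sum>(i, j)\<in>{..N} \<times> {..N}. norm (coeff p i) * norm (coeff q j))"
    by (intro sum_mono2) auto
  also have "\<dots> = (\<Sum>s\<le>N. norm (coeff p s)) * (\<Sum>s\<le>N. norm (coeff q s))"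
    by (simp add: sum_product sum.cartesian_product)
  finally show ?thesis .
qed

lemma sum_norm_coeff_power: "(\<Sum>s\<le>N. norm (coeff (p ^ h) s)) \<le> coeff_norm p ^ h"
proof (induction h)
  case 0
  have "(\<Sum>s\<le>N. norm (coeff (1 :: complex poly) s)) = (\<Sum>s\<le>N. if s = 0 then 1 else 0)"
    by (rule sum.cong) auto
  then show ?case by simp
next
  case (Suc h)
  have "(\<Sum>s\<le>N. norm (coeff (p ^ Suc h) s)) \<le>
      (\<Sum>s\<le>N. norm (coeff p s)) * (\<Sum>s\<le>N. norm (coeff (p ^ h) s))"
    using sum_norm_coeff_mult by simp
  also have "\<dots> \<le> coeff_norm p * coeff_norm p ^ h"
    by (intro mult_mono sum_norm_coeff_le Suc.IH coeff_norm_nonneg sum_nonneg) auto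
  finally show ?case by simp
qed

lemma norm_coeff_power_le: "norm (coeff (p ^ h) s) \<le> coeff_norm p ^ h"
proof -
  have "norm (coeff (p ^ h) s) \<le> (\<Sum>s\<le>s. norm (coeff (p ^ h) s))"
    by (rule member_le_sum) auto
  also have "\<dots> \<le> coeff_norm p ^ h" by (rule sum_norm_coeff_power)
  finally show ?thesis .
qed

lemma norm_poly_le_coeff_norm:
  assumes "norm x \<le> 1"
  shows "norm (poly p x) \<le> coeff_norm p"
proof -
  have "norm (poly p x) \<le> (\<Sum>i\<le>degree p. norm (coeff p i * x ^ i))"
    unfolding poly_altdef by (rule norm_sum)
  also have "\<dots> \<le> (\<Sum>i\<le>degree p. norm (coeff p i) * 1)"
    unfolding norm_mult norm_power using assms by (intro sum_mono mult_left_mono power_le_one) auto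
  finally show ?thesis by (simp add: coeff_norm_def)
qed

text \<open>Otherwise \<open>1 / w i\<close> is a root of \<open>1 - t A\<close> in the closed unit
  disc, where the norm of \<open>t A\<close> is below 1.\<close>

lemma reciprocal_roots_small:
  fixes w :: "nat \<Rightarrow> complex"
  assumes u: "1 - smult t A = smult c (\<Prod>i<D. [:1, - w i:])"
    and t: "norm t * coeff_norm A < 1" and i: "i < D"
  shows "norm (w i) < 1"
proof (rule ccontr)
  assume "\<not> norm (w i) < 1"
  then have w: "norm (w i) \<ge> 1" by simp
  then have "w i \<noteq> 0" by auto
  then have "poly (smult c (\<Prod>i<D. [:1, - w i:])) (1 / w i) = 0"
    using i by (auto simp: poly_prod intro!: prod_zero bexI[of _ i])
  then have "t * poly A (1 / w i) = 1" unfolding u[symmetric] by simp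
  then have "1 = norm t * norm (poly A (1 / w i))" by (metis norm_mult norm_one)
  also have "\<dots> \<le> norm t * coeff_norm A"
    using w by (intro mult_left_mono norm_poly_le_coeff_norm) (auto simp: norm_divide divide_le_eq_1)
  finally show False using t by simp
qed

text \<open>The logarithmic derivative of the product, multiplied by \<open>- fps_X\<close> and
  cleared of denominators. Each factor contributes w X / (1 - w X), which has no constant term;
  hence the entry 0 instead of \<open>n\<close> at \<open>s = 0\<close>.\<close>

lemma power_sum_fps:
  fixes w :: "nat \<Rightarrow> 'a::field"
  shows "(\<Prod>i<n. 1 - fps_const (w i) * fps_X) * Abs_fps (\<lambda>s. if s = 0 then 0 else \<Sum>i<n. w i ^ s) =
    - fps_X * fps_deriv (\<Prod>i<n. 1 - fps_const (w i) * fps_X)"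
proof (induction n)
  case 0
  have "Abs_fps (\<lambda>s. if s = 0 then 0 else \<Sum>i<0. w i ^ s) = 0" by (rule fps_ext) simp
  then show ?case by simp
next
  case (Suc n)
  define F where "F = (\<Prod>i<n. 1 - fps_const (w i) * fps_X)"
  define P where "P = Abs_fps (\<lambda>s. if s = 0 then 0 else \<Sum>i<n. w i ^ s)"
  define L where "L = 1 - fps_const (w n) * fps_X"
  define G where "G = Abs_fps (\<lambda>s. if s = 0 then 0 else w n ^ s)"
  have IH: "F * P = - fps_X * fps_deriv F" using Suc.IH by (simp add: F_def P_def)
  have LG: "L * G = fps_const (w n) * fps_X"
  proof (rule fps_ext)
    fix k
    have "(L * G) $ k = G $ k - w n * (if k = 0 then 0 else G $ (k - 1))"
      by (simp add: L_def left_diff_distrib mult.assoc)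
    then show "(L * G) $ k = (fps_const (w n) * fps_X) $ k"
      by (cases k) (auto simp: G_def)
  qed
  have PG: "Abs_fps (\<lambda>s. if s = 0 then 0 else \<Sum>i<Suc n. w i ^ s) = P + G"
    by (rule fps_ext) (simp add: P_def G_def)
  have L': "fps_deriv L = - fps_const (w n)" by (simp add: L_def)
  have "F * L * (P + G) = L * (F * P) + F * (L * G)" by (simp only: distrib_left mult_ac)
  also have "\<dots> = - fps_X * (F * fps_deriv L + fps_deriv F * L)"
    unfolding IH LG L' by (simp add: algebra_simps del: fps_const_neg)
  finally have "F * L * Abs_fps (\<lambda>s. if s = 0 then 0 else \<Sum>i<Suc n. w i ^ s) =
      - fps_X * fps_deriv (F * L)"
    unfolding PG fps_deriv_mult .
  then show ?case unfolding prod.lessThan_Suc F_def L_def .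
qed

lemma fps_of_poly_prod_linear:
  "fps_of_poly (\<Prod>i<(n::nat). [:1, - w i:]) = (\<Prod>i<n. 1 - fps_const (w i) * fps_X :: 'a::comm_ring_1 fps)"
proof (induction n)
  case (Suc n)
  have "fps_of_poly [:1, - w n:] = 1 - fps_const (w n) * fps_X"
    by (simp add: fps_of_poly_pCons)
  then show ?case
    unfolding prod.lessThan_Suc fps_of_poly_mult Suc.IH by (simp only:)
qed simp

text \<open>Two expansions of - X (log (1 - t A))' are compared: by reciprocal roots and by the
  geometric series in \<open>t A\<close>. As \<open>t A\<close> may have a constant term, its powers
  need not tend to 0 formally; convergence is analytic, coefficient by coefficient.\<close>

lemma power_sum_sums:
  fixes w :: "nat \<Rightarrow> complex"
  assumes u: "1 - smult t A = smult c (\<Prod>i<D. [:1, - w i:])" and c: "c \<noteq> 0"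
    and t: "norm t * coeff_norm A < 1" and s: "s \<ge> 1"
  shows "(\<lambda>h. t ^ h * coeff (A ^ h) s / of_nat h) sums ((\<Sum>i<D. w i ^ s) / of_nat s)"
proof -
  define b where "b = fps_of_poly (smult t A)"
  define F where "F = (\<Prod>i<D. 1 - fps_const (w i) * fps_X)"
  define P where "P = Abs_fps (\<lambda>s. if s = 0 then 0 else \<Sum>i<D. w i ^ s)"
  define X where "X = (\<lambda>H. fps_X * fps_deriv b * (\<Sum>h<H. b ^ h))"
  have "1 - b = fps_of_poly (1 - smult t A)" by (simp add: b_def fps_of_poly_diff)
  then have U: "1 - b = fps_const c * F"
    unfolding u F_def fps_of_poly_smult fps_of_poly_prod_linear .
  have U0: "(1 - b) $ 0 \<noteq> 0"
  proof -
    have "F $ 0 = 1"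
      unfolding F_def fps_of_poly_prod_linear[symmetric] by (simp add: coeff_0_prod_linear)
    then show ?thesis unfolding U using c by simp
  qed
  have nth_b: "(b ^ h) $ j = t ^ h * coeff (A ^ h) j" for h j
    by (simp add: b_def fps_of_poly_power[symmetric] smult_power)
  have "(1 - b) * P = fps_const c * (F * P)" unfolding U by (simp add: mult.assoc)
  also have "\<dots> = - fps_X * fps_deriv (fps_const c * F)"
    unfolding F_def P_def power_sum_fps by simp
  also have "\<dots> = fps_X * fps_deriv b" unfolding U[symmetric] by simp
  finally have UP: "(1 - b) * P = fps_X * fps_deriv b" .
  have UX: "(1 - b) * X H = fps_X * fps_deriv b * (1 - b ^ H)" for H
    unfolding X_def one_diff_power_eq by (simp add: mult_ac)
  \<comment> \<open>The remainder of the geometric series after \<open>H\<close> terms is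
    \<open>K * b ^ H\<close> with \<open>K\<close> independent of \<open>H\<close>. Its coefficient
    at \<open>s\<close> is a combination of finitely many coefficients of \<open>b ^ H\<close>, each
    tending to 0.\<close>
  define K where "K = inverse (1 - b) * (fps_X * fps_deriv b)"
  have PX: "P - X H = K * b ^ H" for H
  proof -
    have "(1 - b) * (P - X H) = fps_X * fps_deriv b * b ^ H"
      unfolding right_diff_distrib[of "1 - b"] UP UX by (simp add: right_diff_distrib mult.assoc)
    then have "inverse (1 - b) * ((1 - b) * (P - X H)) = K * b ^ H"
      by (simp add: K_def mult.assoc)
    then show ?thesis
      using inverse_mult_eq_1[OF U0] by (simp add: mult.assoc[symmetric])
  qed
  have "(\<lambda>H. (b ^ H) $ j) \<longlonglongrightarrow> 0" for j
  proof (rule Lim_null_comparison)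
    show "\<forall>\<^sub>F H in sequentially. norm ((b ^ H) $ j) \<le> (norm t * coeff_norm A) ^ H"
      unfolding nth_b norm_mult norm_power power_mult_distrib
      by (intro always_eventually allI mult_left_mono norm_coeff_power_le) auto
    show "(\<lambda>H. (norm t * coeff_norm A) ^ H) \<longlonglongrightarrow> 0"
      using t by (intro LIMSEQ_realpow_zero) (auto simp: coeff_norm_nonneg)
  qed
  then have "(\<lambda>H. (P - X H) $ s) \<longlonglongrightarrow> (\<Sum>i=0..s. K $ i * 0)"
    unfolding PX fps_mult_nth by (intro tendsto_sum tendsto_mult tendsto_const)
  then have "(\<lambda>H. P $ s - (P - X H) $ s) \<longlonglongrightarrow> P $ s - (\<Sum>i=0..s. K $ i * 0)"
    by (intro tendsto_diff tendsto_const)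
  then have "(\<lambda>H. X H $ s) \<longlonglongrightarrow> P $ s" by simp
  moreover have "X H $ s = (\<Sum>h<H. of_nat s * (t ^ Suc h * coeff (A ^ Suc h) s / of_nat (Suc h)))" for H
  proof -
    have "fps_X * fps_deriv b * b ^ h = fps_const (1 / of_nat (Suc h)) * (fps_X * fps_deriv (b ^ Suc h))" for h
    proof -
      have "fps_deriv (b ^ Suc h) = fps_const (of_nat (Suc h)) * (fps_deriv b * b ^ h)"
        by (simp add: fps_deriv_power fps_of_nat mult.assoc del: of_nat_Suc power_Suc)
      then have "fps_const (1 / of_nat (Suc h)) * (fps_X * fps_deriv (b ^ Suc h)) =
          fps_const (1 / of_nat (Suc h) * of_nat (Suc h)) * (fps_X * fps_deriv b * b ^ h)"
        by (simp only: fps_const_mult[symmetric] mult_ac)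
      then show ?thesis by (simp del: of_nat_Suc)
    qed
    then have "X H = (\<Sum>h<H. fps_const (1 / of_nat (Suc h)) * (fps_X * fps_deriv (b ^ Suc h)))"
      by (simp only: X_def sum_distrib_left)
    then have "X H $ s =
        (\<Sum>h<H. 1 / of_nat (Suc h) * (fps_X * fps_deriv (b ^ Suc h)) $ s)"
      by (simp only: fps_sum_nth fps_mult_left_const_nth)
    moreover have "(fps_X * fps_deriv g) $ s = of_nat s * g $ s" for g :: "complex fps"
      using s by (simp add: fps_deriv_nth)
    ultimately show ?thesis
      by (simp only: nth_b) (simp del: of_nat_Suc power_Suc)
  qed
  ultimately have "(\<lambda>h. of_nat s * (t ^ Suc h * coeff (A ^ Suc h) s / of_nat (Suc h))) sums (P $ s)"
    by (simp only: sums_def)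
  then have "(\<lambda>h. 1 / of_nat s * (of_nat s * (t ^ Suc h * coeff (A ^ Suc h) s / of_nat (Suc h))))
      sums (1 / of_nat s * P $ s)"
    by (rule sums_mult)
  then have "(\<lambda>h. t ^ Suc h * coeff (A ^ Suc h) s / of_nat (Suc h)) sums (1 / of_nat s * P $ s)"
    using s by (simp del: of_nat_Suc power_Suc)
  \<comment> \<open>The shift from \<open>Suc h\<close> to \<open>h\<close> adds only the term at
    \<open>h = 0\<close>, which is 0 because division by zero gives 0.\<close>
  then show ?thesis
    using s sums_Suc_iff[of "\<lambda>h. t ^ h * coeff (A ^ h) s / of_nat h"]
    by (simp add: P_def del: of_nat_Suc power_Suc)
qed

subsection \<open>The logarithm of the resultant along a pencil\<close>

text \<open>With \<open>A\<close> and \<open>B\<close> the polynomials with coefficients \<open>\<alpha>\<close> and \<open>\<beta>\<close>, this is \<open>- Tr\<^sub>d(T) / d\<close> for \<open>d > 0\<close>,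
  and \<open>0\<close> for \<open>d = 0\<close> since \<open>x / 0 = 0\<close>.\<close>

definition pencil_log_coeff :: "nat \<Rightarrow> complex poly \<Rightarrow> complex poly \<Rightarrow> nat \<Rightarrow> complex" where
  "pencil_log_coeff D A B d =
     - (of_nat D * (coeff A 0 ^ d + coeff B 0 ^ d) / of_nat d +
       (\<Sum>(h, k) | h + k = d \<and> h \<ge> 1 \<and> k \<ge> 1. \<Sum>s = 1..min h k * D.
          of_nat s / (of_nat h * of_nat k) * (coeff (A ^ h) s * coeff (B ^ k) s)))"

lemma Ln_one_minus_sums:
  assumes "norm (x::complex) < 1"
  shows "(\<lambda>d. - (x ^ d / of_nat d)) sums Ln (1 - x)"
  using Ln_series'[of "- x"] assms by simp

text \<open>A triple series over (h, k, s) is summed in two ways. For fixed \<open>s\<close>, the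
  weight \<open>s\<close> times (p s / s) (q s / s) gives \<open>p s * q s / s\<close>; for fixed
  \<open>h + k = d\<close> the sum is finite and gives the term in \<open>t ^ d\<close>.\<close>

lemma mixed_log_terms_sums:
  fixes A B :: "complex poly" and t :: complex
  assumes degA: "degree A \<le> D" and degB: "degree B \<le> D"
    and tA: "norm t * coeff_norm A < 1" and tB: "norm t * coeff_norm B < 1"
    and p: "\<And>s. s \<ge> 1 \<Longrightarrow> (\<lambda>h. t ^ h * coeff (A ^ h) s / of_nat h) sums (p s / of_nat s)"
    and q: "\<And>s. s \<ge> 1 \<Longrightarrow> (\<lambda>k. t ^ k * coeff (B ^ k) s / of_nat k) sums (q s / of_nat s)"
    and T: "(\<lambda>s. p s * q s / of_nat s) sums T"
  shows "(\<lambda>d. (\<Sum>(h, k) | h + k = d \<and> h \<ge> 1 \<and> k \<ge> 1. \<Sum>s = 1..min h k * D.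
          of_nat s / (of_nat h * of_nat k) * (coeff (A ^ h) s * coeff (B ^ k) s)) * t ^ d) sums T"
proof -
  define x where "x = norm t * coeff_norm A"
  define y where "y = norm t * coeff_norm B"
  have x: "x \<ge> 0" "x < 1" and y: "y \<ge> 0" "y < 1"
    using tA tB by (auto simp: x_def y_def coeff_norm_nonneg)
  define f where "f = (\<lambda>h s. t ^ h * coeff (A ^ h) s / of_nat h)"
  define g where "g = (\<lambda>k s. t ^ k * coeff (B ^ k) s / of_nat k)"
  have deg_f: "f h s = 0" if "s > h * D" for h s
  proof -
    have "degree (A ^ h) \<le> degree A * h" by (rule degree_power_le)
    also have "\<dots> \<le> D * h" using degA by simp
    finally show ?thesis using that by (simp add: f_def coeff_eq_0 mult.commute)
  qed
  have deg_g: "g k s = 0" if "s > k * D" for k s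
  proof -
    have "degree (B ^ k) \<le> degree B * k" by (rule degree_power_le)
    also have "\<dots> \<le> D * k" using degB by simp
    finally show ?thesis using that by (simp add: g_def coeff_eq_0 mult.commute)
  qed
  have nf: "norm (t ^ h * coeff (A ^ h) s) \<le> x ^ h" for h s
    unfolding x_def norm_mult norm_power power_mult_distrib
    by (intro mult_left_mono norm_coeff_power_le) auto
  have ng: "norm (t ^ k * coeff (B ^ k) s) \<le> y ^ k" for k s
    unfolding y_def norm_mult norm_power power_mult_distrib
    by (intro mult_left_mono norm_coeff_power_le) auto
  have div_le: "norm (z / of_nat n) \<le> norm z" for z :: complex and n :: nat
    by (cases n) (auto simp: norm_divide divide_le_eq mult_le_cancel_left1 simp del: of_nat_Suc)
  have f_le: "norm (f h s) \<le> x ^ h" and g_le: "norm (g h s) \<le> y ^ h" for h s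
    using div_le nf ng unfolding f_def g_def by (meson order_trans)+
  have g_sum_le: "(\<Sum>s\<le>k * D. norm (g k s)) \<le> y ^ k" for k
  proof -
    have "(\<Sum>s\<le>k * D. norm (g k s)) \<le> (\<Sum>s\<le>k * D. norm t ^ k * norm (coeff (B ^ k) s))"
      unfolding g_def by (intro sum_mono order_trans[OF div_le]) (simp add: norm_mult norm_power)
    also have "\<dots> \<le> norm t ^ k * coeff_norm B ^ k"
      unfolding sum_distrib_left[symmetric] by (intro mult_left_mono sum_norm_coeff_power) auto
    finally show ?thesis by (simp add: y_def power_mult_distrib)
  qed
  \<comment> \<open>The denominator \<open>h\<close> absorbs the weight \<open>s\<close>: nonzero
    terms have \<open>s \<le> h * D\<close>, at the price of a factor \<open>D\<close>.\<close>
  have sf_le: "norm (of_nat s * f h s) \<le> of_nat D * x ^ h" for h s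
  proof (cases "h = 0 \<or> s > h * D")
    case True
    then have "f h s = 0" using deg_f[of h s] by (auto simp: f_def)
    then show ?thesis using x by simp
  next
    case False
    then have "real s \<le> real h * real D" by (metis not_less of_nat_le_iff of_nat_mult)
    then have "real s / real h \<le> real D" using False by (simp add: divide_le_eq mult.commute)
    then have "real s / real h * norm (t ^ h * coeff (A ^ h) s) \<le> real D * x ^ h"
      by (intro mult_mono nf) auto
    then show ?thesis by (simp add: f_def norm_mult norm_divide)
  qed
  define F where "F = (\<lambda>(h, k, s). of_nat s * f h s * g k s)"
  have "(\<lambda>(k, s). norm (g k s)) summable_on (UNIV \<times> UNIV)"
  proof (rule summable_on_SigmaI)
    fix k
    show "((\<lambda>s. case (k, s) of (k, s) \<Rightarrow> norm (g k s)) has_sum (\<Sum>s\<le>k * D. norm (g k s))) UNIV"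
      by (rule has_sum_finite_neutralI[of "{..k * D}"]) (auto simp: deg_g)
  next
    have "summable (\<lambda>k. \<Sum>s\<le>k * D. norm (g k s))"
      by (rule summable_comparison_test'[of "\<lambda>k. y ^ k" 0])
        (use g_sum_le y in \<open>auto simp: sum_nonneg intro: summable_geometric\<close>)
    then show "(\<lambda>k. \<Sum>s\<le>k * D. norm (g k s)) summable_on UNIV"
      by (subst summable_on_UNIV_nonneg_real_iff) (auto simp: sum_nonneg)
  qed auto
  then have "((\<lambda>(k, s). norm (g k s)) has_sum infsum (\<lambda>(k, s). norm (g k s)) UNIV) UNIV"
    by (intro has_sum_infsum) simp
  then obtain M where M: "((\<lambda>(k, s). norm (g k s)) has_sum M) UNIV" by blast
  \<comment> \<open>A majorant that separates \<open>h\<close> from (k, s): a geometric series in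
    \<open>x\<close> times the summable family of the norms of \<open>g k s\<close>.\<close>
  have "(\<lambda>(h, ks). of_nat D * x ^ h * (case ks of (k, s) \<Rightarrow> norm (g k s))) summable_on (UNIV \<times> UNIV)"
  proof (rule summable_on_SigmaI)
    fix h
    show "((\<lambda>ks. case (h, ks) of (h, ks) \<Rightarrow> of_nat D * x ^ h * (case ks of (k, s) \<Rightarrow> norm (g k s)))
        has_sum (of_nat D * x ^ h * M)) UNIV"
      using has_sum_cmult_right[OF M, of "of_nat D * x ^ h"] by simp
  next
    have "summable (\<lambda>h. of_nat D * x ^ h * M)"
      using x by (intro summable_mult summable_mult2 summable_geometric) auto
    moreover have "M \<ge> 0" by (rule has_sum_nonneg[OF M]) auto
    ultimately show "(\<lambda>h. of_nat D * x ^ h * M) summable_on UNIV"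
      using x by (subst summable_on_UNIV_nonneg_real_iff) auto
  qed (use x in auto)
  then have "(\<lambda>(h, ks). of_nat D * x ^ h * (case ks of (k, s) \<Rightarrow> norm (g k s))) summable_on UNIV"
    by simp
  then have "(\<lambda>hks. norm (case hks of (h, ks) \<Rightarrow>
      of_nat D * x ^ h * (case ks of (k, s) \<Rightarrow> norm (g k s)))) summable_on UNIV"
    using x by (simp add: case_prod_unfold)
  then have "(\<lambda>hks. norm (F hks)) summable_on UNIV"
  proof (rule Infinite_Sum.abs_summable_on_comparison_test)
    fix hks :: "nat \<times> nat \<times> nat"
    obtain h k s where hks: "hks = (h, k, s)" by (cases hks)
    have "norm (F hks) \<le> of_nat D * x ^ h * norm (g k s)"
      unfolding hks F_def using sf_le[of s h] by (simp add: norm_mult mult_right_mono)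
    then show "norm (F hks) \<le> norm (case hks of (h, ks) \<Rightarrow>
        of_nat D * x ^ h * (case ks of (k, s) \<Rightarrow> norm (g k s)))"
      using x by (simp add: hks)
  qed
  then have "F summable_on UNIV" by (rule abs_summable_summable)
  then obtain S where S: "(F has_sum S) UNIV" by (meson summable_on_def)

  have hsf: "((\<lambda>h. f h s) has_sum (p s / of_nat s)) UNIV" if "s \<ge> 1" for s
  proof (rule norm_summable_imp_has_sum)
    show "summable (\<lambda>h. norm (f h s))"
      by (rule summable_comparison_test'[of "\<lambda>k. x ^ k" 0])
        (use f_le x in \<open>auto intro: summable_geometric\<close>)
  qed (use p[OF that] in \<open>simp add: f_def\<close>)
  have hsg: "((\<lambda>h. g h s) has_sum (q s / of_nat s)) UNIV" if "s \<ge> 1" for s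
  proof (rule norm_summable_imp_has_sum)
    show "summable (\<lambda>h. norm (g h s))"
      by (rule summable_comparison_test'[of "\<lambda>k. y ^ k" 0])
        (use g_le y in \<open>auto intro: summable_geometric\<close>)
  qed (use q[OF that] in \<open>simp add: g_def\<close>)

  \<comment> \<open>Grouping by \<open>s\<close>, with \<open>k\<close> summed first and
    \<open>h\<close> second.\<close>
  have "((\<lambda>((s, h), k). of_nat s * f h s * g k s) has_sum S) ((UNIV \<times> UNIV) \<times> UNIV) \<longleftrightarrow>
      (F has_sum S) UNIV"
    by (rule has_sum_reindex_bij_witness[where
      j = "\<lambda>((s, h), k). (h, k, s)" and i = "\<lambda>(h, k, s). ((s, h), k)"]) (auto simp: F_def)
  with S have "((\<lambda>((s, h), k). of_nat s * f h s * g k s) has_sum S) ((UNIV \<times> UNIV) \<times> UNIV)"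
    by simp
  then have "((\<lambda>(s, h). of_nat s * f h s * (q s / of_nat s)) has_sum S) (UNIV \<times> UNIV)"
  proof (rule has_sum_SigmaD)
    fix sh :: "nat \<times> nat"
    obtain s h where sh: "sh = (s, h)" by (cases sh)
    show "((\<lambda>k. (\<lambda>((s, h), k). of_nat s * f h s * g k s) (sh, k)) has_sum
        (case sh of (s, h) \<Rightarrow> of_nat s * f h s * (q s / of_nat s))) UNIV"
      using has_sum_cmult_right[OF hsg, of s "of_nat s * f h s"]
      by (cases "s = 0") (auto simp: sh)
  qed
  then have "((\<lambda>s. p s * q s / of_nat s) has_sum S) UNIV"
  proof (rule has_sum_SigmaD)
    fix s :: nat
    show "((\<lambda>h. (\<lambda>(s, h). of_nat s * f h s * (q s / of_nat s)) (s, h)) has_sum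
        (p s * q s / of_nat s)) UNIV"
    proof (cases "s = 0")
      case False
      then have "((\<lambda>h. q s * f h s) has_sum (q s * (p s / of_nat s))) UNIV"
        by (intro has_sum_cmult_right hsf) simp
      with False show ?thesis by (simp add: mult_ac)
    qed simp
  qed
  from sums_unique2[OF has_sum_imp_sums[OF this] T] have "S = T" .

  \<comment> \<open>Grouping the same family by the total degree \<open>d = h + k\<close>.\<close>
  have "((\<lambda>(d, (h, k), s). F (h, k, s)) has_sum S) (Sigma UNIV (\<lambda>d. {(h, k). h + k = d} \<times> UNIV)) \<longleftrightarrow>
      (F has_sum S) UNIV"
    by (rule has_sum_reindex_bij_witness[where
      j = "\<lambda>(d, (h, k), s). (h, k, s)" and i = "\<lambda>(h, k, s). (h + k, (h, k), s)"]) auto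
  with S have "((\<lambda>(d, (h, k), s). F (h, k, s)) has_sum S)
      (Sigma UNIV (\<lambda>d. {(h, k). h + k = d} \<times> UNIV))"
    by simp
  then have "((\<lambda>d. (\<Sum>(h, k) | h + k = d \<and> h \<ge> 1 \<and> k \<ge> 1. \<Sum>s = 1..min h k * D.
          of_nat s / (of_nat h * of_nat k) * (coeff (A ^ h) s * coeff (B ^ k) s)) * t ^ d) has_sum S) UNIV"
  proof (rule has_sum_SigmaD)
    fix d :: nat
    define I where "I = {(h, k). h + k = d \<and> h \<ge> 1 \<and> k \<ge> 1}"
    define J where "J = (\<lambda>(h, k). {1..min h k * D})"
    have fin: "finite I"
      by (rule finite_subset[of _ "{..d} \<times> {..d}"]) (auto simp: I_def)
    show "((\<lambda>hks. (\<lambda>(d, (h, k), s). F (h, k, s)) (d, hks)) has_sum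
       ((\<Sum>(h, k) | h + k = d \<and> h \<ge> 1 \<and> k \<ge> 1. \<Sum>s = 1..min h k * D.
          of_nat s / (of_nat h * of_nat k) * (coeff (A ^ h) s * coeff (B ^ k) s)) * t ^ d))
       ({(h, k). h + k = d} \<times> UNIV)"
    proof (rule has_sum_finite_neutralI[of "Sigma I J"])
      show "finite (Sigma I J)" using fin by (auto simp: J_def)
      show "Sigma I J \<subseteq> {(h, k). h + k = d} \<times> UNIV" by (auto simp: I_def)
    next
      \<comment> \<open>Outside the finite index set a term is 0: for \<open>h = 0\<close> or
        \<open>k = 0\<close> by division by zero, for \<open>s = 0\<close> by the weight, and for
        larger \<open>s\<close> by the degrees of the powers.\<close>
      fix hks assume "hks \<in> {(h, k). h + k = d} \<times> UNIV - Sigma I J"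
      moreover obtain h k s where hks: "hks = ((h, k), s)" by (cases hks) auto
      ultimately have "h = 0 \<or> k = 0 \<or> s = 0 \<or> s > h * D \<or> s > k * D"
        by (auto simp: I_def J_def min_def split: if_splits)
      then have "F (h, k, s) = 0"
        using deg_f[of h s] deg_g[of k s] by (auto simp: F_def f_def g_def)
      then show "((\<lambda>(d, (h, k), s). F (h, k, s)) (d, hks)) = 0" by (simp add: hks)
    next
      have "(\<Sum>(h, k)\<in>I. \<Sum>s = 1..min h k * D.
          of_nat s / (of_nat h * of_nat k) * (coeff (A ^ h) s * coeff (B ^ k) s)) * t ^ d =
        (\<Sum>hk\<in>I. \<Sum>s\<in>J hk. F (fst hk, snd hk, s))"
        unfolding sum_distrib_right
      proof (intro sum.cong refl)
        fix hk assume "hk \<in> I"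
        then obtain h k where hk: "hk = (h, k)" "h + k = d" by (auto simp: I_def)
        show "(case hk of (h, k) \<Rightarrow> \<Sum>s = 1..min h k * D.
            of_nat s / (of_nat h * of_nat k) * (coeff (A ^ h) s * coeff (B ^ k) s)) * t ^ d =
          (\<Sum>s\<in>J hk. F (fst hk, snd hk, s))"
          unfolding hk(1) prod.case sum_distrib_right
          by (intro sum.cong) (auto simp: J_def F_def f_def g_def hk(2)[symmetric] power_add)
      qed
      also have "\<dots> = (\<Sum>hks\<in>Sigma I J. (\<lambda>(d, (h, k), s). F (h, k, s)) (d, hks))"
        using fin by (subst sum.Sigma) (auto simp: J_def case_prod_unfold)
      finally show "(\<Sum>(h, k) | h + k = d \<and> h \<ge> 1 \<and> k \<ge> 1. \<Sum>s = 1..min h k * D.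
          of_nat s / (of_nat h * of_nat k) * (coeff (A ^ h) s * coeff (B ^ k) s)) * t ^ d =
        (\<Sum>hks\<in>Sigma I J. (\<lambda>(d, (h, k), s). F (h, k, s)) (d, hks))"
        unfolding I_def .
    qed
  qed
  then show ?thesis unfolding \<open>S = T\<close> by (rule has_sum_imp_sums)
qed

text \<open>Each factor has a principal logarithm given by its power series, as
  \<open>t * coeff A 0\<close>, \<open>t * coeff B 0\<close> and all \<open>w i * z j\<close> have
  norm below 1. Only \<open>exp S\<close> is compared with the product, so the logarithm of a
  product, and with it the choice of a branch, never enters.\<close>

lemma pencil_log_sums:
  fixes A B :: "complex poly" and w z :: "nat \<Rightarrow> complex"
  assumes degA: "degree A \<le> D" and degB: "degree B \<le> D"
    and tA: "norm t * coeff_norm A < 1" and tB: "norm t * coeff_norm B < 1"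
    and u: "1 - t * coeff A 0 \<noteq> 0" and v: "1 - t * coeff B 0 \<noteq> 0"
    and w: "1 - smult t A = smult (1 - t * coeff A 0) (\<Prod>i<D. [:1, - w i:])"
    and z: "1 - smult t B = smult (1 - t * coeff B 0) (\<Prod>i<D. [:1, - z i:])"
  shows "\<exists>S. (\<lambda>d. pencil_log_coeff D A B d * t ^ d) sums S \<and>
    exp S = (1 - t * coeff A 0) ^ D * (1 - t * coeff B 0) ^ D * (\<Prod>i<D. \<Prod>j<D. 1 - w i * z j)"
proof -
  have small: "norm (t * coeff C 0) < 1" if "norm t * coeff_norm C < 1" for C
  proof -
    have "norm (t * coeff C 0) \<le> norm t * coeff_norm C"
      unfolding norm_mult using norm_coeff_power_le[of C 1 0] by (intro mult_left_mono) auto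
    with that show ?thesis by simp
  qed
  have wz: "norm (w i * z j) < 1" if "i < D" "j < D" for i j
    unfolding norm_mult
    using reciprocal_roots_small[OF w tA that(1)] reciprocal_roots_small[OF z tB that(2)]
    by (metis abs_norm_cancel abs_mult_less mult_1)
  define T where "T = (\<Sum>i<D. \<Sum>j<D. Ln (1 - w i * z j))"
  have "(\<lambda>s. \<Sum>i<D. \<Sum>j<D. - ((w i * z j) ^ s / of_nat s)) sums T"
    unfolding T_def by (intro sums_sum Ln_one_minus_sums wz) auto
  then have "(\<lambda>s. (\<Sum>i<D. w i ^ s) * (\<Sum>j<D. z j ^ s) / of_nat s) sums (- T)"
    unfolding sum_product using sums_minus
    by (fastforce simp: power_mult_distrib sum_negf sum_divide_distrib)
  from mixed_log_terms_sums[OF degA degB tA tB power_sum_sums[OF w u tA] power_sum_sums[OF z v tB] this]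
  have mixed: "(\<lambda>d. (\<Sum>(h, k) | h + k = d \<and> h \<ge> 1 \<and> k \<ge> 1. \<Sum>s = 1..min h k * D.
      of_nat s / (of_nat h * of_nat k) * (coeff (A ^ h) s * coeff (B ^ k) s)) * t ^ d) sums (- T)" .
  have "(\<lambda>d. of_nat D * (- ((t * coeff A 0) ^ d / of_nat d) + - ((t * coeff B 0) ^ d / of_nat d)) -
      (\<Sum>(h, k) | h + k = d \<and> h \<ge> 1 \<and> k \<ge> 1. \<Sum>s = 1..min h k * D.
      of_nat s / (of_nat h * of_nat k) * (coeff (A ^ h) s * coeff (B ^ k) s)) * t ^ d) sums
    (of_nat D * (Ln (1 - t * coeff A 0) + Ln (1 - t * coeff B 0)) - (- T))"
    by (intro sums_diff sums_mult sums_add Ln_one_minus_sums small tA tB mixed)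
  moreover have "of_nat D * (- ((t * coeff A 0) ^ d / of_nat d) + - ((t * coeff B 0) ^ d / of_nat d)) - X * t ^ d =
      - (of_nat D * (coeff A 0 ^ d + coeff B 0 ^ d) / of_nat d + X) * t ^ d" for d X
    by (simp add: power_mult_distrib add_divide_distrib algebra_simps)
  ultimately have "(\<lambda>d. pencil_log_coeff D A B d * t ^ d) sums
      (of_nat D * (Ln (1 - t * coeff A 0) + Ln (1 - t * coeff B 0)) - (- T))"
    unfolding pencil_log_coeff_def by simp
  moreover have "1 - w i * z j \<noteq> 0" if "i < D" "j < D" for i j
    using wz[OF that] by auto
  then have "exp T = (\<Prod>i<D. \<Prod>j<D. 1 - w i * z j)"
    unfolding T_def by (simp add: exp_sum)
  then have "exp (of_nat D * (Ln (1 - t * coeff A 0) + Ln (1 - t * coeff B 0)) - (- T)) =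
      (1 - t * coeff A 0) ^ D * (1 - t * coeff B 0) ^ D * (\<Prod>i<D. \<Prod>j<D. 1 - w i * z j)"
    using u v by (simp add: exp_add exp_of_nat_mult power_mult_distrib)
  ultimately show ?thesis by blast
qed

subsection \<open>The coefficient formula\<close>

lemma fps_linear_ode_unique:
  fixes F G K :: "'a::field_char_0 fps"
  assumes "fps_deriv F = K * F" "fps_deriv G = K * G" "F $ 0 = G $ 0"
  shows "F = G"
proof (rule fps_ext)
  fix n
  show "F $ n = G $ n"
  proof (induction n rule: less_induct)
    case (less n)
    show ?case
    proof (cases n)
      case (Suc m)
      have "of_nat n * F $ n = fps_deriv F $ m" "of_nat n * G $ n = fps_deriv G $ m"
        using Suc by simp_all
      moreover have "(K * F) $ m = (K * G) $ m"
        unfolding fps_mult_nth using less.IH Suc by (intro sum.cong) auto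
      ultimately have "of_nat n * F $ n = of_nat n * G $ n" using assms by metis
      then show ?thesis using Suc by (simp del: of_nat_Suc)
    qed (use assms in simp)
  qed
qed

text \<open>Both series solve the formal equation F' = L' F with the same constant term. This passes
  from the analytic identity to formal composition without rearranging the iterated series.\<close>

lemma fps_expansion_exp_compose:
  fixes F L :: "complex fps"
  assumes f: "f has_fps_expansion F" and L0: "L $ 0 = 0"
    and g: "\<forall>\<^sub>F t in nhds 0. (\<lambda>d. L $ d * t ^ d) sums g t"
    and fg: "\<forall>\<^sub>F t in nhds 0. f t = exp (g t)"
  shows "F = fps_exp 1 oo L"
proof (rule fps_linear_ode_unique)
  have gL: "g has_fps_expansion L" using g by (rule has_fps_expansionI)
  obtain s where s: "open s" "0 \<in> s" "g holomorphic_on s"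
    using has_fps_expansion_imp_holomorphic[OF gL] by metis
  have "\<forall>\<^sub>F t in nhds 0. t \<in> s" using s by (intro eventually_nhds_in_open)
  \<comment> \<open>Differentiating at \<open>t\<close> requires the identity on a whole
    neighbourhood of \<open>t\<close>, not only at \<open>t\<close>.\<close>
  moreover have "\<forall>\<^sub>F t in nhds 0. \<forall>\<^sub>F t' in nhds t. f t' = exp (g t')"
    using fg by (simp add: eventually_eventually)
  ultimately have "\<forall>\<^sub>F t in nhds 0. deriv f t = deriv g t * f t"
    using fg
  proof eventually_elim
    case (elim t)
    have "(g has_field_derivative deriv g t) (at t)"
      using s elim by (intro holomorphic_derivI) auto
    then have "((\<lambda>t. exp (g t)) has_field_derivative (exp (g t) * deriv g t)) (at t)"
      by (rule DERIV_fun_exp)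
    then have "deriv (\<lambda>t. exp (g t)) t = exp (g t) * deriv g t" by (rule DERIV_imp_deriv)
    moreover have "deriv f t = deriv (\<lambda>t. exp (g t)) t"
      using elim by (intro deriv_cong_ev) auto
    ultimately show ?case using elim by (simp add: mult.commute)
  qed
  moreover have "deriv f has_fps_expansion fps_deriv F"
    using f by (rule has_fps_expansion_deriv)
  ultimately have fF: "(\<lambda>t. deriv g t * f t) has_fps_expansion fps_deriv F"
    unfolding has_fps_expansion_def by (auto elim: eventually_elim2)
  have gF: "(\<lambda>t. deriv g t * f t) has_fps_expansion fps_deriv L * F"
    using gL f by (intro has_fps_expansion_mult has_fps_expansion_deriv)
  show "fps_deriv F = fps_deriv L * F"
    by (rule fps_ext) (simp only: fps_nth_fps_expansion[OF fF] fps_nth_fps_expansion[OF gF])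
  show "fps_deriv (fps_exp 1 oo L) = fps_deriv L * (fps_exp 1 oo L)"
    using L0 by (simp add: fps_compose_deriv mult.commute)
  have "f 0 = exp (g 0)" using fg by (rule eventually_nhds_x_imp_x)
  moreover have "f 0 = F $ 0" "g 0 = L $ 0"
    using fps_nth_fps_expansion[OF f, of 0] fps_nth_fps_expansion[OF gL, of 0] by simp_all
  ultimately show "F $ 0 = (fps_exp 1 oo L) $ 0" using L0 by simp
qed

section \<open>Coefficients of powers and exponentials as sums over compositions\<close>

lemma fps_power_nth_list:
  fixes f :: "'a::comm_ring_1 fps"
  shows "(f ^ k) $ n = (\<Sum>v\<in>natpermute n k. \<Prod>d\<leftarrow>v. f $ d)"
proof (cases k)
  case 0
  then show ?thesis by (auto simp: natpermute_0)
next
  case (Suc m)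
  have "(f ^ k) $ n = (\<Sum>v\<in>natpermute n k. \<Prod>j\<in>{0..m}. f $ (v ! j))"
    unfolding Suc fps_power_nth_Suc by simp
  also have "\<dots> = (\<Sum>v\<in>natpermute n k. \<Prod>d\<leftarrow>v. f $ d)"
  proof (rule sum.cong[OF refl])
    fix v assume "v \<in> natpermute n k"
    then have len: "length v = Suc m" by (simp add: natpermute_def Suc)
    have "(\<Prod>d\<leftarrow>v. f $ d) = (\<Prod>j = 0..<Suc m. map (($) f) v ! j)"
      unfolding prod.list_conv_set_nth by (simp only: length_map len)
    also have "\<dots> = (\<Prod>j\<in>{0..m}. f $ (v ! j))"
      using len by (intro prod.cong) auto
    finally show "(\<Prod>j\<in>{0..m}. f $ (v ! j)) = (\<Prod>d\<leftarrow>v. f $ d)" ..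
  qed
  finally show ?thesis .
qed

text \<open>The restrictions only remove zero terms: the power 0 of \<open>L\<close> has no
  coefficient at \<open>n > 0\<close>, and a list with a part 0 contains the factor
  \<open>L $ 0\<close>. This is where the sum over positive \<open>ds\<close> in the theorem comes
  from.\<close>

lemma fps_exp_compose_nth:
  fixes L :: "'a::field_char_0 fps"
  assumes "n > 0" "L $ 0 = 0"
  shows "(fps_exp 1 oo L) $ n = (\<Sum>i = 1..n. 1 / fact i *
    (\<Sum>ds | length ds = i \<and> (\<forall>d\<in>set ds. d > 0) \<and> sum_list ds = n. \<Prod>d\<leftarrow>ds. L $ d))"
proof -
  have "(fps_exp 1 oo L) $ n = (\<Sum>i = 0..n. 1 / fact i * (L ^ i) $ n)"
    by (simp add: fps_compose_nth)
  also have "\<dots> = (\<Sum>i = 1..n. 1 / fact i * (L ^ i) $ n)"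
    using assms(1) by (intro sum.mono_neutral_right) (auto simp: not_le)
  also have "\<dots> = (\<Sum>i = 1..n. 1 / fact i *
    (\<Sum>ds | length ds = i \<and> (\<forall>d\<in>set ds. d > 0) \<and> sum_list ds = n. \<Prod>d\<leftarrow>ds. L $ d))"
  proof (intro sum.cong refl arg_cong2[of _ _ _ _ "(*)"])
    fix i
    show "(L ^ i) $ n =
      (\<Sum>ds | length ds = i \<and> (\<forall>d\<in>set ds. d > 0) \<and> sum_list ds = n. \<Prod>d\<leftarrow>ds. L $ d)"
      unfolding fps_power_nth_list
    proof (intro sum.mono_neutral_right ballI)
      fix v assume "v \<in> natpermute n i - {ds. length ds = i \<and> (\<forall>d\<in>set ds. d > 0) \<and> sum_list ds = n}"
      then have "0 \<in> set v" by (auto simp: natpermute_def)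
      then show "(\<Prod>d\<leftarrow>v. L $ d) = 0" using assms(2) by (force simp: prod_list_zero_iff)
    qed (auto simp: natpermute_def intro: natpermute_finite[unfolded natpermute_def])
  qed
  finally show ?thesis .
qed

definition exp_trace_form :: "nat \<Rightarrow> complex poly \<Rightarrow> complex poly \<Rightarrow> complex" where
  "exp_trace_form D A B = (\<Sum>i = 1..2 * D. 1 / fact i *
     (\<Sum>ds | length ds = i \<and> (\<forall>d\<in>set ds. d > 0) \<and> sum_list ds = 2 * D.
        \<Prod>d\<leftarrow>ds. pencil_log_coeff D A B d))"

text \<open>Both sides are the coefficient of t^(2 D) in the pencil polynomial: one by its direct
  evaluation, the other because near 0 the polynomial is the exponential of the series with
  coefficients \<open>pencil_log_coeff\<close>.\<close>

lemma exp_trace_form_reciprocal_roots: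
  fixes A B :: "complex poly"
  assumes D: "D > 0" and degA: "degree A \<le> D" and degB: "degree B \<le> D"
    and A: "A = smult a (\<Prod>i<D. [:1, - r i:])"
  shows "exp_trace_form D A B = a ^ D * (\<Prod>i<D. poly B (r i))"
proof -
  obtain q where top: "coeff q (2 * D) = a ^ D * (\<Prod>i<D. poly B (r i))" and
    q: "\<And>t w z. 1 - t * coeff A 0 \<noteq> 0 \<Longrightarrow> 1 - t * coeff B 0 \<noteq> 0 \<Longrightarrow>
      1 - smult t A = smult (1 - t * coeff A 0) (\<Prod>i<D. [:1, - w i:]) \<Longrightarrow>
      1 - smult t B = smult (1 - t * coeff B 0) (\<Prod>i<D. [:1, - z i:]) \<Longrightarrow>
      poly q t = (1 - t * coeff A 0) ^ D * (1 - t * coeff B 0) ^ D *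
        (\<Prod>i<D. \<Prod>j<D. 1 - w i * z j)"
    using pencil_resultant_polynomial[OF D degA degB A] by blast
  define L where "L = Abs_fps (pencil_log_coeff D A B)"
  define g where "g = (\<lambda>t. suminf (\<lambda>d. L $ d * t ^ d))"
  have L0: "L $ 0 = 0"
  proof -
    have empty: "{(h, k). h + k = (0::nat) \<and> h \<ge> 1 \<and> k \<ge> 1} = {}" by auto
    show ?thesis unfolding L_def fps_nth_Abs_fps pencil_log_coeff_def empty by simp
  qed
  have main: "(\<lambda>d. L $ d * t ^ d) sums g t \<and> poly q t = exp (g t)"
    if tA: "norm t * coeff_norm A < 1" and tB: "norm t * coeff_norm B < 1" for t
  proof -
    have nz: "1 - t * coeff C 0 \<noteq> 0" if "norm t * coeff_norm C < 1" for C
    proof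
      assume "1 - t * coeff C 0 = 0"
      then have "1 = norm (t * coeff C 0)" by (metis eq_iff_diff_eq_0 norm_one)
      also have "\<dots> \<le> norm t * coeff_norm C"
        unfolding norm_mult using norm_coeff_power_le[of C 1 0] by (intro mult_left_mono) auto
      finally show False using that by simp
    qed
    have ex: "\<exists>w. 1 - smult t C = smult (1 - t * coeff C 0) (\<Prod>j<D. [:1, - w j:])"
      if "norm t * coeff_norm C < 1" "degree C \<le> D" for C
      using complex_poly_reciprocal_roots[of "1 - smult t C" D] nz[OF that(1)] that(2) D
      by (simp add: degree_diff_le order_trans[OF degree_smult_le])
    from ex[OF tA degA] ex[OF tB degB] obtain w z where
      w: "1 - smult t A = smult (1 - t * coeff A 0) (\<Prod>i<D. [:1, - w i:])" and
      z: "1 - smult t B = smult (1 - t * coeff B 0) (\<Prod>i<D. [:1, - z i:])" by blast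
    from pencil_log_sums[OF degA degB tA tB nz[OF tA] nz[OF tB] w z] q[OF nz[OF tA] nz[OF tB] w z]
    obtain S where "(\<lambda>d. L $ d * t ^ d) sums S" "poly q t = exp S"
      by (auto simp: L_def)
    then show ?thesis unfolding g_def by (simp add: sums_iff)
  qed
  have "\<forall>\<^sub>F t in nhds (0::complex). norm t * coeff_norm C < 1" for C
  proof -
    have "((\<lambda>t::complex. norm t * coeff_norm C) \<longlongrightarrow> norm (0::complex) * coeff_norm C) (nhds 0)"
      by (intro tendsto_intros filterlim_ident)
    then show ?thesis by (rule order_tendstoD) simp
  qed
  from this[of A] this[of B]
  have ev: "\<forall>\<^sub>F t in nhds 0. (\<lambda>d. L $ d * t ^ d) sums g t \<and> poly q t = exp (g t)"
    by eventually_elim (rule main)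
  have "fps_of_poly q = fps_exp 1 oo L"
  proof (rule fps_expansion_exp_compose)
    show "poly q has_fps_expansion fps_of_poly q"
      by (auto simp: has_fps_expansion_def)
  qed (use ev L0 in \<open>auto elim: eventually_mono\<close>)
  then have "coeff q (2 * D) = (fps_exp 1 oo L) $ (2 * D)"
    by (metis fps_of_poly_nth)
  also have "\<dots> = exp_trace_form D A B"
  proof -
    have "($) L = pencil_log_coeff D A B" by (rule ext) (simp add: L_def)
    then show ?thesis using D L0 by (simp add: fps_exp_compose_nth exp_trace_form_def)
  qed
  finally show ?thesis using top by simp
qed

section \<open>Extension of the product formula by polynomial dependence on the coefficients\<close>

lemma coeff_power_list:
  "coeff (p ^ h) s = (\<Sum>v\<in>natpermute s h. \<Prod>d\<leftarrow>v. coeff (p :: 'a::comm_ring_1 poly) d)"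
  using fps_power_nth_list[of "fps_of_poly p" h s] by (simp add: fps_of_poly_power[symmetric])

lemma polyfun_divide: "polyfun S f \<Longrightarrow> polyfun S (\<lambda>x. f x / c)"
  using polyfun_cmult[of S f "1 / c"] by simp

lemma polyfun_minus: "polyfun S f \<Longrightarrow> polyfun S (\<lambda>x. - f x)"
  using polyfun_cmult[of S f "-1"] by simp

text \<open>Needed to deform \<open>A\<close> in the next product formula. The sum type indexes the
  coefficients of \<open>A\<close> by \<open>Inl\<close> and those of \<open>B\<close> by
  \<open>Inr\<close>.\<close>

lemma polyfun_exp_trace_form:
  "\<exists>E. polyfun UNIV E \<and> (\<forall>A B. exp_trace_form D A B = E (case_sum (coeff A) (coeff B)))"
proof -
  define P where "P = (\<lambda>j h s y. \<Sum>v\<in>natpermute s h. \<Prod>d\<leftarrow>v. y (j d :: nat + nat) :: complex)"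
  have P: "polyfun UNIV (P j h s)" for j h s
    unfolding P_def by (intro polyfun_intros polyfun_var) simp
  define l where "l = (\<lambda>d y. - (of_nat D * (y (Inl 0) ^ d + y (Inr 0) ^ d) / of_nat d +
       (\<Sum>hk | fst hk + snd hk = d \<and> fst hk \<ge> 1 \<and> snd hk \<ge> 1. \<Sum>s = 1..min (fst hk) (snd hk) * D.
          of_nat s / (of_nat (fst hk) * of_nat (snd hk)) * (P Inl (fst hk) s y * P Inr (snd hk) s y))))"
  have l: "polyfun UNIV (l d)" for d
    unfolding l_def by (intro polyfun_minus polyfun_divide polyfun_intros polyfun_var P) simp_all
  have "pencil_log_coeff D A B = (\<lambda>d. l d (case_sum (coeff A) (coeff B)))" for A B
    unfolding pencil_log_coeff_def l_def P_def
    by (rule ext) (simp add: case_prod_unfold coeff_power_list)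
  then have "exp_trace_form D A B = (\<Sum>i = 1..2 * D. 1 / fact i *
     (\<Sum>ds | length ds = i \<and> (\<forall>d\<in>set ds. d > 0) \<and> sum_list ds = 2 * D.
        \<Prod>d\<leftarrow>ds. l d (case_sum (coeff A) (coeff B))))" for A B
    unfolding exp_trace_form_def by simp
  moreover have "polyfun UNIV (\<lambda>y. \<Sum>i = 1..2 * D. 1 / fact i *
     (\<Sum>ds | length ds = i \<and> (\<forall>d\<in>set ds. d > 0) \<and> sum_list ds = 2 * D. \<Prod>d\<leftarrow>ds. l d y))"
    by (intro polyfun_intros l)
  ultimately show ?thesis by (intro exI conjI allI)
qed

lemma coeff_prod_linear_family:
  assumes "\<And>j. j < D \<Longrightarrow> univ_polyfun (P j)" "\<And>j. j < D \<Longrightarrow> univ_polyfun (Q j)"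
  shows "univ_polyfun (\<lambda>t. coeff (\<Prod>j<(D::nat). [:P j t, Q j t:]) a)"
  using assms
proof (induction D arbitrary: a)
  case (Suc D)
  have "coeff (\<Prod>j<Suc D. [:P j t, Q j t:]) a = P D t * coeff (\<Prod>j<D. [:P j t, Q j t:]) a +
      (if a = 0 then 0 else Q D t * coeff (\<Prod>j<D. [:P j t, Q j t:]) (a - 1))" for t
    by (cases a) (simp_all add: mult.commute)
  moreover have "univ_polyfun (\<lambda>t. if a = 0 then 0 else Q D t * coeff (\<Prod>j<D. [:P j t, Q j t:]) (a - 1))"
    using Suc by (cases "a = 0") (auto intro!: univ_polyfun_intros)
  ultimately show ?case using Suc by (auto intro!: univ_polyfun_intros)
qed (auto intro: univ_polyfun_const)

lemma poly_eq_sum_le: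
  fixes p :: "complex poly"
  assumes "degree p \<le> n"
  shows "poly p x = (\<Sum>i\<le>n. coeff p i * x ^ i)"
  unfolding poly_altdef by (rule sum.mono_neutral_left) (use assms in \<open>auto simp: coeff_eq_0\<close>)

text \<open>The previous formula covers the case that no \<open>P j\<close> is 0. Adding
  \<open>t\<close> to all of them reaches that case for almost all \<open>t\<close>, and both sides
  are polynomial in \<open>t\<close>. The factors on the right are values of the second form at the
  projective zeros \<open>(Q j, P j)\<close>.\<close>

lemma exp_trace_form_linear_factors:
  fixes B :: "complex poly"
  assumes D: "D > 0" and degB: "degree B \<le> D"
  shows "exp_trace_form D (\<Prod>j<D. [:P j, - Q j:]) B =
    (\<Prod>j<D. \<Sum>b\<le>D. coeff B b * Q j ^ b * P j ^ (D - b))"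
proof -
  have nz: "exp_trace_form D (\<Prod>j<D. [:P j, - Q j:]) B =
    (\<Prod>j<D. \<Sum>b\<le>D. coeff B b * Q j ^ b * P j ^ (D - b))" if "\<And>j. j < D \<Longrightarrow> P j \<noteq> 0" for P
  proof -
    define a where "a = (\<Prod>j<D. P j)"
    have A: "(\<Prod>j<D. [:P j, - Q j:]) = smult a (\<Prod>j<D. [:1, - (Q j / P j):])"
    proof -
      have "(\<Prod>j<D. [:P j, - Q j:]) = (\<Prod>j<D. smult (P j) [:1, - (Q j / P j):])"
        by (rule prod.cong) (use that in auto)
      then show ?thesis unfolding a_def by (simp add: prod_smult del: smult_pCons)
    qed
    have "exp_trace_form D (\<Prod>j<D. [:P j, - Q j:]) B = a ^ D * (\<Prod>j<D. poly B (Q j / P j))"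
      by (rule exp_trace_form_reciprocal_roots[OF D degree_prod_linear_le degB A])
    also have "\<dots> = (\<Prod>j<D. P j ^ D * poly B (Q j / P j))"
      unfolding a_def prod_power_distrib prod.distrib ..
    also have "\<dots> = (\<Prod>j<D. \<Sum>b\<le>D. coeff B b * Q j ^ b * P j ^ (D - b))"
    proof (rule prod.cong[OF refl])
      fix j assume "j \<in> {..<D}"
      then have "P j \<noteq> 0" using that by auto
      then show "P j ^ D * poly B (Q j / P j) = (\<Sum>b\<le>D. coeff B b * Q j ^ b * P j ^ (D - b))"
        unfolding poly_eq_sum_le[OF degB] sum_distrib_left
        by (intro sum.cong) (auto simp: power_divide power_diff)
    qed
    finally show ?thesis .
  qed
  obtain E where E: "polyfun UNIV E" "\<And>A B. exp_trace_form D A B = E (case_sum (coeff A) (coeff B))"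
    using polyfun_exp_trace_form by blast
  define f where "f = (\<lambda>t. exp_trace_form D (\<Prod>j<D. [:P j + t, - Q j:]) B -
    (\<Prod>j<D. \<Sum>b\<le>D. coeff B b * Q j ^ b * (P j + t) ^ (D - b)))"
  have "univ_polyfun (\<lambda>t. E (case_sum (coeff (\<Prod>j<D. [:P j + t, - Q j:])) (coeff B)))"
  proof (rule polyfun_along[OF E(1)])
    fix v :: "nat + nat"
    show "univ_polyfun (\<lambda>t. case_sum (coeff (\<Prod>j<D. [:P j + t, - Q j:])) (coeff B) v)"
      by (cases v) (auto intro!: coeff_prod_linear_family univ_polyfun_intros)
  qed
  then have f: "univ_polyfun f"
    unfolding f_def E(2) by (intro univ_polyfun_intros)
  have "finite ((\<lambda>j. - P j) ` {..<D})" by simp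
  then obtain t0 where t0: "t0 \<notin> (\<lambda>j. - P j) ` {..<D}"
    using ex_new_if_finite[OF infinite_UNIV_char_0] by blast
  have "f 0 = 0"
  proof (rule univ_polyfun_vanishes[OF f, of "\<lambda>t. \<Prod>j<D. P j + t"])
    show "univ_polyfun (\<lambda>t. \<Prod>j<D. P j + t)" by (intro univ_polyfun_intros)
    show "(\<Prod>j<D. P j + t0) \<noteq> 0" using t0 by (auto simp: eq_neg_iff_add_eq_0 add.commute)
    show "f t = 0" if "(\<Prod>j<D. P j + t) \<noteq> 0" for t
      unfolding f_def using nz[of "\<lambda>j. P j + t"] that by auto
  qed
  then show ?thesis unfolding f_def by simp
qed

subsection \<open>Divisibility by the resultant of two binary forms\<close>

lemma binary_form_dehomogenize:
  fixes p :: "complex poly"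
  assumes "degree p \<le> D"
  shows "(\<Sum>a\<le>D. coeff p a * X ^ (D - a) * Y ^ a) =
    (if X = 0 then coeff p D * Y ^ D else X ^ D * poly p (Y / X))"
proof (cases "X = 0")
  case True
  have "(\<Sum>a\<le>D. coeff p a * X ^ (D - a) * Y ^ a) = (\<Sum>a\<in>{D}. coeff p a * X ^ (D - a) * Y ^ a)"
    by (rule sum.mono_neutral_right) (use True in auto)
  with True show ?thesis by simp
next
  case False
  then show ?thesis
    unfolding poly_eq_sum_le[OF assms] sum_distrib_left
    by (auto intro!: sum.cong simp: power_divide power_diff)
qed

lemma binary_form_linear_factors:
  fixes P Q :: "nat \<Rightarrow> complex"
  shows "(\<Sum>a\<le>D. coeff (\<Prod>j<D. [:P j, - Q j:]) a * X ^ (D - a) * Y ^ a) = (\<Prod>j<D. P j * X - Q j * Y)"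
proof (cases "X = 0")
  case True
  have "(\<Prod>j<D. P j * X - Q j * Y) = (\<Prod>j<D. (- Q j) * Y)"
    using True by simp
  then show ?thesis
    unfolding binary_form_dehomogenize[OF degree_prod_linear_le] coeff_prod_linear_top prod.distrib
    using True by simp
next
  case False
  have "(\<Prod>j<D. P j * X - Q j * Y) = (\<Prod>j<D. X * poly [:P j, - Q j:] (Y / X))"
    using False by (intro prod.cong) (auto simp: field_simps)
  then show ?thesis
    unfolding binary_form_dehomogenize[OF degree_prod_linear_le] prod.distrib poly_prod
    using False by simp
qed

text \<open>For \<open>X = 0\<close> the factor \<open>[:- Y, X:]\<close> is a nonzero constant, and
  vanishing at this point at infinity means a drop of the degree. The bound on \<open>C\<close> thus
  says that \<open>C\<close> is a form of degree \<open>D - 1\<close> in either case.\<close>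

lemma binary_form_zero_factor:
  fixes p :: "complex poly"
  assumes D: "D > 0" and deg: "degree p \<le> D" and XY: "(X, Y) \<noteq> (0, 0)"
    and zero: "(\<Sum>a\<le>D. coeff p a * X ^ (D - a) * Y ^ a) = 0"
  shows "\<exists>C. p = [:- Y, X:] * C \<and> degree C < D"
proof (cases "X = 0")
  case True
  then have "coeff p D = 0" using zero XY unfolding binary_form_dehomogenize[OF deg] by simp
  then have "degree p < D" using deg D by (cases "degree p = D") auto
  moreover have "p = [:- Y, X:] * smult (- 1 / Y) p" using XY True by simp
  ultimately show ?thesis
    by (intro exI[of _ "smult (- 1 / Y) p"]) (auto intro: le_less_trans[OF degree_smult_le])
next
  case False
  then have "poly p (Y / X) = 0"
    using zero unfolding binary_form_dehomogenize[OF deg] by simp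
  then obtain C where C: "p = [:- (Y / X), 1:] * C" by (auto simp: poly_eq_0_iff_dvd)
  have "[:- Y, X:] = smult X [:- (Y / X), 1:]" using False by simp
  then have "[:- Y, X:] * smult (1 / X) C = p"
    using False unfolding C by (simp del: mult_pCons_left smult_pCons)
  moreover have "degree C < D"
  proof (cases "C = 0")
    case False
    then have "degree p = 1 + degree C"
      unfolding C by (subst degree_mult_eq) auto
    then show ?thesis using deg by simp
  qed (use D in simp)
  ultimately show ?thesis
    by (intro exI[of _ "smult (1 / X) C"]) (auto intro: le_less_trans[OF degree_smult_le])
qed

lemma binary_form_linear_multiple_zero:
  fixes C :: "complex poly"
  assumes "degree C < D"
  shows "(\<Sum>a\<le>D. coeff ([:- Y, X:] * C) a * X ^ (D - a) * Y ^ a) = 0"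
proof -
  have deg: "degree ([:- Y, X:] * C) \<le> D"
  proof -
    have "degree ([:- Y, X:] * C) \<le> degree [:- Y, X:] + degree C" by (rule degree_mult_le)
    also have "\<dots> \<le> 1 + degree C" by simp
    finally show ?thesis using assms by simp
  qed
  show ?thesis
  proof (cases "X = 0")
    case True
    then show ?thesis
      unfolding binary_form_dehomogenize[OF deg] using assms by (simp add: coeff_eq_0)
  next
    case False
    then have "poly ([:- Y, X:] * C) (Y / X) = 0" by simp
    with False show ?thesis unfolding binary_form_dehomogenize[OF deg] by simp
  qed
qed

lemma coeff_sum_monom:
  fixes c :: "nat \<Rightarrow> complex"
  shows "coeff (\<Sum>a\<le>D. monom (c a) a) i = (if i \<le> D then c i else 0)"
  by (simp add: coeff_sum coeff_monom sum.delta')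

text \<open>\<open>av a\<close> and \<open>bv b\<close> are the variables for the coefficients of \<open>x\<^bsup>D-a\<^esup> y\<^sup>a\<close> in the first and of
  \<open>y\<^bsup>D-b\<^esup> x\<^sup>b\<close> in the second form; the product in \<open>R_eq\<close> runs over the zeros \<open>(Q j, P j)\<close> of the first
  form.\<close>

locale binary_resultant =
  fixes D :: nat and av bv :: "nat \<Rightarrow> 'v" and R :: "('v \<Rightarrow> complex) \<Rightarrow> complex"
  assumes D: "D > 0" and inj_av: "inj_on av {..D}" and inj_bv: "inj_on bv {..D}"
    and disj: "\<And>a b. a \<le> D \<Longrightarrow> b \<le> D \<Longrightarrow> av a \<noteq> bv b"
    and polyfun_R: "polyfun UNIV R"
    and R_eq: "\<And>x P Q. (\<And>a. a \<le> D \<Longrightarrow> x (av a) = coeff (\<Prod>j<D. [:P j, - Q j:]) a) \<Longrightarrow>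
      R x = (\<Prod>j<D. \<Sum>b\<le>D. x (bv b) * Q j ^ b * P j ^ (D - b))"
begin

section \<open>Pseudo-division by \<open>R\<close> in the variable \<open>bv 0\<close>\<close>

lemma degree_sum_monom: "degree (\<Sum>a\<le>D. monom (c a :: complex) a) \<le> D"
  by (intro degree_le) (auto simp: coeff_sum_monom)

lemma linear_factors:
  fixes c :: "nat \<Rightarrow> complex"
  shows "\<exists>P Q. \<forall>a\<le>D. c a = coeff (\<Prod>j<D. [:P j, - Q j:]) a"
proof -
  obtain P Q where PQ: "(\<Sum>a\<le>D. monom (c a) a) = (\<Prod>j<D. [:P j, - Q j:])"
    using complex_poly_linear_factors[OF degree_sum_monom[of c] D] by blast
  show ?thesis
    by (intro exI[of _ P] exI[of _ Q]) (simp add: PQ[symmetric] coeff_sum_monom)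
qed

text \<open>At each point the product formula shows degree at most \<open>D\<close> in
  \<open>bv 0\<close>, with leading coefficient the \<open>D\<close>-th power of the product of the
  \<open>P j\<close>, that is of \<open>x (av 0)\<close>. The factors are not polynomial in the
  point; polynomiality of the \<open>r i\<close> comes from \<open>polyfun_expand\<close>.\<close>

lemma R_expand:
  "\<exists>r. (\<forall>i. polyfun (UNIV - {bv 0}) (r i)) \<and>
    (\<forall>x. R x = x (av 0) ^ D * x (bv 0) ^ D + (\<Sum>i<D. r i x * x (bv 0) ^ i))"
proof -
  obtain N c where c: "\<And>i. polyfun (UNIV - {bv 0}) (c i)"
    and Rc: "\<And>x. R x = (\<Sum>i\<le>N. c i x * x (bv 0) ^ i)"
    using polyfun_expand[OF polyfun_R, of "bv 0"] by blast
  define r where "r = (\<lambda>i x. if i \<le> N then c i x else 0)"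
  have r: "polyfun (UNIV - {bv 0}) (r i)" for i
    unfolding r_def using c by (cases "i \<le> N") (auto intro: polyfun.const)
  have "R x = x (av 0) ^ D * x (bv 0) ^ D + (\<Sum>i<D. r i x * x (bv 0) ^ i)" for x
  proof -
    obtain P Q where PQ: "\<And>a. a \<le> D \<Longrightarrow> x (av a) = coeff (\<Prod>j<D. [:P j, - Q j:]) a"
      using linear_factors[of "\<lambda>a. x (av a)"] by blast
    define h where "h = (\<lambda>j. \<Sum>b=1..D. x (bv b) * Q j ^ b * P j ^ (D - b))"
    define p where "p = (\<Prod>j<D. [:h j, P j ^ D:])"
    have Ry: "R (x(bv 0 := y)) = poly p y" for y
    proof -
      have "R (x(bv 0 := y)) =
          (\<Prod>j<D. \<Sum>b\<le>D. (x(bv 0 := y)) (bv b) * Q j ^ b * P j ^ (D - b))"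
        by (rule R_eq) (use PQ disj in auto)
      also have "\<dots> = (\<Prod>j<D. h j + y * P j ^ D)"
      proof (rule prod.cong[OF refl])
        fix j
        have "(\<Sum>b\<le>D. (x(bv 0 := y)) (bv b) * Q j ^ b * P j ^ (D - b)) =
            y * P j ^ D + (\<Sum>b=1..D. (x(bv 0 := y)) (bv b) * Q j ^ b * P j ^ (D - b))"
          by (simp add: atMost_atLeast0 sum.atLeast_Suc_atMost)
        also have "(\<Sum>b=1..D. (x(bv 0 := y)) (bv b) * Q j ^ b * P j ^ (D - b)) = h j"
          unfolding h_def using inj_bv by (intro sum.cong) (auto simp: inj_on_def)
        finally show "(\<Sum>b\<le>D. (x(bv 0 := y)) (bv b) * Q j ^ b * P j ^ (D - b)) = h j + y * P j ^ D"
          by simp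
      qed
      finally show ?thesis by (simp add: p_def poly_prod)
    qed
    have "(\<Sum>i\<le>N. monom (c i x) i) = p"
    proof (rule poly_eqI_cofinite[of "{}"])
      fix y
      have "poly (\<Sum>i\<le>N. monom (c i x) i) y = (\<Sum>i\<le>N. c i (x(bv 0 := y)) * y ^ i)"
        unfolding poly_sum poly_monom
        by (intro sum.cong arg_cong2[of _ _ _ _ "(*)"] polyfun_cong_on[OF c]) auto
      also have "\<dots> = poly p y" using Rc[of "x(bv 0 := y)"] Ry[of y] by simp
      finally show "poly (\<Sum>i\<le>N. monom (c i x) i) y = poly p y" .
    qed simp
    then have coeff_p: "coeff p i = r i x" for i
      by (auto simp: r_def coeff_sum coeff_monom sum.delta')
    have "R x = poly p (x (bv 0))" using Ry[of "x (bv 0)"] by simp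
    also have "\<dots> = (\<Sum>i\<le>D. coeff p i * x (bv 0) ^ i)"
      unfolding p_def by (rule poly_eq_sum_le[OF degree_prod_linear_le])
    also have "\<dots> = (\<Sum>i<D. r i x * x (bv 0) ^ i) + coeff p D * x (bv 0) ^ D"
      by (simp add: lessThan_Suc_atMost[symmetric] coeff_p)
    also have "coeff p D = x (av 0) ^ D"
      unfolding p_def coeff_prod_linear_top
      using PQ[of 0] by (simp add: coeff_0_prod_linear prod_power_distrib)
    finally show ?thesis by simp
  qed
  with r show ?thesis by (intro exI[of _ r] conjI allI)
qed

lemma pseudo_division:
  assumes "polyfun UNIV F"
  shows "\<exists>k G S. polyfun UNIV G \<and> (\<forall>i. polyfun (UNIV - {bv 0}) (S i)) \<and>
    (\<forall>x. x (av 0) ^ k * F x = G x * R x + (\<Sum>i<D. S i x * x (bv 0) ^ i))"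
  using assms
proof induction
  case (const c)
  define S where "S = (\<lambda>i (x :: 'v \<Rightarrow> complex). if i = (0::nat) then c else 0)"
  have "polyfun (UNIV - {bv 0}) (S i)" for i
    unfolding S_def by (rule polyfun.const)
  moreover have "(\<Sum>i<D. S i x * x (bv 0) ^ i) = c" for x
  proof -
    have "(\<Sum>i<D. S i x * x (bv 0) ^ i) = (\<Sum>i<D. if i = 0 then c else 0)"
      by (rule sum.cong) (auto simp: S_def)
    then show ?thesis using D by simp
  qed
  ultimately show ?case
    by (intro exI[of _ 0] exI[of _ "\<lambda>_. 0"] exI[of _ S]) (auto intro: polyfun.const)
next
  case (add F1 F2)
  from add.IH obtain k1 G1 S1 k2 G2 S2 where
    1: "polyfun UNIV G1" "\<forall>i. polyfun (UNIV - {bv 0}) (S1 i)"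
      "\<forall>x. x (av 0) ^ k1 * F1 x = G1 x * R x + (\<Sum>i<D. S1 i x * x (bv 0) ^ i)" and
    2: "polyfun UNIV G2" "\<forall>i. polyfun (UNIV - {bv 0}) (S2 i)"
      "\<forall>x. x (av 0) ^ k2 * F2 x = G2 x * R x + (\<Sum>i<D. S2 i x * x (bv 0) ^ i)"
    by blast
  note 1 = 1(1) 1(2,3)[rule_format] and 2 = 2(1) 2(2,3)[rule_format]
  define G where "G = (\<lambda>x. x (av 0) ^ k2 * G1 x + x (av 0) ^ k1 * G2 x)"
  define S where "S = (\<lambda>i x. x (av 0) ^ k2 * S1 i x + x (av 0) ^ k1 * S2 i x)"
  have "polyfun UNIV G" unfolding G_def by (intro polyfun_intros polyfun_var 1 2) simp_all
  moreover have "polyfun (UNIV - {bv 0}) (S i)" for i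
    unfolding S_def using disj[of 0 0] by (intro polyfun_intros polyfun_var 1 2) auto
  moreover have "x (av 0) ^ (k1 + k2) * (F1 x + F2 x) = G x * R x + (\<Sum>i<D. S i x * x (bv 0) ^ i)" for x
  proof -
    have "x (av 0) ^ (k1 + k2) * (F1 x + F2 x) =
        x (av 0) ^ k2 * (x (av 0) ^ k1 * F1 x) + x (av 0) ^ k1 * (x (av 0) ^ k2 * F2 x)"
      by (simp add: power_add algebra_simps)
    then show ?thesis
      unfolding 1(3) 2(3) G_def S_def by (simp add: algebra_simps sum.distrib sum_distrib_left)
  qed
  ultimately show ?case by (intro exI[of _ "k1 + k2"] exI[of _ G] exI[of _ S] conjI allI)
next
  case (var_mult w F)
  from var_mult.IH obtain k G S where
    IH: "polyfun UNIV G" "\<forall>i. polyfun (UNIV - {bv 0}) (S i)"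
      "\<forall>x. x (av 0) ^ k * F x = G x * R x + (\<Sum>i<D. S i x * x (bv 0) ^ i)"
    by blast
  note IH = IH(1) IH(2,3)[rule_format]
  show ?case
  proof (cases "w = bv 0")
    case False
    have "polyfun UNIV (\<lambda>x. x w * G x)" by (intro polyfun.var_mult IH) simp
    moreover have "polyfun (UNIV - {bv 0}) (\<lambda>x. x w * S i x)" for i
      using False by (intro polyfun.var_mult IH) simp
    moreover have "x (av 0) ^ k * (x w * F x) =
        (x w * G x) * R x + (\<Sum>i<D. (x w * S i x) * x (bv 0) ^ i)" for x
    proof -
      have "x (av 0) ^ k * (x w * F x) = x w * (x (av 0) ^ k * F x)" by simp
      then show ?thesis unfolding IH(3) by (simp add: algebra_simps sum_distrib_left)
    qed
    ultimately show ?thesis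
      by (intro exI[of _ k] exI[of _ "\<lambda>x. x w * G x"] exI[of _ "\<lambda>i x. x w * S i x"] conjI allI)
  next
    case True
    obtain r where r: "\<And>i. polyfun (UNIV - {bv 0}) (r i)"
      and Rr: "\<And>x. R x = x (av 0) ^ D * x (bv 0) ^ D + (\<Sum>i<D. r i x * x (bv 0) ^ i)"
      using R_expand by blast
    \<comment> \<open>Multiplication by \<open>x (bv 0)\<close> shifts the remainder up by one. The
      overflow \<open>S (D - 1)\<close> times \<open>x (bv 0) ^ D\<close>, once scaled by the
      leading coefficient of \<open>R\<close>, is replaced by \<open>R\<close> minus its lower
      terms.\<close>
    define G' where "G' = (\<lambda>x. x (av 0) ^ D * x (bv 0) * G x + S (D - 1) x)"
    define S' where "S' = (\<lambda>i x. x (av 0) ^ D * (if i = 0 then 0 else S (i - 1) x) - S (D - 1) x * r i x)"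
    have "polyfun UNIV G'"
      unfolding G'_def using polyfun_mono[OF IH(2)] by (intro polyfun_intros polyfun_var IH) auto
    moreover have "polyfun (UNIV - {bv 0}) (S' i)" for i
    proof -
      have "polyfun (UNIV - {bv 0}) (\<lambda>x. if i = 0 then 0 else S (i - 1) x)"
        using IH(2) by (cases "i = 0") (auto intro: polyfun.const)
      then show ?thesis
        unfolding S'_def using disj[of 0 0] by (intro polyfun_intros polyfun_var IH r) auto
    qed
    moreover have "x (av 0) ^ (k + D) * (x w * F x) = G' x * R x + (\<Sum>i<D. S' i x * x (bv 0) ^ i)" for x
    proof -
      define y c T where "y = x (bv 0)" and "c = x (av 0) ^ D" and "T = S (D - 1) x"
      obtain E where E: "D = Suc E" using D by (cases D) auto
      have "(\<Sum>i<D. (if i = 0 then 0 else S (i - 1) x) * y ^ i) = (\<Sum>i<E. S i x * y ^ Suc i)"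
        unfolding E sum.lessThan_Suc_shift by simp
      moreover have "y * (\<Sum>i<D. S i x * y ^ i) = (\<Sum>i<E. S i x * y ^ Suc i) + T * y ^ D"
        unfolding E T_def by (simp add: sum_distrib_left algebra_simps)
      ultimately have shift: "y * (\<Sum>i<D. S i x * y ^ i) =
          (\<Sum>i<D. (if i = 0 then 0 else S (i - 1) x) * y ^ i) + T * y ^ D"
        by simp
      have "x (av 0) ^ (k + D) * (x w * F x) = c * y * (x (av 0) ^ k * F x)"
        unfolding True by (simp add: power_add c_def y_def mult_ac)
      also have "\<dots> = c * y * G x * R x + c * (y * (\<Sum>i<D. S i x * y ^ i))"
        unfolding IH(3) by (simp add: y_def algebra_simps)
      also have "\<dots> = c * y * G x * R x +
          (c * (\<Sum>i<D. (if i = 0 then 0 else S (i - 1) x) * y ^ i) + T * (c * y ^ D))"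
        unfolding shift by (simp add: algebra_simps)
      also have "c * y ^ D = R x - (\<Sum>i<D. r i x * y ^ i)"
        using Rr[of x] by (simp add: c_def y_def)
      also have "c * y * G x * R x + (c * (\<Sum>i<D. (if i = 0 then 0 else S (i - 1) x) * y ^ i) +
          T * (R x - (\<Sum>i<D. r i x * y ^ i))) = (c * y * G x + T) * R x +
          (c * (\<Sum>i<D. (if i = 0 then 0 else S (i - 1) x) * y ^ i) - T * (\<Sum>i<D. r i x * y ^ i))"
        by (simp add: algebra_simps)
      also have "c * (\<Sum>i<D. (if i = 0 then 0 else S (i - 1) x) * y ^ i) - T * (\<Sum>i<D. r i x * y ^ i) =
          (\<Sum>i<D. S' i x * y ^ i)"
        unfolding S'_def c_def[symmetric] T_def[symmetric] sum_distrib_left sum_subtractf[symmetric]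
        by (intro sum.cong) (simp_all add: left_diff_distrib mult.assoc)
      finally show ?thesis by (simp add: G'_def c_def y_def T_def)
    qed
    ultimately show ?thesis by (intro exI[of _ "k + D"] exI[of _ G'] exI[of _ S'] conjI allI)
  qed
qed

text \<open>For generic coefficients, \<open>R\<close> has \<open>D\<close> distinct zeros in the variable \<open>bv 0\<close>; genericity is
  checked at one point and propagated along a polynomial curve through the given point.\<close>

lemma remainder_eq_0:
  assumes S: "\<And>i. polyfun (UNIV - {bv 0}) (S i)"
    and zero: "\<And>x. R x = 0 \<Longrightarrow> (\<Sum>i<D. S i x * x (bv 0) ^ i) = 0"
    and i: "i < D"
  shows "S i x = 0"
proof -
  obtain P0 Q0 where PQ0: "\<And>a. a \<le> D \<Longrightarrow> x (av a) = coeff (\<Prod>j<D. [:P0 j, - Q0 j:]) a"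
    using linear_factors[of "\<lambda>a. x (av a)"] by blast
  \<comment> \<open>The first form is moved through its linear factors, so the product formula holds
    all along the curve. At \<open>t = 1\<close> the factors are \<open>[:1, - of_nat j:]\<close>
    and the only nonzero coefficient of the second form is at \<open>bv 1\<close>, which makes
    \<open>h j 1 = of_nat j\<close> pairwise distinct.\<close>
  define P where "P = (\<lambda>j t. P0 j + t * (1 - P0 j))"
  define Q where "Q = (\<lambda>j t. Q0 j + t * (of_nat j - Q0 j))"
  have P: "univ_polyfun (P j)" and Q: "univ_polyfun (Q j)" for j
    unfolding P_def Q_def by (intro univ_polyfun_intros)+
  define g where "g = (\<lambda>t u. if u \<in> av ` {..D}
      then coeff (\<Prod>j<D. [:P j t, - Q j t:]) (inv_into {..D} av u)
      else x u + t * ((if u = bv 1 then 1 else 0) - x u))"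
  have neg: "univ_polyfun (\<lambda>t. - Q j t)" for j
    using univ_polyfun_diff[OF univ_polyfun_const[of 0] Q[of j]] by simp
  have g: "univ_polyfun (\<lambda>t. g t u)" for u
  proof (cases "u \<in> av ` {..D}")
    case True
    then show ?thesis
      unfolding g_def by (simp only: if_True) (intro coeff_prod_linear_family P neg)
  next
    case False
    then show ?thesis
      unfolding g_def by (simp only: if_False) (intro univ_polyfun_intros)
  qed
  have g_av: "g t (av a) = coeff (\<Prod>j<D. [:P j t, - Q j t:]) a" if "a \<le> D" for a t
    using that by (simp add: g_def inv_into_f_f[OF inj_av])
  have g_bv: "g t (bv b) = x (bv b) + t * ((if b = 1 then 1 else 0) - x (bv b))" if "b \<le> D" for b t
  proof -
    have "bv b \<notin> av ` {..D}" using disj[OF _ that] by (metis atMost_iff imageE)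
    moreover have "bv b = bv 1 \<longleftrightarrow> b = 1" using that D inj_bv by (auto simp: inj_on_def)
    ultimately show ?thesis by (simp add: g_def)
  qed
  have g0: "g 0 = x"
  proof
    fix u
    show "g 0 u = x u"
    proof (cases "u \<in> av ` {..D}")
      case True
      then obtain a where "a \<le> D" "u = av a" by auto
      then show ?thesis using g_av PQ0 by (simp add: P_def Q_def)
    qed (simp add: g_def)
  qed
  define h where "h = (\<lambda>j t. \<Sum>b=1..D. g t (bv b) * Q j t ^ b * P j t ^ (D - b))"
  have h: "univ_polyfun (h j)" for j
    unfolding h_def by (intro univ_polyfun_intros g P Q)
  \<comment> \<open>Nonvanishing says that all \<open>P j t\<close> are nonzero and that the zeros
    \<open>- h j t / P j t ^ D\<close> of \<open>R\<close> in \<open>bv 0\<close> are distinct, in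
    cross-multiplied form.\<close>
  define \<Delta> where "\<Delta> = (\<lambda>t. (\<Prod>j<D. P j t) *
      (\<Prod>j<D. \<Prod>k\<in>{..<D} - {j}. h j t * P k t ^ D - h k t * P j t ^ D))"
  have \<Delta>: "univ_polyfun \<Delta>"
    unfolding \<Delta>_def by (intro univ_polyfun_intros P h)
  have "h j 1 = of_nat j" for j
  proof -
    have "h j 1 = (\<Sum>b=1..D. if b = 1 then of_nat j else 0)"
      unfolding h_def by (intro sum.cong) (auto simp: g_bv P_def Q_def)
    also have "\<dots> = of_nat j" using D by simp
    finally show ?thesis .
  qed
  then have \<Delta>1: "\<Delta> 1 \<noteq> 0" by (auto simp: \<Delta>_def P_def)
  have "S i (g t) = 0" if t: "\<Delta> t \<noteq> 0" for t
  proof -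
    have Pnz: "P j t \<noteq> 0" if "j < D" for j using t that by (auto simp: \<Delta>_def)
    define z where "z = (\<lambda>j. - h j t / P j t ^ D)"
    have inj: "inj_on z {..<D}"
    proof (rule inj_onI, rule ccontr)
      fix j k assume jk: "j \<in> {..<D}" "k \<in> {..<D}" "z j = z k" "j \<noteq> k"
      then have "h j t * P k t ^ D - h k t * P j t ^ D = 0"
        using Pnz by (simp add: z_def frac_eq_eq)
      then have "(\<Prod>j<D. \<Prod>k\<in>{..<D} - {j}. h j t * P k t ^ D - h k t * P j t ^ D) = 0"
        using jk by (intro prod_zero bexI[of _ j] bexI[of _ k]) auto
      with t show False by (simp add: \<Delta>_def)
    qed
    define p where "p = (\<Sum>i<D. monom (S i (g t)) i)"
    have root: "poly p (z j) = 0" if "j < D" for j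
    proof -
      define y where "y = (g t)(bv 0 := z j)"
      have "R y = (\<Prod>j<D. \<Sum>b\<le>D. y (bv b) * Q j t ^ b * P j t ^ (D - b))"
        by (rule R_eq) (use g_av disj in \<open>auto simp: y_def\<close>)
      also have "(\<Sum>b\<le>D. y (bv b) * Q j t ^ b * P j t ^ (D - b)) =
          z j * P j t ^ D + (\<Sum>b=1..D. y (bv b) * Q j t ^ b * P j t ^ (D - b))"
        by (simp add: atMost_atLeast0 sum.atLeast_Suc_atMost y_def)
      moreover have "(\<Sum>b=1..D. y (bv b) * Q j t ^ b * P j t ^ (D - b)) = h j t"
        unfolding h_def y_def using inj_bv by (intro sum.cong) (auto simp: inj_on_def)
      ultimately have "(\<Sum>b\<le>D. y (bv b) * Q j t ^ b * P j t ^ (D - b)) = 0"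
        using Pnz[OF that] by (simp add: z_def atMost_atLeast0 sum.atLeast_Suc_atMost y_def)
      then have "(\<Prod>j<D. \<Sum>b\<le>D. y (bv b) * Q j t ^ b * P j t ^ (D - b)) = 0"
        using that by (intro prod_zero bexI[of _ j]) auto
      with \<open>R y = _\<close> have "R y = 0" by simp
      from zero[OF this] have "(\<Sum>i<D. S i y * z j ^ i) = 0" by (simp add: y_def)
      moreover have "S i y = S i (g t)" for i
        by (rule polyfun_cong_on[OF S]) (auto simp: y_def)
      ultimately show ?thesis by (simp add: p_def poly_sum poly_monom)
    qed
    have coeff_p: "coeff p k = (if k < D then S k (g t) else 0)" for k
      by (simp add: p_def coeff_sum coeff_monom sum.delta')
    have "p = 0"
    proof (rule ccontr)
      assume nz: "p \<noteq> 0"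
      have "D = card (z ` {..<D})" using inj by (simp add: card_image)
      also have "\<dots> \<le> card {y. poly p y = 0}"
        by (intro card_mono poly_roots_finite nz) (use root in auto)
      also have "\<dots> \<le> degree p" by (rule card_poly_roots_bound[OF nz])
      also have "degree p < D"
        using D by (intro degree_lessI) (auto simp: coeff_p nz)
      finally show False by simp
    qed
    then show ?thesis using coeff_p[of i] i by simp
  qed
  from univ_polyfun_vanishes[OF polyfun_along[OF S[of i], of g] \<Delta> \<Delta>1 this, of 0] g
  show ?thesis using g0 by simp
qed

text \<open>On the hyperplane \<open>x (av 0) = 0\<close> the product of \<open>G\<close> and
  \<open>R\<close> vanishes while \<open>R\<close> does not vanish identically; hence
  \<open>G\<close> vanishes there and contains the factor \<open>x (av 0)\<close>.\<close>

lemma cancel_av_0: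
  assumes F: "polyfun UNIV F" and G: "polyfun UNIV G"
    and eq: "\<And>x. x (av 0) * F x = G x * R x"
  shows "\<exists>G'. polyfun UNIV G' \<and> (\<forall>x. F x = G' x * R x)"
proof -
  obtain G' where G': "polyfun UNIV G'" "\<And>x. G x = G (x(av 0 := 0)) + x (av 0) * G' x"
    using polyfun_factor_var[OF G] by blast
  \<comment> \<open>The forms (-Y)^D and X^D: the coefficient \<open>av 0\<close> of X^D in the
    first is 0, yet there is no common zero.\<close>
  define y where "y = (\<lambda>u. if u \<in> av ` {..D}
      then coeff (\<Prod>j<D. [:0, - 1:] :: complex poly) (inv_into {..D} av u)
      else if u = bv D then 1 else 0)"
  have y_av: "y (av a) = coeff (\<Prod>j<D. [:0, - 1:]) a" if "a \<le> D" for a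
    using that unfolding y_def by (simp add: inv_into_f_f[OF inj_av])
  have y_bv: "y (bv b) = (if b = D then 1 else 0)" if "b \<le> D" for b
  proof -
    have "bv b \<notin> av ` {..D}" using disj[OF _ that] by (metis atMost_iff imageE)
    moreover have "bv b = bv D \<longleftrightarrow> b = D" using that inj_bv by (auto simp: inj_on_def)
    ultimately show ?thesis by (simp add: y_def)
  qed
  have "R y = (\<Prod>j<D. \<Sum>b\<le>D. y (bv b) * 1 ^ b * 0 ^ (D - b))"
    by (rule R_eq) (rule y_av)
  also have "\<dots> = (\<Prod>j<D. \<Sum>b\<le>D. if b = D then 1 else 0)"
    by (intro prod.cong sum.cong) (auto simp: y_bv)
  finally have "R y \<noteq> 0" by simp
  moreover have "y(av 0 := 0) = y"
  proof -
    have "y (av 0) = (\<Prod>j<D. 0)" using y_av[of 0] coeff_0_prod_linear[of "\<lambda>_. 0" "\<lambda>_. -1" D] by simp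
    then show ?thesis using D by (auto simp: fun_eq_iff)
  qed
  ultimately have Ry: "R (y(av 0 := 0)) \<noteq> 0" by simp
  have "G (x(av 0 := 0)) = 0" for x
  proof (rule polyfun_mult_eq_0[where f = "\<lambda>x. G (x(av 0 := 0))" and g = "\<lambda>x. R (x(av 0 := 0))" and y = y])
    show "polyfun (UNIV - {av 0}) (\<lambda>x. G (x(av 0 := 0)))" by (rule polyfun_restrict[OF G])
    show "polyfun (UNIV - {av 0}) (\<lambda>x. R (x(av 0 := 0)))" by (rule polyfun_restrict[OF polyfun_R])
    show "G (x(av 0 := 0)) * R (x(av 0 := 0)) = 0" for x
      using eq[of "x(av 0 := 0)"] by simp
  qed (rule Ry)
  then have Geq: "G x = x (av 0) * G' x" for x using G'(2)[of x] by simp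
  have "F x - G' x * R x = 0" for x
  proof (rule polyfun_mult_eq_0[of UNIV "\<lambda>x. F x - G' x * R x" UNIV "\<lambda>x. x (av 0)" "\<lambda>_. 1"])
    show "polyfun UNIV (\<lambda>x. F x - G' x * R x)" by (intro polyfun_intros F G' polyfun_R)
    show "polyfun UNIV (\<lambda>x. x (av 0))" by (rule polyfun_var) simp
    show "(F x - G' x * R x) * x (av 0) = 0" for x
      using eq[of x] Geq[of x] by (simp add: algebra_simps)
  qed simp
  with G'(1) show ?thesis by (intro exI[of _ G']) simp
qed

text \<open>The Nullstellensatz for this hypersurface. The power of \<open>x (av 0)\<close> left by
  pseudo-division is cancelled one factor at a time.\<close>

lemma divides:
  assumes F: "polyfun UNIV F" and zero: "\<And>x. R x = 0 \<Longrightarrow> F x = 0"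
  shows "\<exists>G. polyfun UNIV G \<and> (\<forall>x. F x = G x * R x)"
proof -
  from pseudo_division[OF F] obtain k G S where G: "polyfun UNIV G"
    and S: "\<forall>i. polyfun (UNIV - {bv 0}) (S i)"
    and eq: "\<forall>x. x (av 0) ^ k * F x = G x * R x + (\<Sum>i<D. S i x * x (bv 0) ^ i)"
    by blast
  have "S i x = 0" if "i < D" for i x
  proof (rule remainder_eq_0[of S])
    show "(\<Sum>i<D. S i x * x (bv 0) ^ i) = 0" if "R x = 0" for x
      using eq[rule_format, of x] zero[OF that] that by simp
  qed (use S that in auto)
  then have "x (av 0) ^ k * F x = G x * R x" for x
    using eq[rule_format, of x] by simp
  then have "\<exists>G. polyfun UNIV G \<and> (\<forall>x. x (av 0) ^ k * F x = G x * R x)" using G by blast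
  then show ?thesis
  proof (induction k)
    case (Suc k)
    then obtain G where "polyfun UNIV G" "\<And>x. x (av 0) * (x (av 0) ^ k * F x) = G x * R x"
      by (auto simp: mult.assoc)
    then have "\<exists>G. polyfun UNIV G \<and> (\<forall>x. x (av 0) ^ k * F x = G x * R x)"
      by (intro cancel_av_0) (auto intro!: polyfun_intros polyfun_var F)
    then show ?case by (rule Suc.IH)
  qed simp
qed

lemma R_zero_iff:
  "R x = 0 \<longleftrightarrow> (\<exists>X Y. (X, Y) \<noteq> (0, 0) \<and> (\<Sum>a\<le>D. x (av a) * X ^ (D - a) * Y ^ a) = 0 \<and>
    (\<Sum>b\<le>D. x (bv b) * Y ^ (D - b) * X ^ b) = 0)"
proof -
  obtain P Q where PQ: "\<And>a. a \<le> D \<Longrightarrow> x (av a) = coeff (\<Prod>j<D. [:P j, - Q j:]) a"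
    using linear_factors[of "\<lambda>a. x (av a)"] by blast
  have R: "R x = (\<Prod>j<D. \<Sum>b\<le>D. x (bv b) * Q j ^ b * P j ^ (D - b))"
    by (rule R_eq[OF PQ])
  have A: "(\<Sum>a\<le>D. x (av a) * X ^ (D - a) * Y ^ a) = (\<Prod>j<D. P j * X - Q j * Y)" for X Y
    unfolding binary_form_linear_factors[symmetric] by (intro sum.cong) (auto simp: PQ)
  show ?thesis
  proof
    assume "R x = 0"
    then obtain j where j: "j < D" "(\<Sum>b\<le>D. x (bv b) * Q j ^ b * P j ^ (D - b)) = 0"
      unfolding R by auto
    show "\<exists>X Y. (X, Y) \<noteq> (0, 0) \<and> (\<Sum>a\<le>D. x (av a) * X ^ (D - a) * Y ^ a) = 0 \<and>
      (\<Sum>b\<le>D. x (bv b) * Y ^ (D - b) * X ^ b) = 0"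
    proof (cases "(Q j, P j) = (0, 0)")
      case False
      then show ?thesis
        using j unfolding A by (intro exI[of _ "Q j"] exI[of _ "P j"])
          (auto simp: mult_ac intro!: bexI[of _ j])
    next
      \<comment> \<open>A factor 0 makes the first form vanish identically, so any nontrivial zero
        of the second form will do.\<close>
      case True
      then have A0: "(\<Sum>a\<le>D. x (av a) * X ^ (D - a) * Y ^ a) = 0" for X Y
        using j(1) unfolding A by (auto intro!: bexI[of _ j])
      obtain P' Q' where PQ': "\<And>b. b \<le> D \<Longrightarrow> x (bv b) = coeff (\<Prod>j<D. [:P' j, - Q' j:]) b"
        using linear_factors[of "\<lambda>b. x (bv b)"] by blast
      have B: "(\<Sum>b\<le>D. x (bv b) * Y ^ (D - b) * X ^ b) = (\<Prod>j<D. P' j * Y - Q' j * X)" for X Y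
        unfolding binary_form_linear_factors[symmetric] by (intro sum.cong) (auto simp: PQ')
      show ?thesis
      proof (cases "(P' 0, Q' 0) = (0, 0)")
        case True
        then show ?thesis
          using D unfolding A0 B by (intro exI[of _ 1] exI[of _ 0]) (auto intro!: bexI[of _ 0])
      next
        case False
        then show ?thesis
          using D unfolding A0 B by (intro exI[of _ "P' 0"] exI[of _ "Q' 0"])
            (auto intro!: bexI[of _ 0])
      qed
    qed
  next
    assume "\<exists>X Y. (X, Y) \<noteq> (0, 0) \<and> (\<Sum>a\<le>D. x (av a) * X ^ (D - a) * Y ^ a) = 0 \<and>
      (\<Sum>b\<le>D. x (bv b) * Y ^ (D - b) * X ^ b) = 0"
    then obtain X Y where XY: "(X, Y) \<noteq> (0, 0)" "(\<Prod>j<D. P j * X - Q j * Y) = 0"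
      and B0: "(\<Sum>b\<le>D. x (bv b) * Y ^ (D - b) * X ^ b) = 0"
      unfolding A by blast
    then obtain j where j: "j < D" "P j * X = Q j * Y" by auto
    \<comment> \<open>The zero is proportional to \<open>(Q j, P j)\<close>. Scaling in this
      direction allows \<open>c = 0\<close>, which covers a vanishing factor.\<close>
    have "\<exists>c. Q j = c * X \<and> P j = c * Y"
    proof (cases "X = 0")
      case True
      then show ?thesis using XY j by (intro exI[of _ "P j / Y"]) auto
    next
      case False
      then show ?thesis using j by (intro exI[of _ "Q j / X"]) (auto simp: field_simps)
    qed
    then obtain c where c: "Q j = c * X" "P j = c * Y" by blast
    have "(\<Sum>b\<le>D. x (bv b) * Q j ^ b * P j ^ (D - b)) =
        c ^ D * (\<Sum>b\<le>D. x (bv b) * Y ^ (D - b) * X ^ b)"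
      unfolding c sum_distrib_left
    proof (rule sum.cong[OF refl])
      fix b assume "b \<in> {..D}"
      then have "c ^ D = c ^ b * c ^ (D - b)" by (simp flip: power_add)
      then show "x (bv b) * (c * X) ^ b * (c * Y) ^ (D - b) = c ^ D * (x (bv b) * Y ^ (D - b) * X ^ b)"
        by (simp add: power_mult_distrib mult_ac)
    qed
    then show "R x = 0" unfolding R using j(1) B0 by (auto intro!: bexI[of _ j])
  qed
qed

text \<open>The zero set of \<open>R\<close> is a polynomial image of an affine space, hence irreducible.\<close>

lemma zero_set_irreducible:
  assumes F: "polyfun UNIV F" and G: "polyfun UNIV G"
    and zero: "\<And>x. R x = 0 \<Longrightarrow> F x * G x = 0"
    and x: "R x = 0" "F x \<noteq> 0" and y: "R y = 0"
  shows "G y = 0"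
proof -
  \<comment> \<open>Parameters of the zero set: a common zero (X, Y) and the cofactors of the linear
    form that vanishes there.\<close>
  have param: "\<exists>X Y C C'. (\<forall>a\<le>D. x (av a) = coeff ([:- Y, X:] * C) a) \<and>
      (\<forall>b\<le>D. x (bv b) = coeff ([:- X, Y:] * C') b) \<and> degree C < D \<and> degree C' < D"
    if "R x = 0" for x
  proof -
    from that obtain X Y where XY: "(X, Y) \<noteq> (0, 0)"
      "(\<Sum>a\<le>D. x (av a) * X ^ (D - a) * Y ^ a) = 0"
      "(\<Sum>b\<le>D. x (bv b) * Y ^ (D - b) * X ^ b) = 0"
      unfolding R_zero_iff by blast
    define p q where "p = (\<Sum>a\<le>D. monom (x (av a)) a)" and "q = (\<Sum>b\<le>D. monom (x (bv b)) b)"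
    have p: "degree p \<le> D" "\<And>a. a \<le> D \<Longrightarrow> coeff p a = x (av a)" and
      q: "degree q \<le> D" "\<And>b. b \<le> D \<Longrightarrow> coeff q b = x (bv b)"
      unfolding p_def q_def by (rule degree_sum_monom, simp add: coeff_sum_monom)+
    have "\<exists>C. p = [:- Y, X:] * C \<and> degree C < D"
      by (rule binary_form_zero_factor[OF D p(1) XY(1)]) (use XY(2) p(2) in simp)
    then obtain C where C: "p = [:- Y, X:] * C" "degree C < D" by blast
    have "\<exists>C. q = [:- X, Y:] * C \<and> degree C < D"
      by (rule binary_form_zero_factor[OF D q(1), of Y X]) (use XY q(2) in auto)
    then obtain C' where C': "q = [:- X, Y:] * C'" "degree C' < D" by blast
    have "\<forall>a\<le>D. x (av a) = coeff ([:- Y, X:] * C) a" "\<forall>b\<le>D. x (bv b) = coeff ([:- X, Y:] * C') b"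
      unfolding C(1)[symmetric] C'(1)[symmetric] using p(2) q(2) by simp_all
    with C(2) C'(2) show ?thesis by blast
  qed
  from param[OF x(1)] obtain X0 Y0 C0 C0' where
    0: "\<forall>a\<le>D. x (av a) = coeff ([:- Y0, X0:] * C0) a"
      "\<forall>b\<le>D. x (bv b) = coeff ([:- X0, Y0:] * C0') b" "degree C0 < D" "degree C0' < D"
    by blast
  from param[OF y] obtain X1 Y1 C1 C1' where
    1: "\<forall>a\<le>D. y (av a) = coeff ([:- Y1, X1:] * C1) a"
      "\<forall>b\<le>D. y (bv b) = coeff ([:- X1, Y1:] * C1') b" "degree C1 < D" "degree C1' < D"
    by blast
  \<comment> \<open>A straight line in parameter space from the data of \<open>x\<close> to that of
    \<open>y\<close>; its image is a polynomial curve inside the zero set of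
    \<open>R\<close>.\<close>
  define X Y where "X = (\<lambda>t. X0 + t * (X1 - X0))" and "Y = (\<lambda>t. Y0 + t * (Y1 - Y0))"
  define C C' where "C = (\<lambda>t. C0 + smult t (C1 - C0))" and "C' = (\<lambda>t. C0' + smult t (C1' - C0'))"
  define g where "g = (\<lambda>t u.
    if u \<in> av ` {..D} then coeff ([:- Y t, X t:] * C t) (inv_into {..D} av u)
    else if u \<in> bv ` {..D} then coeff ([:- X t, Y t:] * C' t) (inv_into {..D} bv u)
    else x u + t * (y u - x u))"
  have g_av: "g t (av a) = coeff ([:- Y t, X t:] * C t) a" if "a \<le> D" for a t
    using that unfolding g_def by (simp add: inv_into_f_f[OF inj_av])
  have g_bv: "g t (bv b) = coeff ([:- X t, Y t:] * C' t) b" if "b \<le> D" for b t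
  proof -
    have "bv b \<notin> av ` {..D}" using disj[OF _ that] by (metis atMost_iff imageE)
    then show ?thesis using that unfolding g_def by (simp add: inv_into_f_f[OF inj_bv])
  qed
  have XY: "univ_polyfun X" "univ_polyfun Y" unfolding X_def Y_def by (intro univ_polyfun_intros)+
  have coeff_family: "univ_polyfun (\<lambda>t. coeff ([:- V t, U t:] * (E0 + smult t (E1 - E0))) n)"
    if "univ_polyfun U" "univ_polyfun V" for U V E0 E1 n
  proof -
    have "coeff ([:- V t, U t:] * E) n = (0 - V t) * coeff E n +
        (if n = 0 then 0 else 1) * U t * coeff E (n - 1)" for t E
      by (cases n) simp_all
    then show ?thesis
      using that by (simp only: coeff_add coeff_smult coeff_diff) (intro univ_polyfun_intros)
  qed
  have g: "univ_polyfun (\<lambda>t. g t u)" for u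
  proof -
    consider "u \<in> av ` {..D}" | "u \<notin> av ` {..D}" "u \<in> bv ` {..D}"
      | "u \<notin> av ` {..D}" "u \<notin> bv ` {..D}" by blast
    then show ?thesis
    proof cases
      case 1
      then show ?thesis unfolding g_def C_def by (simp only: if_True) (intro coeff_family XY)
    next
      case 2
      then show ?thesis unfolding g_def C'_def by (simp only: if_True if_False) (intro coeff_family XY)
    next
      case 3
      then show ?thesis unfolding g_def by (simp only: if_False) (intro univ_polyfun_intros)
    qed
  qed
  have degC: "degree (C t) < D" "degree (C' t) < D" for t
    unfolding C_def C'_def using 0 1
    by (auto intro!: degree_add_less le_less_trans[OF degree_smult_le] degree_diff_less)
  have Rg: "R (g t) = 0" for t
  proof -
    have A: "(\<Sum>a\<le>D. g t (av a) * X t ^ (D - a) * Y t ^ a) = 0"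
      using binary_form_linear_multiple_zero[OF degC(1)] by (simp add: g_av del: mult_pCons_left)
    have B: "(\<Sum>b\<le>D. g t (bv b) * Y t ^ (D - b) * X t ^ b) = 0"
      using binary_form_linear_multiple_zero[OF degC(2)] by (simp add: g_bv del: mult_pCons_left)
    show ?thesis
    proof (cases "(X t, Y t) = (0, 0)")
      \<comment> \<open>The line may pass through the origin, which is no projective point. Both
        forms are 0 there, so \<open>R\<close> still vanishes.\<close>
      case True
      then have "g t (av a) = 0" "g t (bv a) = 0" if "a \<le> D" for a
        using that by (simp_all add: g_av g_bv)
      then show ?thesis
        unfolding R_zero_iff by (intro exI[of _ 1] exI[of _ 0]) auto
    next
      case False
      with A B show ?thesis unfolding R_zero_iff by blast
    qed
  qed
  have endpoint: "g t = z" if "\<And>a. a \<le> D \<Longrightarrow> g t (av a) = z (av a)"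
    "\<And>b. b \<le> D \<Longrightarrow> g t (bv b) = z (bv b)" "\<And>u. x u + t * (y u - x u) = z u" for t z
  proof
    fix u
    consider a where "a \<le> D" "u = av a" | b where "b \<le> D" "u = bv b"
      | "u \<notin> av ` {..D}" "u \<notin> bv ` {..D}" by blast
    then show "g t u = z u"
    proof cases
      case 3
      then show ?thesis using that(3)[of u] by (simp add: g_def)
    qed (use that in simp_all)
  qed
  have g0: "g 0 = x"
    using 0 by (intro endpoint) (simp_all add: g_av g_bv X_def Y_def C_def C'_def del: mult_pCons_left)
  have g1: "g 1 = y"
    using 1 by (intro endpoint) (simp_all add: g_av g_bv X_def Y_def C_def C'_def del: mult_pCons_left)
  have "G (g 1) = 0"
  proof (rule univ_polyfun_vanishes[of "\<lambda>t. G (g t)" "\<lambda>t. F (g t)" 0])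
    show "univ_polyfun (\<lambda>t. G (g t))" "univ_polyfun (\<lambda>t. F (g t))"
      using polyfun_along[OF F] polyfun_along[OF G] g by auto
    show "F (g 0) \<noteq> 0" using x(2) g0 by simp
    show "G (g t) = 0" if "F (g t) \<noteq> 0" for t using zero[OF Rg, of t] that by simp
  qed
  then show ?thesis using g1 by simp
qed

end

section \<open>Normalization and irreducibility\<close>

context binary_resultant
begin

lemma R_normalized:
  assumes "\<And>a. a \<le> D \<Longrightarrow> x (av a) = (if a = 0 then 1 else 0)"
    and "\<And>b. b \<le> D \<Longrightarrow> x (bv b) = (if b = 0 then 1 else 0)"
  shows "R x = 1"
proof -
  have "R x = (\<Prod>j<D. \<Sum>b\<le>D. x (bv b) * 0 ^ b * 1 ^ (D - b))"
  proof (rule R_eq)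
    fix a assume "a \<le> D"
    have "(\<Prod>j<D. [:1, - 0:]) = (1 :: complex poly)" by (simp flip: one_pCons)
    with assms(1)[OF \<open>a \<le> D\<close>] show "x (av a) = coeff (\<Prod>j<D. [:1, - 0:]) a" by simp
  qed
  also have "\<dots> = (\<Prod>j<D. \<Sum>b\<le>D. if b = 0 then 1 else 0)"
    by (intro prod.cong sum.cong) (auto simp: assms(2))
  finally show ?thesis by simp
qed

lemma R_nonzero: "\<exists>x. R x \<noteq> 0"
proof -
  define x where "x = (\<lambda>u. if u = av 0 \<or> u = bv 0 then 1 else 0 :: complex)"
  have "R x = 1"
  proof (rule R_normalized)
    fix a assume "a \<le> D"
    then show "x (av a) = (if a = 0 then 1 else 0)" "x (bv a) = (if a = 0 then 1 else 0)"
      using inj_av inj_bv disj[of 0 a] disj[of a 0] by (auto simp: x_def inj_on_def)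
  qed
  then show ?thesis by (intro exI[of _ x]) simp
qed

text \<open>As the zero set is irreducible, one factor vanishes on all of it. That factor is a
  multiple of the whole product, which forces the other one to be a unit.\<close>

lemma irreducible_mpoly:
  assumes Rp: "\<And>x. mpoly_eval x Rp = R x"
  shows "irreducible Rp"
proof (rule irreducibleI)
  obtain x1 where x1: "R x1 \<noteq> 0" using R_nonzero by blast
  then show "Rp \<noteq> 0" using Rp[of x1] by auto
  show "\<not> Rp dvd 1"
  proof
    assume "Rp dvd 1"
    then obtain c where "1 = Rp * c" by (elim dvdE)
    then have "R (\<lambda>_. 0) * mpoly_eval (\<lambda>_. 0) c = 1"
      unfolding Rp[symmetric] mpoly_eval_mult[symmetric] by (metis mpoly_eval_one)
    moreover have "R (\<lambda>_. 0) = 0"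
      unfolding R_zero_iff by (intro exI[of _ 1] exI[of _ 0]) simp
    ultimately show False by simp
  qed
  have unit: "B dvd 1" if AB: "Rp = A * B" and van: "\<And>x. R x = 0 \<Longrightarrow> mpoly_eval x A = 0" for A B
  proof -
    have pf: "polyfun UNIV (\<lambda>x. mpoly_eval x P)" for P :: "('v, complex) mpoly"
      using polyfun_mpoly_eval by (rule polyfun_mono) simp
    from divides[of "\<lambda>x. mpoly_eval x A", OF pf van]
    obtain g where g: "polyfun UNIV g" "\<forall>x. mpoly_eval x A = g x * R x" by blast
    from polyfun_imp_mpoly_eval[OF g(1)] obtain G where G: "\<forall>x. g x = mpoly_eval x G" by blast
    have R: "R x = mpoly_eval x A * mpoly_eval x B" for x
      unfolding Rp[symmetric] AB mpoly_eval_mult ..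
    have "mpoly_eval x (B * G) - 1 = 0" for x
    proof (rule polyfun_mult_eq_0[where f = "\<lambda>x. mpoly_eval x (B * G) - 1"
          and g = "\<lambda>x. mpoly_eval x A" and y = x1])
      show "polyfun UNIV (\<lambda>x. mpoly_eval x (B * G) - 1)"
        by (intro polyfun_diff pf polyfun.const)
      show "polyfun UNIV (\<lambda>x. mpoly_eval x A)" by (rule pf)
      show "mpoly_eval x1 A \<noteq> 0" using x1 R by auto
      show "(mpoly_eval x (B * G) - 1) * mpoly_eval x A = 0" for x
      proof -
        have "(mpoly_eval x (B * G) - 1) * mpoly_eval x A =
            mpoly_eval x G * (mpoly_eval x A * mpoly_eval x B) - mpoly_eval x A"
          unfolding mpoly_eval_mult by (simp add: algebra_simps)
        also have "\<dots> = g x * R x - mpoly_eval x A" using G by (simp add: R)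
        also have "\<dots> = 0" by (simp only: g(2)[rule_format] diff_self)
        finally show ?thesis .
      qed
    qed
    then have "B * G = 1" by (intro mpoly_eval_inject) simp
    then show ?thesis by (metis dvdI)
  qed
  fix A B assume AB: "Rp = A * B"
  have pf: "polyfun UNIV (\<lambda>x. mpoly_eval x P)" for P :: "('v, complex) mpoly"
    using polyfun_mpoly_eval by (rule polyfun_mono) simp
  show "A dvd 1 \<or> B dvd 1"
  proof (cases "\<exists>x. R x = 0 \<and> mpoly_eval x A \<noteq> 0")
    case True
    then obtain x where x: "R x = 0" "mpoly_eval x A \<noteq> 0" by blast
    have "mpoly_eval y B = 0" if "R y = 0" for y
    proof (rule zero_set_irreducible[where F = "\<lambda>x. mpoly_eval x A" and
          G = "\<lambda>x. mpoly_eval x B" and x = x and y = y])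
      show "mpoly_eval x A * mpoly_eval x B = 0" if "R x = 0" for x
        using that unfolding Rp[symmetric] AB mpoly_eval_mult .
    qed (fact pf x that)+
    moreover have "Rp = B * A" using AB by (simp add: mult.commute)
    ultimately have "A dvd 1" by (intro unit)
    then show ?thesis ..
  next
    case False
    then have "B dvd 1" by (intro unit[OF AB]) blast
    then show ?thesis ..
  qed
qed

end

subsection \<open>The resultant of two binary forms\<close>

lemma polyfun_compose:
  assumes "polyfun V f" "\<And>v. v \<in> V \<Longrightarrow> polyfun S (h v)"
  shows "polyfun S (\<lambda>x. f (\<lambda>v. h v x))"
  using assms by (induction rule: polyfun.induct) (auto intro: polyfun.const polyfun.add polyfun_mult)

definition binary_exponent :: "nat \<Rightarrow> nat \<Rightarrow> 2 \<Rightarrow>\<^sub>0 nat" where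
  "binary_exponent D a = Poly_Mapping.single 1 (D - a) + Poly_Mapping.single 2 a"

lemma lookup_binary_exponent [simp]:
  "Poly_Mapping.lookup (binary_exponent D a) 1 = D - a"
  "Poly_Mapping.lookup (binary_exponent D a) 2 = a"
  by (simp_all add: binary_exponent_def lookup_add lookup_single when_def)

lemma binary_exponent_eq_iff:
  assumes "(\<Sum>i\<in>UNIV. Poly_Mapping.lookup e i) = D"
  shows "e = binary_exponent D a \<longleftrightarrow> Poly_Mapping.lookup e 2 = a"
proof
  assume *: "Poly_Mapping.lookup e 2 = a"
  have sum: "Poly_Mapping.lookup e 1 + Poly_Mapping.lookup e 2 = D"
    using assms by (simp add: UNIV_2)
  show "e = binary_exponent D a"
  proof (rule poly_mapping_eqI)
    fix i :: 2
    show "Poly_Mapping.lookup e i = Poly_Mapping.lookup (binary_exponent D a) i"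
      using exhaust_2[of i] * sum by auto
  qed
qed simp

lemma inj_on_binary_exponent: "inj_on (binary_exponent D) A"
  by (rule inj_onI) (metis lookup_binary_exponent(2))

lemma exponents_of_degree_2: "exponents_of_degree D = binary_exponent D ` {..D}"
proof (intro equalityI subsetI)
  fix e :: "2 \<Rightarrow>\<^sub>0 nat" assume "e \<in> exponents_of_degree D"
  then have e: "(\<Sum>i\<in>UNIV. Poly_Mapping.lookup e i) = D" by (simp add: exponents_of_degree_def)
  then have "Poly_Mapping.lookup e 2 \<le> D" by (simp add: UNIV_2)
  with binary_exponent_eq_iff[OF e] show "e \<in> binary_exponent D ` {..D}" by blast
qed (auto simp: exponents_of_degree_def UNIV_2)

lemma binary_exponent_image_rev:
  "(\<lambda>b. binary_exponent D (D - b)) ` {..D} = binary_exponent D ` {..D}"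
proof (intro equalityI subsetI)
  fix e assume "e \<in> binary_exponent D ` {..D}"
  then obtain a where "a \<le> D" "e = binary_exponent D a" by auto
  then show "e \<in> (\<lambda>b. binary_exponent D (D - b)) ` {..D}"
    by (intro image_eqI[of _ _ "D - a"]) auto
qed auto

lemma inj_on_binary_exponent_rev: "inj_on (\<lambda>b. binary_exponent D (D - b)) {..D}"
  by (rule inj_onI) (metis lookup_binary_exponent(2) atMost_iff diff_diff_cancel)

lemma mpoly_eval_binary_form:
  fixes F :: "(2, complex) mpoly"
  assumes "homogeneous_of_degree D F"
  shows "mpoly_eval f F = (\<Sum>a\<le>D. Poly_Mapping.lookup F (binary_exponent D a) * f 1 ^ (D - a) * f 2 ^ a)"
    and "mpoly_eval f F = (\<Sum>b\<le>D. Poly_Mapping.lookup F (binary_exponent D (D - b)) * f 2 ^ (D - b) * f 1 ^ b)"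
proof -
  have keys: "Poly_Mapping.keys F \<subseteq> binary_exponent D ` {..D}"
    using assms by (simp add: homogeneous_of_degree_def exponents_of_degree_2)
  have monom: "monom_eval f (binary_exponent D a) = f 1 ^ (D - a) * f 2 ^ a" for a
    by (simp add: binary_exponent_def monom_eval_add)
  show "mpoly_eval f F = (\<Sum>a\<le>D. Poly_Mapping.lookup F (binary_exponent D a) * f 1 ^ (D - a) * f 2 ^ a)"
    by (subst mpoly_eval_superset[OF _ keys])
      (simp_all add: sum.reindex[OF inj_on_binary_exponent] monom mult.assoc)
  show "mpoly_eval f F = (\<Sum>b\<le>D. Poly_Mapping.lookup F (binary_exponent D (D - b)) * f 2 ^ (D - b) * f 1 ^ b)"
    unfolding mpoly_eval_superset[OF _ keys, simplified]
    unfolding binary_exponent_image_rev[symmetric] sum.reindex[OF inj_on_binary_exponent_rev]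
    by (auto intro!: sum.cong simp: monom)
qed

definition alpha_var :: "nat \<Rightarrow> nat \<Rightarrow> 2 \<times> (2 \<Rightarrow>\<^sub>0 nat)" where
  "alpha_var D a = (1, binary_exponent D a)"

text \<open>The index is the exponent of the first variable, the opposite of
  \<open>alpha_var\<close>; this agrees with \<open>tensor_beta\<close>, which counts entries equal
  to 1.\<close>

definition beta_var :: "nat \<Rightarrow> nat \<Rightarrow> 2 \<times> (2 \<Rightarrow>\<^sub>0 nat)" where
  "beta_var D b = (2, binary_exponent D (D - b))"

definition resultant_fun :: "nat \<Rightarrow> (2 \<times> (2 \<Rightarrow>\<^sub>0 nat) \<Rightarrow> complex) \<Rightarrow> complex" where
  "resultant_fun D x = exp_trace_form D (\<Sum>a\<le>D. monom (x (alpha_var D a)) a)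
     (\<Sum>b\<le>D. monom (x (beta_var D b)) b)"

lemma polyfun_resultant_fun:
  "polyfun (UNIV \<times> exponents_of_degree D) (resultant_fun D)"
proof -
  obtain E where E: "polyfun UNIV E" "\<And>A B. exp_trace_form D A B = E (case_sum (coeff A) (coeff B))"
    using polyfun_exp_trace_form by blast
  define h :: "nat + nat \<Rightarrow> (2 \<times> (2 \<Rightarrow>\<^sub>0 nat) \<Rightarrow> complex) \<Rightarrow> complex" where
    "h = (\<lambda>v x. case v of Inl a \<Rightarrow> if a \<le> D then x (alpha_var D a) else 0
      | Inr b \<Rightarrow> if b \<le> D then x (beta_var D b) else 0)"
  have "polyfun (UNIV \<times> exponents_of_degree D) (h v)" for v
  proof (cases v)
    case (Inl a)
    then show ?thesis
      by (cases "a \<le> D")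
        (auto simp: h_def alpha_var_def exponents_of_degree_2 intro!: polyfun.const polyfun_var)
  next
    case (Inr b)
    then show ?thesis
      by (cases "b \<le> D")
        (auto simp: h_def beta_var_def exponents_of_degree_2 intro!: polyfun.const polyfun_var)
  qed
  then have "polyfun (UNIV \<times> exponents_of_degree D) (\<lambda>x. E (\<lambda>v. h v x))"
    by (intro polyfun_compose[OF E(1)])
  moreover have "resultant_fun D = (\<lambda>x. E (\<lambda>v. h v x))"
  proof
    fix x
    have "case_sum (coeff (\<Sum>a\<le>D. monom (x (alpha_var D a)) a))
        (coeff (\<Sum>b\<le>D. monom (x (beta_var D b)) b)) = (\<lambda>v. h v x)"
      by (auto simp: h_def coeff_sum_monom fun_eq_iff split: sum.splits)
    then show "resultant_fun D x = E (\<lambda>v. h v x)" unfolding resultant_fun_def E(2) by simp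
  qed
  ultimately show ?thesis by simp
qed

lemma binary_resultant_resultant_fun:
  assumes D: "D > 0"
  shows "binary_resultant D (alpha_var D) (beta_var D) (resultant_fun D)"
proof
  show "inj_on (alpha_var D) {..D}"
    using inj_on_binary_exponent[of D "{..D}"] by (auto simp: inj_on_def alpha_var_def)
  show "inj_on (beta_var D) {..D}"
    using inj_on_binary_exponent_rev[of D] by (auto simp: inj_on_def beta_var_def)
  show "polyfun UNIV (resultant_fun D)"
    using polyfun_resultant_fun by (rule polyfun_mono) simp
  fix x :: "2 \<times> (2 \<Rightarrow>\<^sub>0 nat) \<Rightarrow> complex" and P Q
  assume x: "\<And>a. a \<le> D \<Longrightarrow> x (alpha_var D a) = coeff (\<Prod>j<D. [:P j, - Q j:]) a"
  have A: "(\<Sum>a\<le>D. monom (x (alpha_var D a)) a) = (\<Prod>j<D. [:P j, - Q j:])"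
  proof (rule poly_eqI)
    fix n
    show "coeff (\<Sum>a\<le>D. monom (x (alpha_var D a)) a) n = coeff (\<Prod>j<D. [:P j, - Q j:]) n"
    proof (cases "n \<le> D")
      case False
      then have "degree (\<Prod>j<D. [:P j, - Q j:]) < n"
        using degree_prod_linear_le[of P "\<lambda>j. - Q j" D] by simp
      with False show ?thesis unfolding coeff_sum_monom by (simp add: coeff_eq_0)
    qed (simp add: coeff_sum_monom x)
  qed
  have "degree (\<Sum>b\<le>D. monom (x (beta_var D b)) b) \<le> D"
    by (intro degree_le) (simp add: coeff_sum_monom)
  from exp_trace_form_linear_factors[OF D this, of P Q]
  show "resultant_fun D x = (\<Prod>j<D. \<Sum>b\<le>D. x (beta_var D b) * Q j ^ b * P j ^ (D - b))"
    unfolding resultant_fun_def A by (simp add: coeff_sum_monom)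
qed (use D in \<open>simp_all add: alpha_var_def beta_var_def\<close>)

lemma mpoly_var_power: "mpoly_var v ^ n = Poly_Mapping.single (Poly_Mapping.single v n) 1"
  by (induction n) (simp_all add: mpoly_var_def mult_single single_add[symmetric])

lemma resultant_fun_eq_0_iff:
  assumes D: "D > 0" and F: "\<And>i. homogeneous_of_degree D (F i)"
  shows "resultant_fun D (coeffs_of_system F) = 0 \<longleftrightarrow>
    (\<exists>x :: complex ^ 2. x \<noteq> 0 \<and> (\<forall>i. mpoly_eval (\<lambda>j. x $ j) (F i) = 0))"
proof -
  interpret binary_resultant D "alpha_var D" "beta_var D" "resultant_fun D"
    by (rule binary_resultant_resultant_fun[OF D])
  have 1: "mpoly_eval f (F 1) =
      (\<Sum>a\<le>D. coeffs_of_system F (alpha_var D a) * f 1 ^ (D - a) * f 2 ^ a)" for f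
    unfolding mpoly_eval_binary_form(1)[OF F] by (simp add: coeffs_of_system_def alpha_var_def)
  have 2: "mpoly_eval f (F 2) =
      (\<Sum>b\<le>D. coeffs_of_system F (beta_var D b) * f 2 ^ (D - b) * f 1 ^ b)" for f
    unfolding mpoly_eval_binary_form(2)[OF F] by (simp add: coeffs_of_system_def beta_var_def)
  show ?thesis
  proof
    assume "resultant_fun D (coeffs_of_system F) = 0"
    then obtain X Y where XY: "(X, Y) \<noteq> (0, 0)"
      "(\<Sum>a\<le>D. coeffs_of_system F (alpha_var D a) * X ^ (D - a) * Y ^ a) = 0"
      "(\<Sum>b\<le>D. coeffs_of_system F (beta_var D b) * Y ^ (D - b) * X ^ b) = 0"
      unfolding R_zero_iff by blast
    define x :: "complex ^ 2" where "x = (\<chi> i. if i = 1 then X else Y)"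
    have x: "x $ 1 = X" "x $ 2 = Y" by (simp_all add: x_def)
    then have "x \<noteq> 0" using XY(1) by auto
    moreover have "mpoly_eval (\<lambda>j. x $ j) (F i) = 0" for i
      using exhaust_2[of i] XY(2,3) by (auto simp: 1 2 x)
    ultimately show "\<exists>x :: complex ^ 2. x \<noteq> 0 \<and> (\<forall>i. mpoly_eval (\<lambda>j. x $ j) (F i) = 0)" by blast
  next
    assume "\<exists>x :: complex ^ 2. x \<noteq> 0 \<and> (\<forall>i. mpoly_eval (\<lambda>j. x $ j) (F i) = 0)"
    then obtain x :: "complex ^ 2" where x: "x \<noteq> 0" "\<And>i. mpoly_eval (\<lambda>j. x $ j) (F i) = 0" by blast
    have "(x $ 1, x $ 2) \<noteq> (0, 0)"
      using x(1) by (auto simp: vec_eq_iff forall_2)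
    with x(2)[of 1] x(2)[of 2] show "resultant_fun D (coeffs_of_system F) = 0"
      unfolding R_zero_iff 1 2 by blast
  qed
qed

lemma resultant_fun_normalized:
  assumes "D > 0"
  shows "resultant_fun D (coeffs_of_system (\<lambda>i. mpoly_var i ^ D)) = 1"
proof -
  interpret binary_resultant D "alpha_var D" "beta_var D" "resultant_fun D"
    by (rule binary_resultant_resultant_fun[OF assms])
  have single: "Poly_Mapping.single i D = binary_exponent D a \<longleftrightarrow>
      Poly_Mapping.lookup (Poly_Mapping.single i D) 2 = a" for i :: 2 and a
    by (rule binary_exponent_eq_iff) (use exhaust_2[of i] in \<open>auto simp: UNIV_2 lookup_single when_def\<close>)
  show ?thesis
  proof (rule R_normalized)
    fix a assume "a \<le> D"
    then show "coeffs_of_system (\<lambda>i. mpoly_var i ^ D) (alpha_var D a) = (if a = 0 then 1 else 0)"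
      "coeffs_of_system (\<lambda>i. mpoly_var i ^ D) (beta_var D a) = (if a = 0 then 1 else 0)"
      by (auto simp: coeffs_of_system_def alpha_var_def beta_var_def mpoly_var_power lookup_single
          when_def single)
  qed
qed

text \<open>Uniqueness: any other resultant vanishes on the zeros of \<open>resultant_fun D\<close>,
  hence is a multiple of it. By irreducibility the quotient is a unit and so constant, and the
  normalization makes it 1.\<close>

lemma mpoly_eval_resultant_poly:
  assumes D: "D > 0"
  shows "mpoly_eval x (resultant_poly D) = resultant_fun D x"
proof -
  interpret binary_resultant D "alpha_var D" "beta_var D" "resultant_fun D"
    by (rule binary_resultant_resultant_fun[OF D])
  obtain R where vars: "mpoly_vars R \<subseteq> UNIV \<times> exponents_of_degree D"
    and R: "\<And>x. mpoly_eval x R = resultant_fun D x"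
    using polyfun_imp_mpoly_eval[OF polyfun_resultant_fun[of D]] by metis
  have res: "is_resultant_poly D R"
    unfolding is_resultant_poly_def R
    by (intro conjI allI impI vars irreducible_mpoly[OF R] resultant_fun_eq_0_iff[OF D]
        resultant_fun_normalized[OF D]) simp
  have uniq: "R' = R" if R': "is_resultant_poly D R'" for R'
  proof -
    have pf: "polyfun UNIV (\<lambda>x. mpoly_eval x P)" for P :: "(2 \<times> (2 \<Rightarrow>\<^sub>0 nat), complex) mpoly"
      using polyfun_mpoly_eval by (rule polyfun_mono) simp
    have "mpoly_eval x R' = 0" if x: "resultant_fun D x = 0" for x
    proof -
      \<comment> \<open>\<open>is_resultant_poly\<close> speaks only about systems of forms, whereas
        \<open>x\<close> may take any values at variables that are no coefficients of degree
        \<open>D\<close>. \<open>F\<close> copies the relevant values, and neither polynomial sees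
        the others.\<close>
      define F where "F = (\<lambda>i. \<Sum>e\<in>exponents_of_degree D. Poly_Mapping.single e (x (i, e)))"
      have fin: "finite (exponents_of_degree D :: (2 \<Rightarrow>\<^sub>0 nat) set)"
        unfolding exponents_of_degree_2 by simp
      have lookup_F: "Poly_Mapping.lookup (F i) e = (if e \<in> exponents_of_degree D then x (i, e) else 0)" for i e
        using fin by (simp add: F_def lookup_sum lookup_single when_def sum.delta)
      have F: "homogeneous_of_degree D (F i)" for i
        unfolding homogeneous_of_degree_def by (auto simp: in_keys_iff lookup_F split: if_splits)
      have agree: "coeffs_of_system F v = x v" if "v \<in> UNIV \<times> exponents_of_degree D" for v
        using that by (auto simp: coeffs_of_system_def lookup_F)
      have "resultant_fun D (coeffs_of_system F) = resultant_fun D x"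
        by (rule polyfun_cong_on[OF polyfun_resultant_fun agree])
      with x have "resultant_fun D (coeffs_of_system F) = 0" by simp
      then have "mpoly_eval (coeffs_of_system F) R' = 0"
        using R' F unfolding resultant_fun_eq_0_iff[OF D F] is_resultant_poly_def by blast
      moreover have "mpoly_eval (coeffs_of_system F) R' = mpoly_eval x R'"
        by (rule polyfun_cong_on[OF polyfun_mpoly_eval])
          (use R' agree in \<open>auto simp: is_resultant_poly_def\<close>)
      ultimately show ?thesis by simp
    qed
    from divides[of "\<lambda>x. mpoly_eval x R'", OF pf this] obtain g where g: "polyfun UNIV g"
      "\<forall>x. mpoly_eval x R' = g x * resultant_fun D x" by blast
    from polyfun_imp_mpoly_eval[OF g(1)] obtain G where G: "\<forall>x. g x = mpoly_eval x G" by blast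
    have R'_eq: "R' = G * R"
      by (rule mpoly_eval_inject) (simp add: mpoly_eval_mult g(2) G R)
    have "irreducible R'" using R' by (simp add: is_resultant_poly_def)
    then have "G dvd 1 \<or> R dvd 1" using R'_eq by (rule irreducibleD)
    moreover have "\<not> R dvd 1"
      using irreducible_mpoly[OF R] by (auto simp: irreducible_def)
    ultimately obtain c where c: "1 = G * c" by (auto elim: dvdE)
    let ?u = "coeffs_of_system (\<lambda>i :: 2. mpoly_var i ^ D)"
    have "mpoly_eval ?u R' = 1" using R' by (simp add: is_resultant_poly_def)
    then have "mpoly_eval ?u G = 1"
      using resultant_fun_normalized[OF D] by (simp add: R'_eq mpoly_eval_mult R)
    moreover have "mpoly_eval x G = mpoly_eval ?u G" for x
    proof (rule polyfun_unit_const[of UNIV "\<lambda>x. mpoly_eval x G" "\<lambda>x. mpoly_eval x c"])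
      show "mpoly_eval x G * mpoly_eval x c = 1" for x
        unfolding mpoly_eval_mult[symmetric] c[symmetric] by simp
    qed (rule pf)+
    ultimately have "G = 1" by (intro mpoly_eval_inject) simp
    with R'_eq show ?thesis by simp
  qed
  have "resultant_poly D = R"
    unfolding resultant_poly_def using res uniq by (rule the_equality)
  then show ?thesis by (simp add: R)
qed

subsection \<open>Tensors of dimension two\<close>

lemma count_list_1_2: "count_list is 1 + count_list is 2 = length (is :: 2 list)"
proof (induction "is")
  case (Cons i "is")
  then show ?case using exhaust_2[of i] by auto
qed simp

lemma lookup_tensor_form:
  "Poly_Mapping.lookup (tensor_form m T i) e =
    (\<Sum>is | length is = m - 1 \<and> (\<Sum>j\<leftarrow>is. Poly_Mapping.single j 1) = e. T (i # is))"
proof -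
  have fin: "finite {is :: 'a list. length is = m - 1}"
    using finite_lists_length_eq[of "UNIV :: 'a set" "m - 1"] by simp
  have var: "(\<Prod>j\<leftarrow>is. mpoly_var j) = Poly_Mapping.single (\<Sum>j\<leftarrow>is. Poly_Mapping.single j 1) (1 :: complex)"
    for "is" :: "'a list"
    by (induction "is") (simp_all add: mpoly_var_def mult_single)
  have "Poly_Mapping.lookup (tensor_form m T i) e =
      (\<Sum>is | length is = m - 1. if (\<Sum>j\<leftarrow>is. Poly_Mapping.single j 1) = e then T (i # is) else 0)"
    unfolding tensor_form_def lookup_sum var mpoly_const_def mult_single
    by (simp add: lookup_single when_def)
  also have "\<dots> = (\<Sum>is\<in>{is \<in> {is. length is = m - 1}. (\<Sum>j\<leftarrow>is. Poly_Mapping.single j 1) = e}. T (i # is))"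
    by (rule sum.inter_filter[OF fin, symmetric])
  finally show ?thesis by simp
qed

lemma lookup_sum_list_single: "Poly_Mapping.lookup (\<Sum>j\<leftarrow>is. Poly_Mapping.single j 1) i = count_list is i"
  by (induction "is") (auto simp: lookup_add lookup_single when_def)

lemma sum_list_single_eq_binary_exponent_iff:
  fixes "is" :: "2 list"
  shows "(\<Sum>j\<leftarrow>is. Poly_Mapping.single j 1) = binary_exponent (length is) a \<longleftrightarrow> count_list is 2 = a"
proof -
  have "(\<Sum>i\<in>UNIV. Poly_Mapping.lookup (\<Sum>j\<leftarrow>is. Poly_Mapping.single j (1::nat)) i) = length is"
    by (simp add: lookup_sum_list_single UNIV_2 count_list_1_2 del: One_nat_def)
  from binary_exponent_eq_iff[OF this, of a] show ?thesis
    unfolding lookup_sum_list_single .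
qed

lemma coeffs_tensor_form:
  shows "coeffs_of_system (tensor_form m T) (alpha_var (m - 1) a) = tensor_alpha m T a"
    and "b \<le> m - 1 \<Longrightarrow> coeffs_of_system (tensor_form m T) (beta_var (m - 1) b) = tensor_beta m T b"
proof -
  have sets: "{is. length is = m - 1 \<and> (\<Sum>j\<leftarrow>is. Poly_Mapping.single j 1) = binary_exponent (m - 1) a} =
      {is. length is = m - 1 \<and> count_list is 2 = a}" for a
    by (intro Collect_cong conj_cong refl)
      (use sum_list_single_eq_binary_exponent_iff[of _ a] in metis)
  show "coeffs_of_system (tensor_form m T) (alpha_var (m - 1) a) = tensor_alpha m T a"
    unfolding coeffs_of_system_def alpha_var_def prod.case lookup_tensor_form sets tensor_alpha_def ..
  \<comment> \<open>The subtraction \<open>m - 1 - b\<close> is truncated; within the bound,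
    \<open>m - 1 - b\<close> entries equal to 2 mean exactly \<open>b\<close> entries equal to
    1.\<close>
  assume b: "b \<le> m - 1"
  have "{is :: 2 list. length is = m - 1 \<and> count_list is 2 = m - 1 - b} =
      {is. length is = m - 1 \<and> count_list is 1 = b}"
  proof (intro Collect_cong conj_cong refl)
    fix "is" :: "2 list" assume "length is = m - 1"
    then show "(count_list is 2 = m - 1 - b) = (count_list is 1 = b)"
      using count_list_1_2[of "is"] b by linarith
  qed
  then show "coeffs_of_system (tensor_form m T) (beta_var (m - 1) b) = tensor_beta m T b"
    unfolding coeffs_of_system_def beta_var_def prod.case lookup_tensor_form sets tensor_beta_def
    by (rule sum.cong) simp
qed

lemma lists_without_one_index:
  fixes i j :: 2
  assumes "i \<noteq> j"
  shows "{is. length is = n \<and> count_list is j = 0} = {replicate n i}"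
proof (intro equalityI subsetI)
  fix "is" :: "2 list" assume "is \<in> {is. length is = n \<and> count_list is j = 0}"
  then have "length is = n" "j \<notin> set is" by (auto simp: count_list_0_iff)
  moreover have "k = i \<or> k = j" for k
    using exhaust_2[of i] exhaust_2[of j] exhaust_2[of k] assms by auto
  ultimately show "is \<in> {replicate n i}" by (metis replicate_eqI singletonI)
qed (use assms in \<open>auto simp: count_list_0_iff\<close>)

lemma tensor_diagonal:
  assumes "m \<ge> 1"
  shows "T (replicate m 1) = tensor_alpha m T 0" "T (replicate m 2) = tensor_beta m T 0"
proof -
  obtain n where "m = Suc n" using assms by (cases m) auto
  then show "T (replicate m 1) = tensor_alpha m T 0" "T (replicate m 2) = tensor_beta m T 0"
    by (simp_all add: tensor_alpha_def tensor_beta_def lists_without_one_index[of 1 2]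
        lists_without_one_index[of 2 1])
qed

text \<open>The tuple sums of the trace formula are coefficients of powers: expanding the power
  gives all tuples with sum \<open>s\<close>, and an entry above \<open>m - 1\<close> meets a zero
  coefficient.\<close>

lemma sum_bounded_tuples:
  fixes c :: "nat \<Rightarrow> complex"
  shows "(\<Sum>as\<in>bounded_tuples m h s. \<Prod>a\<leftarrow>as. c a) = coeff ((\<Sum>a\<le>m - 1. monom (c a) a) ^ h) s"
proof -
  let ?p = "\<Sum>a\<le>m - 1. monom (c a) a"
  have "coeff (?p ^ h) s = (\<Sum>as\<in>bounded_tuples m h s. \<Prod>d\<leftarrow>as. coeff ?p d)"
    unfolding coeff_power_list
  proof (intro sum.mono_neutral_right ballI natpermute_finite)
    show "bounded_tuples m h s \<subseteq> natpermute s h"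
      by (auto simp: bounded_tuples_def natpermute_def)
    fix as assume "as \<in> natpermute s h - bounded_tuples m h s"
    then obtain a where "a \<in> set as" "\<not> a \<le> m - 1"
      by (auto simp: bounded_tuples_def natpermute_def)
    then show "(\<Prod>d\<leftarrow>as. coeff ?p d) = 0"
      by (force simp: prod_list_zero_iff coeff_sum_monom)
  qed
  also have "\<dots> = (\<Sum>as\<in>bounded_tuples m h s. \<Prod>a\<leftarrow>as. c a)"
    by (intro sum.cong refl arg_cong[of _ _ prod_list] map_cong)
      (auto simp: bounded_tuples_def coeff_sum_monom)
  finally show ?thesis ..
qed

text \<open>The normalizing factors of the trace cancel: the outer \<open>m - 1\<close> against the
  inner one, and \<open>h + k = d\<close> against the division by \<open>d\<close>, which leaves
  \<open>s / (h * k)\<close>.\<close>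

lemma pencil_log_coeff_tensor:
  assumes m: "m \<ge> 2" and d: "d > 0"
  shows "pencil_log_coeff (m - 1) (\<Sum>a\<le>m - 1. monom (tensor_alpha m T a) a)
      (\<Sum>b\<le>m - 1. monom (tensor_beta m T b) b) d = - tensor_Tr m T d / of_nat d"
proof -
  define D where "D = m - 1"
  have D: "D > 0" using m by (simp add: D_def)
  define A B where "A = (\<Sum>a\<le>D. monom (tensor_alpha m T a) a)"
    and "B = (\<Sum>b\<le>D. monom (tensor_beta m T b) b)"
  have A0: "coeff A 0 = T (replicate m 1)" and B0: "coeff B 0 = T (replicate m 2)"
    using tensor_diagonal[of m T] m by (simp_all add: A_def B_def coeff_sum_monom)
  define I where "I = {(h, k). h + k = d \<and> h \<ge> 1 \<and> k \<ge> (1::nat)}"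
  have inner: "(\<Sum>(as, bs)\<in>bounded_tuples m h s \<times> bounded_tuples m k s.
      (\<Prod>a\<leftarrow>as. tensor_alpha m T a) * (\<Prod>b\<leftarrow>bs. tensor_beta m T b)) =
      coeff (A ^ h) s * coeff (B ^ k) s" for h k s
    unfolding A_def B_def D_def sum_bounded_tuples[symmetric] sum_product
    by (simp add: sum.cartesian_product)
  define X where "X = (\<Sum>(h, k)\<in>I. \<Sum>s = 1..min h k * D.
        of_nat (s * (h + k)) / of_nat (h * k * D) * (coeff (A ^ h) s * coeff (B ^ k) s))"
  define Y where "Y = (\<Sum>(h, k)\<in>I. \<Sum>s = 1..min h k * D.
        of_nat s / (of_nat h * of_nat k) * (coeff (A ^ h) s * coeff (B ^ k) s))"
  have XY: "of_nat D * X / of_nat d = Y"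
    unfolding X_def Y_def sum_distrib_left sum_divide_distrib
  proof (rule sum.cong[OF refl])
    fix hk assume "hk \<in> I"
    then obtain h k where hk: "hk = (h, k)" "h + k = d" by (auto simp: I_def)
    have "of_nat D * (of_nat (s * (h + k)) / of_nat (h * k * D) * X) / of_nat d =
        of_nat s / (of_nat h * of_nat k) * X" for s and X :: complex
      unfolding hk(2) using D d by simp
    then show "of_nat D * (case hk of (h, k) \<Rightarrow> \<Sum>s = 1..min h k * D.
        of_nat (s * (h + k)) / of_nat (h * k * D) * (coeff (A ^ h) s * coeff (B ^ k) s)) / of_nat d =
      (case hk of (h, k) \<Rightarrow> \<Sum>s = 1..min h k * D.
        of_nat s / (of_nat h * of_nat k) * (coeff (A ^ h) s * coeff (B ^ k) s))"
      unfolding hk(1) prod.case sum_distrib_left sum_divide_distrib by simp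
  qed
  have "tensor_Tr m T d = of_nat D * (coeff A 0 ^ d + coeff B 0 ^ d + X)"
    unfolding tensor_Tr_def inner A0 B0 X_def D_def I_def ..
  moreover have "pencil_log_coeff D A B d =
      - (of_nat D * (coeff A 0 ^ d + coeff B 0 ^ d) / of_nat d + Y)"
    unfolding pencil_log_coeff_def I_def[symmetric] Y_def ..
  ultimately have "pencil_log_coeff D A B d = - tensor_Tr m T d / of_nat d"
    unfolding XY[symmetric] by (simp add: distrib_left add_divide_distrib diff_divide_distrib)
  then show ?thesis unfolding A_def B_def D_def .
qed

theorem mainTheorem14:
  fixes m :: nat and T :: "2 list \<Rightarrow> complex"
  assumes "m \<ge> 2"
  shows "Edet m T =
    (\<Sum>i = 1..2 * (m - 1). 1 / fact i *
       (\<Sum>ds | length ds = i \<and> (\<forall>d\<in>set ds. d > 0) \<and> sum_list ds = 2 * (m - 1).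
          \<Prod>d\<leftarrow>ds. - tensor_Tr m T d / of_nat d))"
proof -
  have "Edet m T = resultant_fun (m - 1) (coeffs_of_system (tensor_form m T))"
    unfolding Edet_def Res_def using assms by (intro mpoly_eval_resultant_poly) simp
  also have "\<dots> = exp_trace_form (m - 1) (\<Sum>a\<le>m - 1. monom (tensor_alpha m T a) a)
      (\<Sum>b\<le>m - 1. monom (tensor_beta m T b) b)"
    unfolding resultant_fun_def
    by (intro arg_cong2[of _ _ _ _ "exp_trace_form (m - 1)"] sum.cong refl arg_cong2[of _ _ _ _ monom]
        coeffs_tensor_form) auto
  also have "\<dots> = (\<Sum>i = 1..2 * (m - 1). 1 / fact i *
       (\<Sum>ds | length ds = i \<and> (\<forall>d\<in>set ds. d > 0) \<and> sum_list ds = 2 * (m - 1).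
          \<Prod>d\<leftarrow>ds. - tensor_Tr m T d / of_nat d))"
    unfolding exp_trace_form_def
    by (intro sum.cong refl arg_cong2[of _ _ _ _ "(*)"] arg_cong[of _ _ prod_list] map_cong
        pencil_log_coeff_tensor[OF assms]) simp
  finally show ?thesis .
qed

end
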